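(* For generic limit-periodic $V:\mathbb{Z}\to\mathbb{R}$, the spectrum of $H_{\lambda V^{[k]}}$ is a Cantor set of zero Hausdorff dimension for all $\lambda\neq 0$ (real) and all $k\in\mathbb{N}$. That is, there is a dense $G_\delta$ set $\mathcal{G}\subseteq \mathrm{LP}(\mathbb{Z},\mathbb{R})$ such that for every $V\in\mathcal{G}$, every $\lambda\in\mathbb{R}\setminus\{0\}$ and every $k\in\mathbb{N}$, $\operatorname{spec}(H_{\lambda V^{[k]}})$ is a Cantor set of Hausdorff dimension zero.
   Context: $\mathbb{N}=\{1,2,\ldots\}$. $\mathrm{LP}(\mathbb{Z},\mathbb{R})$ is the set of limit-periodic functions $\mathbb{Z}\to\mathbb{R}$, i.e. the closure, in the uniform ($\ell^\infty$) metric, of the set of periodic functions $\mathbb{Z}\to\mathbb{R}$; it is a complete metric space with the uniform metric. A property holds for generic elements if it holds for all elements of a dense $G_\delta$ subset. For $V:\mathbb{Z}\to\mathbb{R}$ and $k\in\mathbb{N}$, the $k$-fold sieve $V^{[k]}:\mathbb{Z}\to\mathbb{R}$ is defined by $V^{[k]}(n)=V(n/k)$ if $n\in k\mathbb{Z}$ and $V^{[k]}(n)=0$ otherwise. For bounded $W:\mathbb{Z}\to\mathbb{R}$, $H_W$ is the discrete Schr\"odinger operator on $\ell^2(\mathbb{Z})$ given by $[H_W\psi](n)=\psi(n-1)+\psi(n+1)+W(n)\psi(n)$, and $\operatorname{spec}(H_W)\subseteq\mathbb{R}$ is its spectrum. A Cantor set in $\mathbb{R}$ here is a nonempty compact set without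 isolated points and with empty interior. *)

theory Defs
  imports "HOL-Analysis.Analysis"
begin

section \<open>Limit-periodic functions\<close>

text \<open>
  The topology of \<^typ>\<open>int\<close> is discrete, so \<^typ>\<open>int \<Rightarrow>\<^sub>C real\<close> is the space of all bounded
  functions on the integers, and its metric is the uniform one.
\<close>

lemma bcontfun_int_iff: "(f :: int \<Rightarrow> real) \<in> bcontfun \<longleftrightarrow> bounded (range f)"
  by (simp add: bcontfun_def continuous_on_discrete)

definition periodic_fun :: "(int \<Rightarrow> real) \<Rightarrow> bool" where
  "periodic_fun V \<longleftrightarrow> (\<exists>p>0. \<forall>n. V (n + p) = V n)"

definition limit_periodic :: "(int \<Rightarrow>\<^sub>C real) set" where
  "limit_periodic = closure {V. periodic_fun (apply_bcontfun V)}"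

definition sieve :: "nat \<Rightarrow> (int \<Rightarrow> real) \<Rightarrow> int \<Rightarrow> real" where
  "sieve k V n = (if int k dvd n then V (n div int k) else 0)"


section \<open>Operators on square-summable sequences and their spectrum\<close>

text \<open>
  Operators are functions on all complex sequences; only their action on \<open>ell2\<close> matters.
\<close>

definition ell2 :: "(int \<Rightarrow> complex) set" where
  "ell2 = {\<psi>. (\<lambda>n. (cmod (\<psi> n))\<^sup>2) summable_on UNIV}"

definition ell2_norm :: "(int \<Rightarrow> complex) \<Rightarrow> real" where
  "ell2_norm \<psi> = sqrt (\<Sum>\<^sub>\<infinity>n. (cmod (\<psi> n))\<^sup>2)"

definition bounded_op :: "((int \<Rightarrow> complex) \<Rightarrow> (int \<Rightarrow> complex)) \<Rightarrow> bool" where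
  "bounded_op T \<longleftrightarrow>
     (\<forall>\<psi>\<in>ell2. T \<psi> \<in> ell2) \<and>
     (\<forall>\<phi>\<in>ell2. \<forall>\<psi>\<in>ell2. T (\<lambda>n. \<phi> n + \<psi> n) = (\<lambda>n. T \<phi> n + T \<psi> n)) \<and>
     (\<forall>c. \<forall>\<psi>\<in>ell2. T (\<lambda>n. c * \<psi> n) = (\<lambda>n. c * T \<psi> n)) \<and>
     (\<exists>C. \<forall>\<psi>\<in>ell2. ell2_norm (T \<psi>) \<le> C * ell2_norm \<psi>)"

definition resolvent_set :: "((int \<Rightarrow> complex) \<Rightarrow> (int \<Rightarrow> complex)) \<Rightarrow> complex set" where
  "resolvent_set T =
     {z. \<exists>R. bounded_op R \<and>
        (\<forall>\<psi>\<in>ell2. R (\<lambda>n. T \<psi> n - z * \<psi> n) = \<psi> \<and>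
                  (\<lambda>n. T (R \<psi>) n - z * R \<psi> n) = \<psi>)}"

definition op_spectrum :: "((int \<Rightarrow> complex) \<Rightarrow> (int \<Rightarrow> complex)) \<Rightarrow> complex set" where
  "op_spectrum T = - resolvent_set T"

definition schrodinger :: "(int \<Rightarrow> real) \<Rightarrow> (int \<Rightarrow> complex) \<Rightarrow> (int \<Rightarrow> complex)" where
  "schrodinger W \<psi> n = \<psi> (n - 1) + \<psi> (n + 1) + complex_of_real (W n) * \<psi> n"


section \<open>Cantor sets and Hausdorff dimension\<close>

definition cantor_set :: "real set \<Rightarrow> bool" where
  "cantor_set K \<longleftrightarrow> K \<noteq> {} \<and> compact K \<and> (\<forall>x. \<not> x isolated_in K) \<and> interior K = {}"

text \<open>
  Boundedness of the covering sets is required explicitly because \<^const>\<open>diameter\<close> is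
  unspecified on unbounded sets.
\<close>

definition hausdorff_premeasure :: "real \<Rightarrow> real \<Rightarrow> 'a::metric_space set \<Rightarrow> ennreal" where
  "hausdorff_premeasure \<delta> s A =
     (INF U \<in> {U :: nat \<Rightarrow> 'a set. A \<subseteq> (\<Union>i. U i) \<and> (\<forall>i. bounded (U i) \<and> diameter (U i) \<le> \<delta>)}.
        \<Sum>i. ennreal (diameter (U i) powr s))"

definition hausdorff_measure :: "real \<Rightarrow> 'a::metric_space set \<Rightarrow> ennreal" where
  "hausdorff_measure s A = (SUP \<delta>\<in>{0<..}. hausdorff_premeasure \<delta> s A)"

text \<open>
  The infimum over \<open>s > 0\<close> equals the usual one over \<open>s \<ge> 0\<close>, and it avoids the convention
  for \<open>0\<^sup>0\<close> that the zero-dimensional measure needs.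
\<close>

definition hausdorff_dim :: "'a::metric_space set \<Rightarrow> ennreal" where
  "hausdorff_dim A = (INF s \<in> {s. 0 < s \<and> hausdorff_measure s A = 0}. ennreal s)"

end

theory Submission
  imports Defs
begin

text \<open>
  Fix a periodic \<open>V\<close>. After a small periodic change of \<open>V\<close> any given energy \<open>E\<close>, apart from the
  finitely many zeros of a Chebyshev polynomial, falls into a gap of the sieved operator: a shift of
  \<open>V\<close> makes the monodromy of finite order, and changing two neighbouring values makes it
  hyperbolic. By compactness finitely many changes \<open>U\<^sub>i\<close> serve all energies and couplings in a
  compact range. Let \<open>V'\<close> be periodic with long blocks on which it equals the various \<open>U\<^sub>i\<close>. An
  approximate eigenfunction at \<open>E\<close> is exponentially small in the middle of the blocks for which
  \<open>E\<close> is in a gap, so \<open>E\<close> is exponentially close to an eigenvalue of the operator cut there.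
  The number of these eigenvalues grows only linearly in the block length, so the spectrum is
  covered by few tiny intervals; this survives small perturbations, and Baire's theorem applies.
\<close>


section \<open>Square-summable real sequences\<close>

text \<open>The sieve creates one obstruction. If \<open>E\<close> is a Dirichlet eigenvalue of the
  k - 1 free sites between multiples of k, the eigenfunction, continued by odd reflection, is a
  bounded solution vanishing on all multiples of k. It does not see the potential, so no change of
  \<open>V\<close> can open a gap at \<open>E\<close>. These are the Chebyshev zeros; there are
  fewer than k of them, independent of \<open>V\<close> and of the coupling, so they are simply
  covered by small balls of their own. Blocks are interleaved because no single periodic potential
  has all energies in gaps, whereas an energy needs only one block that repels it. The gap constant
  is fixed before the block length, so long blocks gain precision at a fixed exponential rate.
  Uncountably many couplings are compatible with a countable intersection because one integer M
  bounds k, the coupling, its reciprocal and the quality of the cover. The absence of isolated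
  points is a separate matter: it holds for every limit-periodic \<open>V\<close> and rests on
  almost periodicity. All operators act on real sequences, and spectral facts are derived from
  Cauchy-Schwarz for nonnegative forms instead of a spectral theorem.\<close>

typedef rl2 = "{u :: int \<Rightarrow> real. (\<lambda>n. (u n)\<^sup>2) summable_on UNIV}"
  morphisms seq Abs_rl2
  by (rule exI[of _ "\<lambda>_. 0"]) simp

setup_lifting type_definition_rl2

lemma rl2_eqI: "(\<And>n. seq u n = seq v n) \<Longrightarrow> u = v"
  by (simp add: seq_inject[symmetric] fun_eq_iff)

lemma square_summable_mult:
  fixes u v :: "int \<Rightarrow> real"
  assumes "(\<lambda>n. (u n)\<^sup>2) summable_on UNIV" "(\<lambda>n. (v n)\<^sup>2) summable_on UNIV"
  shows "(\<lambda>n. u n * v n) summable_on UNIV"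
proof -
  have "(\<lambda>n. \<bar>u n * v n\<bar>) summable_on UNIV"
  proof (rule summable_on_comparison_test)
    show "(\<lambda>n. (u n)\<^sup>2 + (v n)\<^sup>2) summable_on UNIV"
      using assms by (rule summable_on_add)
    show "\<bar>u n * v n\<bar> \<le> (u n)\<^sup>2 + (v n)\<^sup>2" for n
    proof -
      have "2 * \<bar>u n * v n\<bar> \<le> (u n)\<^sup>2 + (v n)\<^sup>2"
        using sum_squares_bound[of "\<bar>u n\<bar>" "\<bar>v n\<bar>"] by (simp add: abs_mult)
      then show ?thesis by (smt (verit) abs_ge_zero)
    qed
  qed simp
  then show ?thesis
    by (subst summable_on_iff_abs_summable_on_real) simp
qed

lemma square_summable_add:
  fixes u v :: "int \<Rightarrow> real"
  assumes "(\<lambda>n. (u n)\<^sup>2) summable_on UNIV" "(\<lambda>n. (v n)\<^sup>2) summable_on UNIV"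
  shows "(\<lambda>n. (u n + v n)\<^sup>2) summable_on UNIV"
proof -
  have "(\<lambda>n. (u n)\<^sup>2 + (v n)\<^sup>2 + 2 * (u n * v n)) summable_on UNIV"
    by (intro summable_on_add summable_on_cmult_right square_summable_mult assms)
  then show ?thesis by (simp add: power2_sum mult.assoc)
qed

instantiation rl2 :: real_vector
begin

lift_definition zero_rl2 :: rl2 is "\<lambda>_. 0" by simp

lift_definition plus_rl2 :: "rl2 \<Rightarrow> rl2 \<Rightarrow> rl2" is "\<lambda>u v n. u n + v n"
  by (rule square_summable_add)

lift_definition uminus_rl2 :: "rl2 \<Rightarrow> rl2" is "\<lambda>u n. - u n" by simp

lift_definition scaleR_rl2 :: "real \<Rightarrow> rl2 \<Rightarrow> rl2" is "\<lambda>c u n. c * u n"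
  by (simp add: power_mult_distrib summable_on_cmult_right)

definition minus_rl2 :: "rl2 \<Rightarrow> rl2 \<Rightarrow> rl2" where
  "u - v = u + - (v :: rl2)"

instance
proof
  fix a b :: real and u v w :: rl2
  show "u + v + w = u + (v + w)" by transfer (simp add: fun_eq_iff)
  show "u + v = v + u" by transfer (simp add: fun_eq_iff)
  show "0 + u = u" by transfer simp
  show "- u + u = 0" by transfer simp
  show "u - v = u + - v" by (rule minus_rl2_def)
  show "a *\<^sub>R (u + v) = a *\<^sub>R u + a *\<^sub>R v" by transfer (simp add: fun_eq_iff algebra_simps)
  show "(a + b) *\<^sub>R u = a *\<^sub>R u + b *\<^sub>R u" by transfer (simp add: fun_eq_iff algebra_simps)
  show "a *\<^sub>R b *\<^sub>R u = (a * b) *\<^sub>R u" by transfer (simp add: fun_eq_iff)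
  show "1 *\<^sub>R u = u" by transfer simp
qed

end

instantiation rl2 :: real_inner
begin

definition inner_rl2 :: "rl2 \<Rightarrow> rl2 \<Rightarrow> real" where
  "inner_rl2 u v = (\<Sum>\<^sub>\<infinity>n. seq u n * seq v n)"

definition norm_rl2 :: "rl2 \<Rightarrow> real" where
  "norm_rl2 u = sqrt (inner u u)"

definition dist_rl2 :: "rl2 \<Rightarrow> rl2 \<Rightarrow> real" where
  "dist_rl2 u v = norm (u - v)"

definition sgn_rl2 :: "rl2 \<Rightarrow> rl2" where
  "sgn_rl2 u = u /\<^sub>R norm u"

definition uniformity_rl2 :: "(rl2 \<times> rl2) filter" where
  "uniformity_rl2 = (INF e\<in>{0 <..}. principal {(u, v). dist u v < e})"

definition open_rl2 :: "rl2 set \<Rightarrow> bool" where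
  "open_rl2 S = (\<forall>u\<in>S. \<forall>\<^sub>F (u', v) in uniformity. u' = u \<longrightarrow> v \<in> S)"

instance
proof
  fix a :: real and u v w :: rl2
  show "sgn u = u /\<^sub>R norm u" by (rule sgn_rl2_def)
  show "dist u v = norm (u - v)" by (rule dist_rl2_def)
  show "uniformity = (INF e\<in>{0 <..}. principal {(u :: rl2, v). dist u v < e})"
    by (rule uniformity_rl2_def)
  show "open S = (\<forall>u\<in>S. \<forall>\<^sub>F (u', v) in uniformity. u' = u \<longrightarrow> v \<in> S)" for S :: "rl2 set"
    by (rule open_rl2_def)
  show "inner u v = inner v u"
    by (simp add: inner_rl2_def mult.commute)
  have s: "(\<lambda>n. seq u n * seq v n) summable_on UNIV" for u v
    using seq[of u] seq[of v] by (intro square_summable_mult) auto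
  show "inner (u + v) w = inner u w + inner v w"
    by (simp add: inner_rl2_def plus_rl2.rep_eq distrib_right infsum_add s)
  show "inner (a *\<^sub>R u) v = a * inner u v"
    by (simp add: inner_rl2_def scaleR_rl2.rep_eq mult.assoc infsum_cmult_right')
  show "0 \<le> inner u u"
    unfolding inner_rl2_def by (intro infsum_nonneg) simp
  show "inner u u = 0 \<longleftrightarrow> u = 0"
  proof
    assume "inner u u = 0"
    then have "seq u n * seq u n = 0" for n
      unfolding inner_rl2_def by (intro nonneg_infsum_le_0D[OF _ s]) auto
    then show "u = 0" by (intro rl2_eqI) (simp add: zero_rl2.rep_eq)
  qed (simp add: inner_rl2_def zero_rl2.rep_eq)
  show "norm u = sqrt (inner u u)" by (rule norm_rl2_def)
qed

end

lemma seq_zero [simp]: "seq 0 n = 0"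
  and seq_add [simp]: "seq (u + v) n = seq u n + seq v n"
  and seq_uminus [simp]: "seq (- u) n = - seq u n"
  and seq_scaleR [simp]: "seq (c *\<^sub>R u) n = c * seq u n"
  by (simp_all add: zero_rl2.rep_eq plus_rl2.rep_eq uminus_rl2.rep_eq scaleR_rl2.rep_eq)

lemma seq_diff [simp]: "seq (u - v) n = seq u n - seq v n"
  unfolding minus_rl2_def[of u v] seq_add seq_uminus by (rule add_uminus_conv_diff)

lemma seq_sum [simp]: "seq (\<Sum>i\<in>I. u i) n = (\<Sum>i\<in>I. seq (u i) n)"
  by (induction I rule: infinite_finite_induct) auto

lemma seq_square_summable: "(\<lambda>n. (seq u n)\<^sup>2) summable_on UNIV"
  using seq[of u] by simp

lemma norm_rl2_square: "(norm (u :: rl2))\<^sup>2 = (\<Sum>\<^sub>\<infinity>n. (seq u n)\<^sup>2)"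
  unfolding power2_norm_eq_inner inner_rl2_def by (simp add: power2_eq_square)

lemma abs_seq_le_norm: "\<bar>seq u n\<bar> \<le> norm u"
proof -
  have "(\<Sum>m\<in>{n}. (seq u m)\<^sup>2) \<le> (norm u)\<^sup>2"
    unfolding norm_rl2_square
    by (intro finite_sum_le_infsum seq_square_summable) auto
  then show ?thesis by (simp add: abs_le_square_iff[symmetric])
qed

lemma rl2_normI:
  assumes "\<And>F. finite F \<Longrightarrow> (\<Sum>n\<in>F. (seq u n)\<^sup>2) \<le> c\<^sup>2" "0 \<le> c"
  shows "norm u \<le> c"
proof -
  have "(norm u)\<^sup>2 \<le> c\<^sup>2"
    unfolding norm_rl2_square
    by (rule infsum_le_finite_sums[OF seq_square_summable]) (rule assms(1))
  then show ?thesis using assms(2) by (rule power2_le_imp_le)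
qed

lemma norm_rl2_mono:
  assumes "\<And>n. \<bar>seq u n\<bar> \<le> \<bar>seq v n\<bar>"
  shows "norm u \<le> norm v"
proof (rule rl2_normI)
  fix F :: "int set" assume "finite F"
  have "(\<Sum>n\<in>F. (seq u n)\<^sup>2) \<le> (\<Sum>n\<in>F. (seq v n)\<^sup>2)"
    by (intro sum_mono) (use assms in \<open>simp add: abs_le_square_iff\<close>)
  also have "\<dots> \<le> (norm v)\<^sup>2"
    unfolding norm_rl2_square
    by (intro finite_sum_le_infsum seq_square_summable \<open>finite F\<close>) auto
  finally show "(\<Sum>n\<in>F. (seq u n)\<^sup>2) \<le> (norm v)\<^sup>2" .
qed simp

instance rl2 :: banach
proof
  fix X :: "nat \<Rightarrow> rl2" assume "Cauchy X"
  have C: "\<exists>N. \<forall>m\<ge>N. \<forall>n\<ge>N. norm (X m - X n) < e" if "0 < e" for e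
    using \<open>Cauchy X\<close> that unfolding Cauchy_def dist_norm by blast
  have "Cauchy (\<lambda>i. seq (X i) n)" for n
    unfolding Cauchy_def
  proof (intro allI impI)
    fix e :: real assume "0 < e"
    then obtain N where N: "\<And>i j. i \<ge> N \<Longrightarrow> j \<ge> N \<Longrightarrow> norm (X i - X j) < e"
      using C[OF \<open>0 < e\<close>] by blast
    have "dist (seq (X i) n) (seq (X j) n) < e" if "i \<ge> N" "j \<ge> N" for i j
      using abs_seq_le_norm[of "X i - X j" n] N[OF that] by (simp add: dist_real_def)
    then show "\<exists>N. \<forall>i\<ge>N. \<forall>j\<ge>N. dist (seq (X i) n) (seq (X j) n) < e"
      by (intro exI[of _ N]) simp
  qed
  then have "\<forall>n. \<exists>l. (\<lambda>i. seq (X i) n) \<longlonglongrightarrow> l"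
    using Cauchy_convergent_iff convergent_def by blast
  then obtain l where l: "\<And>n. (\<lambda>i. seq (X i) n) \<longlonglongrightarrow> l n" by metis
  \<comment> \<open>The Cauchy estimate survives the pointwise limit on finite index sets, which
    takes the place of Fatou's lemma. It is used twice: for membership of the limit in the space and
    for convergence.\<close>
  have fin: "(\<Sum>n\<in>F. (seq (X i) n - l n)\<^sup>2) \<le> e\<^sup>2"
    if "finite F" and N: "\<And>i j. i \<ge> N \<Longrightarrow> j \<ge> N \<Longrightarrow> norm (X i - X j) < e" and "i \<ge> N" for F i e N
  proof (rule LIMSEQ_le_const2)
    show "(\<lambda>j. \<Sum>n\<in>F. (seq (X i) n - seq (X j) n)\<^sup>2) \<longlonglongrightarrow> (\<Sum>n\<in>F. (seq (X i) n - l n)\<^sup>2)"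
      by (intro tendsto_intros l)
    have "(\<Sum>n\<in>F. (seq (X i) n - seq (X j) n)\<^sup>2) \<le> e\<^sup>2" if "j \<ge> N" for j
    proof -
      have "(\<Sum>n\<in>F. (seq (X i - X j) n)\<^sup>2) \<le> (norm (X i - X j))\<^sup>2"
        unfolding norm_rl2_square
        by (intro finite_sum_le_infsum seq_square_summable \<open>finite F\<close>) auto
      also have "\<dots> \<le> e\<^sup>2"
        using N[OF \<open>i \<ge> N\<close> that] by (intro power_mono) auto
      finally show ?thesis by simp
    qed
    then show "\<exists>N. \<forall>j\<ge>N. (\<Sum>n\<in>F. (seq (X i) n - seq (X j) n)\<^sup>2) \<le> e\<^sup>2" by blast
  qed
  obtain N where N: "\<And>i j. i \<ge> N \<Longrightarrow> j \<ge> N \<Longrightarrow> norm (X i - X j) < 1"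
    using C[of 1] by auto
  have "(\<lambda>n. (seq (X N) n - l n)\<^sup>2) summable_on UNIV"
    by (rule nonneg_bdd_above_summable_on)
       (use fin[OF _ N] in \<open>auto simp: bdd_above_def\<close>)
  then have "(\<lambda>n. (seq (X N) n + - (seq (X N) n - l n))\<^sup>2) summable_on UNIV"
    by (intro square_summable_add seq_square_summable) (simp add: power2_commute)
  then have l2: "(\<lambda>n. (l n)\<^sup>2) summable_on UNIV" by simp
  define L where "L = Abs_rl2 l"
  have L: "seq L = l" using l2 by (simp add: L_def Abs_rl2_inverse)
  have "X \<longlonglongrightarrow> L"
    unfolding LIMSEQ_def dist_norm
  proof (intro allI impI)
    fix e :: real assume e: "0 < e"
    then obtain N where N: "\<And>i j. i \<ge> N \<Longrightarrow> j \<ge> N \<Longrightarrow> norm (X i - X j) < e / 2"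
      using C[of "e/2"] by auto
    have "norm (X i - L) < e" if "i \<ge> N" for i
    proof -
      have "norm (X i - L) \<le> e / 2"
        by (rule rl2_normI) (use fin[OF _ N that] e L in auto)
      then show ?thesis using e by simp
    qed
    then show "\<exists>N. \<forall>i\<ge>N. norm (X i - L) < e" by (intro exI[of _ N]) simp
  qed
  then show "convergent X" by (auto simp: convergent_def)
qed

section \<open>Shifts and multiplication operators\<close>

lift_definition shift :: "int \<Rightarrow> rl2 \<Rightarrow> rl2" is "\<lambda>k u n. u (n + k)"
proof -
  fix k and u :: "int \<Rightarrow> real" assume "(\<lambda>n. (u n)\<^sup>2) summable_on UNIV"
  then show "(\<lambda>n. (u (n + k))\<^sup>2) summable_on UNIV"
    using summable_on_reindex_bij_betw[of "\<lambda>n. n + k" UNIV UNIV "\<lambda>n. (u n)\<^sup>2"]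
    by (simp add: bij_betw_def inj_on_def surj_plus_right)
qed

lemma bij_int_add: "bij (\<lambda>n :: int. n + k)"
  by (simp add: bij_def inj_on_def surj_plus_right)

lemma seq_shift [simp]: "seq (shift k u) n = seq u (n + k)"
  by (simp add: shift.rep_eq)

lemma inner_shift: "inner (shift k u) (shift k v) = inner u v"
  using infsum_reindex_bij_betw[OF bij_int_add[of k], of "\<lambda>n. seq u n * seq v n"]
  by (simp add: inner_rl2_def)

lemma norm_shift [simp]: "norm (shift k u) = norm u"
  by (simp add: norm_eq_sqrt_inner inner_shift)

lemma inner_shift_left: "inner (shift k u) v = inner u (shift (- k) v)"
proof -
  have "shift k (shift (- k) v) = v" by (rule rl2_eqI) simp
  then show ?thesis using inner_shift[of k u "shift (- k) v"] by simp
qed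

text \<open>
  The value \<open>0\<close> for unbounded \<open>g\<close> makes \<open>mul g\<close> bounded and symmetric without hypotheses.
\<close>

lift_definition mul :: "(int \<Rightarrow> real) \<Rightarrow> rl2 \<Rightarrow> rl2" is
  "\<lambda>g u n. if bounded (range g) then g n * u n else 0"
proof -
  fix g u :: "int \<Rightarrow> real" assume u: "(\<lambda>n. (u n)\<^sup>2) summable_on UNIV"
  show "(\<lambda>n. (if bounded (range g) then g n * u n else 0)\<^sup>2) summable_on UNIV"
  proof (cases "bounded (range g)")
    case True
    then obtain B where B: "\<And>n. \<bar>g n\<bar> \<le> B" by (auto simp: bounded_iff)
    have "(\<lambda>n. (g n * u n)\<^sup>2) summable_on UNIV"
    proof (rule summable_on_comparison_test)
      show "(\<lambda>n. B\<^sup>2 * (u n)\<^sup>2) summable_on UNIV" using u by (rule summable_on_cmult_right)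
      show "(g n * u n)\<^sup>2 \<le> B\<^sup>2 * (u n)\<^sup>2" for n
        using B[of n] by (simp add: power_mult_distrib mult_right_mono abs_le_square_iff[symmetric])
    qed simp
    then show ?thesis using True by simp
  qed simp
qed

lemma seq_mul [simp]: "bounded (range g) \<Longrightarrow> seq (mul g u) n = g n * seq u n"
  by (simp add: mul.rep_eq)

lemma inner_mul: "inner (mul g u) v = inner u (mul g v)"
  by (cases "bounded (range g)") (simp_all add: inner_rl2_def mul.rep_eq mult_ac)

lemma mul_bounded_by:
  assumes "\<And>n. \<bar>g n\<bar> \<le> B"
  shows "bounded (range g)" and "norm (mul g u) \<le> B * norm u"
proof -
  show b: "bounded (range g)" using assms by (auto simp: bounded_iff)
  have "0 \<le> B" using assms[of 0] by linarith
  have "norm (mul g u) \<le> norm (B *\<^sub>R u)"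
    by (rule norm_rl2_mono) (use b assms \<open>0 \<le> B\<close> in \<open>simp add: abs_mult mult_right_mono\<close>)
  then show "norm (mul g u) \<le> B * norm u" using \<open>0 \<le> B\<close> by simp
qed

lemma bounded_range_indicat [simp]: "bounded (range (indicat_real (A :: int set)))"
  using mul_bounded_by(1)[of "indicat_real A" 1] by (simp add: indicator_def)

lemma norm_mul_indicat_le: "norm (mul (indicat_real A) u) \<le> norm u"
  using mul_bounded_by(2)[of "indicat_real A" 1 u] by (simp add: indicator_def)

text \<open>Turns a pointwise estimate with a finite stencil into a norm estimate. Multiplying
  \<open>f\<close> by its sign realises the sequence of absolute values inside \<open>rl2\<close>,
  so the dominating sequence is itself a sum of shifts and the triangle inequality applies.\<close>

lemma norm_le_sum_shifts:
  assumes "finite J" "0 \<le> C"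
    and "\<And>n. \<bar>seq u n\<bar> \<le> C * (\<Sum>j\<in>J. \<bar>seq f (n + j)\<bar>)"
  shows "norm u \<le> C * card J * norm f"
proof -
  define g where "g n = sgn (seq f n)" for n
  have "\<bar>g n\<bar> \<le> 1" for n by (simp add: g_def sgn_if)
  note g = mul_bounded_by[of g, OF this]
  have gf: "g n * seq f n = \<bar>seq f n\<bar>" for n
    by (simp add: g_def sgn_if)
  let ?v = "C *\<^sub>R (\<Sum>j\<in>J. shift j (mul g f))"
  have "norm u \<le> norm ?v"
  proof (rule norm_rl2_mono)
    fix n show "\<bar>seq u n\<bar> \<le> \<bar>seq ?v n\<bar>"
      using assms(3)[of n] g(1) gf by simp
  qed
  also have "\<dots> \<le> C * (\<Sum>j\<in>J. norm (shift j (mul g f)))"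
    using \<open>0 \<le> C\<close> norm_sum[of "\<lambda>j. shift j (mul g f)" J] by (simp add: mult_left_mono)
  also have "\<dots> \<le> C * (\<Sum>j\<in>J. norm f)"
    using g(2) \<open>0 \<le> C\<close> by (intro mult_left_mono sum_mono) auto
  finally show ?thesis by simp
qed

lemma seq_tendsto_0: 
  assumes "inj h" shows "(\<lambda>i :: nat. seq u (h i)) \<longlonglongrightarrow> 0"
proof -
  have "(\<lambda>n. (seq u n)\<^sup>2) summable_on range h"
    using seq_square_summable by (rule summable_on_subset) simp
  then have "(\<lambda>i. (seq u (h i))\<^sup>2) summable_on UNIV"
    using summable_on_reindex[OF assms, of "\<lambda>n. (seq u n)\<^sup>2"] by (simp add: o_def)
  then have "(\<lambda>i. (seq u (h i))\<^sup>2) \<longlonglongrightarrow> 0"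
    by (intro summable_LIMSEQ_zero summable_on_imp_summable)
  then have "(\<lambda>i. sqrt ((seq u (h i))\<^sup>2)) \<longlonglongrightarrow> sqrt 0"
    by (rule tendsto_real_sqrt)
  then show ?thesis by (simp add: tendsto_rabs_zero_iff)
qed


section \<open>The spectrum of a bounded symmetric operator\<close>

definition bounded_below :: "('a::real_normed_vector \<Rightarrow> 'a) \<Rightarrow> real \<Rightarrow> real \<Rightarrow> bool" where
  "bounded_below T E d \<longleftrightarrow> (\<forall>u. d * norm u \<le> norm (T u - E *\<^sub>R u))"

text \<open>The approximate point spectrum. For a bounded symmetric operator it is the whole
  spectrum; \<open>op_spectrum_schrodinger\<close> proves this for the operators at hand.\<close>

definition approx_spectrum :: "('a::real_normed_vector \<Rightarrow> 'a) \<Rightarrow> real set" where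
  "approx_spectrum T = {E. \<forall>d>0. \<not> bounded_below T E d}"

lemma bounded_belowD: "bounded_below T E d \<Longrightarrow> d * norm u \<le> norm (T u - E *\<^sub>R u)"
  by (simp add: bounded_below_def)

lemma not_in_approx_spectrum: "E \<notin> approx_spectrum T \<longleftrightarrow> (\<exists>d>0. bounded_below T E d)"
  by (auto simp: approx_spectrum_def)

lemma in_approx_spectrumE:
  assumes "E \<in> approx_spectrum T" "0 < d"
  obtains u where "norm (T u - E *\<^sub>R u) < d * norm u"
  using assms by (auto simp: approx_spectrum_def bounded_below_def not_le)

lemma bounded_below_perturb:
  assumes "bounded_below T E d" "\<And>u. norm (T u - T' u) \<le> e * norm u"
  shows "bounded_below T' E' (d - e - \<bar>E - E'\<bar>)"
  unfolding bounded_below_def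
proof
  fix u
  have "d * norm u \<le> norm (T u - E *\<^sub>R u)" using assms(1) by (rule bounded_belowD)
  also have "T u - E *\<^sub>R u = (T' u - E' *\<^sub>R u) + (T u - T' u) + (E' - E) *\<^sub>R u"
    by (simp add: algebra_simps)
  also have "norm \<dots> \<le> norm (T' u - E' *\<^sub>R u) + norm (T u - T' u) + norm ((E' - E) *\<^sub>R u)"
    by (intro norm_triangle_mono order_refl)
  also have "\<dots> \<le> norm (T' u - E' *\<^sub>R u) + e * norm u + \<bar>E - E'\<bar> * norm u"
    using assms(2)[of u] by (simp add: abs_minus_commute)
  finally show "(d - e - \<bar>E - E'\<bar>) * norm u \<le> norm (T' u - E' *\<^sub>R u)"
    by (simp add: algebra_simps)
qed

lemma closed_approx_spectrum: "closed (approx_spectrum T)"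
proof -
  have "open (- approx_spectrum T)"
    unfolding open_dist
  proof
    fix E assume "E \<in> - approx_spectrum T"
    then obtain d where d: "d > 0" "bounded_below T E d"
      by (auto simp: not_in_approx_spectrum)
    have "E' \<notin> approx_spectrum T" if "dist E' E < d" for E'
    proof -
      have "bounded_below T E' (d - 0 - \<bar>E - E'\<bar>)"
        by (rule bounded_below_perturb[OF d(2)]) simp
      moreover have "0 < d - 0 - \<bar>E - E'\<bar>"
        using that by (simp add: dist_real_def abs_minus_commute)
      ultimately show ?thesis unfolding not_in_approx_spectrum by blast
    qed
    then show "\<exists>e>0. \<forall>E'. dist E' E < e \<longrightarrow> E' \<in> - approx_spectrum T"
      using d(1) by auto
  qed
  then show ?thesis by (simp add: closed_def)
qed

lemma nonneg_form_cauchy_schwarz: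
  fixes B :: "'a::real_inner \<Rightarrow> 'a"
  assumes "linear B" and sym: "\<And>u v. inner (B u) v = inner u (B v)"
    and nonneg: "\<And>u. 0 \<le> inner (B u) u"
  shows "(inner (B u) v)\<^sup>2 \<le> inner (B u) u * inner (B v) v"
proof -
  interpret linear B by fact
  define a b c where "a = inner (B u) u" and "b = inner (B u) v" and "c = inner (B v) v"
  have bc: "inner (B v) u = b"
    using sym[of v u] by (simp add: b_def inner_commute)
  have q: "0 \<le> a + 2 * t * b + t\<^sup>2 * c" for t
  proof -
    have "inner (B (u + t *\<^sub>R v)) (u + t *\<^sub>R v) = a + 2 * t * b + t\<^sup>2 * c"
      using bc by (simp add: add scaleR inner_add_left inner_add_right a_def c_def
          b_def[symmetric] power2_eq_square algebra_simps)
    then show ?thesis using nonneg[of "u + t *\<^sub>R v"] by simp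
  qed
  have a0: "0 \<le> a" "0 \<le> c" using nonneg by (auto simp: a_def c_def)
  show ?thesis
  proof (cases "c = 0")
    case True
    have "b = 0"
    proof (rule ccontr)
      assume "b \<noteq> 0"
      \<comment> \<open>For \<open>c = 0\<close> the quadratic is affine in t, and this t is the one
        where it would take the value - 1.\<close>
      have "0 \<le> a + 2 * (- (a + 1) / (2 * b)) * b" using q[of "- (a + 1) / (2 * b)"] True by simp
      also have "\<dots> = - 1" using \<open>b \<noteq> 0\<close> by (simp add: field_simps)
      finally show False by simp
    qed
    then show ?thesis using a0 by (simp add: a_def b_def c_def)
  next
    case False
    then have "0 < c" using a0 by simp
    have "0 \<le> a + 2 * (- b / c) * b + (- b / c)\<^sup>2 * c" by (rule q)
    also have "\<dots> = a - b\<^sup>2 / c" using \<open>0 < c\<close> by (simp add: field_simps power2_eq_square)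
    finally have "b\<^sup>2 \<le> a * c" using \<open>0 < c\<close> by (simp add: field_simps)
    then show ?thesis by (simp add: a_def b_def c_def)
  qed
qed

locale symmetric_operator =
  fixes T :: "'a::real_inner \<Rightarrow> 'a"
  assumes bounded: "bounded_linear T"
    and symmetric: "inner (T u) v = inner u (T v)"
begin

sublocale T: bounded_linear T by (rule bounded)

lemma symmetric_shift: "inner (T u - E *\<^sub>R u) v = inner u (T v - E *\<^sub>R v)"
  by (simp add: inner_diff_left inner_diff_right symmetric)

lemma shift_operator: "symmetric_operator (\<lambda>u. T u - E *\<^sub>R u)"
  by (intro symmetric_operator.intro bounded_linear_sub bounded bounded_linear_scaleR_right
      symmetric_shift)

text \<open>
  With \<open>a\<close> the infimum of \<open>norm (T u - E u)\<close> over unit vectors, \<open>B = (T - E)\<^sup>2 - a\<^sup>2\<close> is a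
  nonnegative form that comes arbitrarily close to \<open>0\<close>; by Cauchy-Schwarz \<open>B u\<close> is then small,
  so one of the factors \<open>T - (E + a)\<close> and \<open>T - (E - a)\<close> is not bounded below.
\<close>

lemma approx_spectrum_near:
  assumes u0: "u0 \<noteq> 0" and "norm (T u0 - E *\<^sub>R u0) \<le> r * norm u0"
  shows "\<exists>E'\<in>approx_spectrum T. \<bar>E' - E\<bar> \<le> r"
proof -
  define A where "A u = T u - E *\<^sub>R u" for u
  interpret A: symmetric_operator A
    unfolding A_def by (rule shift_operator)
  define S where "S = (\<lambda>u. norm (A u)) ` {u. norm u = 1}"
  define a where "a = Inf S"
  have bdd: "bdd_below S" by (auto simp: S_def intro!: bdd_belowI[of _ 0])
  define u1 where "u1 = u0 /\<^sub>R norm u0"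
  have u1: "norm u1 = 1" using u0 by (simp add: u1_def)
  have "norm (A u1) \<le> r"
    using assms unfolding u1_def A.T.scaleR norm_scaleR A_def[of u0, symmetric]
    by (simp add: divide_inverse_commute[symmetric] pos_divide_le_eq)
  have "S \<noteq> {}" using u1 by (auto simp: S_def)
  have ar: "a \<le> r"
    using cInf_lower[OF _ bdd, of "norm (A u1)"] u1 \<open>norm (A u1) \<le> r\<close> by (auto simp: S_def a_def)
  have a0: "0 \<le> a"
    unfolding a_def by (rule cInf_greatest[OF \<open>S \<noteq> {}\<close>]) (auto simp: S_def)
  have low: "a * norm u \<le> norm (A u)" for u
  proof (cases "u = 0")
    case False
    have "norm (A (u /\<^sub>R norm u)) \<in> S" using False by (auto simp: S_def)
    then have "a \<le> norm (A (u /\<^sub>R norm u))" unfolding a_def by (rule cInf_lower[OF _ bdd])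
    then show ?thesis using False by (simp add: A.T.scaleR field_simps)
  qed simp
  define B where "B u = A (A u) - (a\<^sup>2) *\<^sub>R u" for u
  have "bounded_linear (\<lambda>u. A (A u))"
    using A.bounded A.bounded by (rule bounded_linear_compose)
  then have "bounded_linear B"
    unfolding B_def by (intro bounded_linear_sub bounded_linear_scaleR_right)
  then interpret B: bounded_linear B .
  have symB: "inner (B u) v = inner u (B v)" for u v
    by (simp add: B_def inner_diff_left inner_diff_right A.symmetric)
  have B_form: "inner (B u) u = (norm (A u))\<^sup>2 - a\<^sup>2 * (norm u)\<^sup>2" for u
    by (simp add: B_def inner_diff_left A.symmetric power2_norm_eq_inner)
  have B_nonneg: "0 \<le> inner (B u) u" for u
    using power_mono[OF low[of u], of 2] a0 by (simp add: B_form power_mult_distrib)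
  obtain C where C: "C > 0" "\<And>u. norm (A u) \<le> norm u * C"
    using A.T.pos_bounded by blast
  have B_small: "(norm (B u))\<^sup>2 \<le> inner (B u) u * C\<^sup>2" for u
  proof (cases "B u = 0")
    case False
    have "(norm (A (B u)))\<^sup>2 \<le> (norm (B u))\<^sup>2 * C\<^sup>2"
      using power_mono[OF C(2)[of "B u"], of 2] by (simp add: power_mult_distrib)
    moreover have "0 \<le> a\<^sup>2 * (norm (B u))\<^sup>2" by simp
    ultimately have *: "inner (B (B u)) (B u) \<le> (norm (B u))\<^sup>2 * C\<^sup>2"
      unfolding B_form by linarith
    have "(norm (B u))\<^sup>2 * (norm (B u))\<^sup>2 = (inner (B u) (B u))\<^sup>2"
      by (simp add: dot_square_norm power2_eq_square)
    also have "\<dots> \<le> inner (B u) u * inner (B (B u)) (B u)"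
      by (rule nonneg_form_cauchy_schwarz[OF B.linear symB B_nonneg])
    also have "\<dots> \<le> inner (B u) u * ((norm (B u))\<^sup>2 * C\<^sup>2)"
      by (intro mult_left_mono * B_nonneg)
    finally have "(norm (B u))\<^sup>2 * (norm (B u))\<^sup>2 \<le> (inner (B u) u * C\<^sup>2) * (norm (B u))\<^sup>2"
      by (simp only: mult.assoc mult.commute[of "C\<^sup>2"])
    then show ?thesis by (rule mult_right_le_imp_le) (use False in simp)
  qed (use B_nonneg in simp)
  have small: "\<exists>u. norm u = 1 \<and> norm (B u) < e" if "0 < e" for e
  proof -
    define k where "k = (e / C)\<^sup>2"
    have "k > 0" using that C(1) by (simp add: k_def)
    have "a < sqrt (a\<^sup>2 + k)" using \<open>k > 0\<close> a0 by (simp add: real_less_rsqrt)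
    then obtain s where "s \<in> S" "s < sqrt (a\<^sup>2 + k)"
      unfolding a_def using cInf_lessD[OF \<open>S \<noteq> {}\<close>] by blast
    then obtain u where u: "norm u = 1" "norm (A u) < sqrt (a\<^sup>2 + k)" by (auto simp: S_def)
    then have "(norm (A u))\<^sup>2 < (sqrt (a\<^sup>2 + k))\<^sup>2"
      by (intro power_strict_mono) auto
    then have "inner (B u) u < k" using u \<open>k > 0\<close> by (simp add: B_form)
    then have "(norm (B u))\<^sup>2 < k * C\<^sup>2"
      using B_small[of u] C(1) by (smt (verit) mult_strict_right_mono zero_less_power)
    also have "\<dots> = e\<^sup>2" using C(1) by (simp add: k_def power_divide)
    finally have "norm (B u) < e" using that by (intro power_less_imp_less_base[of _ 2 e]) auto
    then show ?thesis using u by blast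
  qed
  have "E + a \<in> approx_spectrum T \<or> E - a \<in> approx_spectrum T"
  proof (rule ccontr)
    assume "\<not> ?thesis"
    then obtain d1 d2 where d: "d1 > 0" "bounded_below T (E + a) d1" "d2 > 0" "bounded_below T (E - a) d2"
      by (auto simp: not_in_approx_spectrum)
    have "0 < d1 * d2" using d by simp
    then obtain u where u: "norm u = 1" "norm (B u) < d1 * d2" using small by blast
    define v where "v = T u - (E - a) *\<^sub>R u"
    have "B u = T v - (E + a) *\<^sub>R v"
      by (simp add: B_def A_def v_def T.diff T.add T.scaleR algebra_simps power2_eq_square)
    then have "d1 * norm v \<le> norm (B u)" using bounded_belowD[OF d(2), of v] by simp
    moreover have "d2 * norm u \<le> norm v" using bounded_belowD[OF d(4), of u] by (simp add: v_def)
    then have "d1 * d2 \<le> d1 * norm v" using u d(1) by simp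
    ultimately show False using u by simp
  qed
  then show ?thesis using ar a0 by force
qed

text \<open>Contrapositive of \<open>approx_spectrum_near\<close>: the self-adjoint bound of the
  resolvent by the reciprocal distance to the spectrum.\<close>

lemma bounded_below_if_no_spectrum:
  assumes "\<And>E'. E' \<in> approx_spectrum T \<Longrightarrow> d \<le> \<bar>E' - E\<bar>"
  shows "bounded_below T E d"
  unfolding bounded_below_def
proof
  fix u show "d * norm u \<le> norm (T u - E *\<^sub>R u)"
  proof (rule ccontr)
    assume *: "\<not> ?thesis"
    then have "u \<noteq> 0" by auto
    define r where "r = norm (T u - E *\<^sub>R u) / norm u"
    have "norm (T u - E *\<^sub>R u) \<le> r * norm u" using \<open>u \<noteq> 0\<close> by (simp add: r_def)
    then obtain E' where "E' \<in> approx_spectrum T" "\<bar>E' - E\<bar> \<le> r"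
      using approx_spectrum_near[OF \<open>u \<noteq> 0\<close>] by blast
    moreover have "r < d" using * \<open>u \<noteq> 0\<close> by (simp add: r_def field_simps)
    ultimately show False using assms by force
  qed
qed

lemma approx_spectrum_bound:
  assumes "\<And>u. norm (T u) \<le> C * norm u" "E \<in> approx_spectrum T"
  shows "\<bar>E\<bar> \<le> C"
proof (rule ccontr)
  assume "\<not> \<bar>E\<bar> \<le> C"
  then have "0 < \<bar>E\<bar> - C" by simp
  then obtain u where u: "norm (T u - E *\<^sub>R u) < (\<bar>E\<bar> - C) * norm u"
    using in_approx_spectrumE[OF assms(2)] by blast
  have "norm (E *\<^sub>R u) \<le> norm (T u) + norm (T u - E *\<^sub>R u)"
    by (metis norm_triangle_sub norm_minus_commute add.commute)
  then show False using u assms(1)[of u] by (simp add: algebra_simps)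
qed

lemma compact_approx_spectrum: "compact (approx_spectrum T)"
proof -
  obtain C where "\<And>u. norm (T u) \<le> norm u * C" using T.bounded by blast
  then have "\<bar>E\<bar> \<le> C" if "E \<in> approx_spectrum T" for E
    using approx_spectrum_bound[OF _ that, of C] by (simp add: mult.commute)
  then have "bounded (approx_spectrum T)" by (auto simp: bounded_iff)
  then show ?thesis using closed_approx_spectrum by (simp add: compact_eq_bounded_closed)
qed

lemma approx_spectrum_nonempty:
  assumes "\<exists>u :: 'a. u \<noteq> 0"
  shows "approx_spectrum T \<noteq> {}"
proof -
  obtain u :: 'a where "u \<noteq> 0" using assms by blast
  have "norm (T u - 0 *\<^sub>R u) \<le> (norm (T u) / norm u) * norm u" using \<open>u \<noteq> 0\<close> by simp
  then show ?thesis using approx_spectrum_near[OF \<open>u \<noteq> 0\<close>] by blast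
qed

end

section \<open>Isolated points of the spectrum, and inverses of coercive operators\<close>

lemma norm_diff_scaleR_square:
  fixes u v :: "'a::real_inner"
  shows "(norm (u - c *\<^sub>R v))\<^sup>2 = (norm u)\<^sup>2 - 2 * c * inner u v + c\<^sup>2 * (norm v)\<^sup>2"
  unfolding power2_norm_eq_inner
  by (simp add: inner_diff_left inner_diff_right inner_commute[of v u] power2_eq_square algebra_simps)

text \<open>Both E + d/2 and E - d/2 have distance at least d/2 from the spectrum, and squaring
  these two lower bounds shows that the forms of A A + d A and A A - d A are nonnegative.
  Cauchy-Schwarz for either form, applied to u and v = A u, controls the difference 2 d |v|^2 of the
  two by |A v| and |v|. The outcome is that A is bounded below on its range.\<close>

lemma (in symmetric_operator) isolated_spectrum_square_bound:
  assumes "0 < d" and iso: "\<And>E'. E' \<in> approx_spectrum T \<Longrightarrow> \<bar>E' - E\<bar> < d \<Longrightarrow> E' = E"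
  defines "A \<equiv> \<lambda>u. T u - E *\<^sub>R u"
  shows "d / 3 * norm (A u) \<le> norm (A (A u))"
proof -
  interpret A: symmetric_operator A
    unfolding A_def by (rule shift_operator)
  have form_bound: "s * d * inner (A u) u \<le> (norm (A u))\<^sup>2" if s: "s = 1 \<or> s = - 1" for s u
  proof -
    have "bounded_below T (E + s * d / 2) (d / 2)"
    proof (rule bounded_below_if_no_spectrum)
      fix E' assume "E' \<in> approx_spectrum T"
      show "d / 2 \<le> \<bar>E' - (E + s * d / 2)\<bar>"
      proof (rule ccontr)
        assume *: "\<not> ?thesis"
        then have "\<bar>E' - E\<bar> < d" using s unfolding abs_less_iff by (auto simp: abs_if split: if_splits)
        then have "E' = E" using iso \<open>E' \<in> approx_spectrum T\<close> by blast
        then show False using * s \<open>0 < d\<close> by auto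
      qed
    qed
    then have "d / 2 * norm u \<le> norm (A u - (s * d / 2) *\<^sub>R u)"
      by (auto dest!: bounded_belowD[of _ _ _ u] simp: A_def algebra_simps)
    then have "(d / 2 * norm u)\<^sup>2 \<le> (norm (A u - (s * d / 2) *\<^sub>R u))\<^sup>2"
      using \<open>0 < d\<close> by (intro power_mono) auto
    also have "\<dots> = (norm (A u))\<^sup>2 - s * d * inner (A u) u + (d / 2 * norm u)\<^sup>2"
      unfolding norm_diff_scaleR_square using s by (auto simp: power_mult_distrib power_divide)
    finally show ?thesis by simp
  qed
  have cs: "(inner (A (A u) + (s * d) *\<^sub>R A u) v)\<^sup>2 \<le>
      ((norm (A u))\<^sup>2 + s * d * inner (A u) u) * ((norm (A v))\<^sup>2 + s * d * inner (A v) v)"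
    if s: "s = 1 \<or> s = - 1" for s u v
  proof -
    have "bounded_linear (\<lambda>u. A (A u))"
      using A.bounded A.bounded by (rule bounded_linear_compose)
    then have "bounded_linear (\<lambda>u. A (A u) + (s * d) *\<^sub>R A u)"
      by (intro bounded_linear_add bounded_linear_const_scaleR A.bounded)
    then have lin: "linear (\<lambda>u. A (A u) + (s * d) *\<^sub>R A u)" by (rule bounded_linear.linear)
    have form: "inner (A (A u) + (s * d) *\<^sub>R A u) u = (norm (A u))\<^sup>2 + s * d * inner (A u) u" for u
      by (simp add: inner_add_left A.symmetric power2_norm_eq_inner)
    have "(inner (A (A u) + (s * d) *\<^sub>R A u) v)\<^sup>2 \<le>
      inner (A (A u) + (s * d) *\<^sub>R A u) u * inner (A (A v) + (s * d) *\<^sub>R A v) v"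
    proof (rule nonneg_form_cauchy_schwarz[OF lin])
      show "inner (A (A u) + (s * d) *\<^sub>R A u) v = inner u (A (A v) + (s * d) *\<^sub>R A v)" for u v
        by (simp add: inner_add_left inner_add_right A.symmetric)
      show "0 \<le> inner (A (A u) + (s * d) *\<^sub>R A u) u" for u
        using form_bound[of "- s" u] s unfolding form by auto
    qed
    then show ?thesis by (simp only: form)
  qed
  define v m e where "v = A u" and "m = norm v" and "e = norm (A v)"
  have m0: "0 \<le> m" "0 \<le> e" by (simp_all add: m_def e_def)
  have Av: "\<bar>d * inner (A v) v\<bar> \<le> d * (e * m)"
    using Cauchy_Schwarz_ineq2[of "A v" v] \<open>0 < d\<close> by (simp add: abs_mult e_def m_def)
  have half: "\<bar>inner (A v + (s * d) *\<^sub>R v) v\<bar> \<le> sqrt (2 * m\<^sup>2 * (e\<^sup>2 + d * (e * m)))"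
    if s: "s = 1 \<or> s = - 1" for s
  proof -
    have "(inner (A v + (s * d) *\<^sub>R v) v)\<^sup>2 \<le>
        (m\<^sup>2 + s * d * inner v u) * (e\<^sup>2 + s * d * inner (A v) v)"
      using cs[OF s, of u v] by (simp add: v_def m_def e_def)
    also have "\<dots> \<le> (2 * m\<^sup>2) * (e\<^sup>2 + d * (e * m))"
    proof (rule mult_mono)
      show "m\<^sup>2 + s * d * inner v u \<le> 2 * m\<^sup>2"
        using form_bound[OF s, of u] by (simp add: v_def m_def)
      show "e\<^sup>2 + s * d * inner (A v) v \<le> e\<^sup>2 + d * (e * m)"
        using Av s by (auto simp: abs_le_iff)
      show "0 \<le> e\<^sup>2 + s * d * inner (A v) v"
        using form_bound[of "- s" v] s by (auto simp: e_def)
    qed simp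
    finally show ?thesis by (simp add: real_le_rsqrt real_sqrt_abs[symmetric] del: real_sqrt_abs)
  qed
  have "2 * d * m\<^sup>2 = inner (A v + (1 * d) *\<^sub>R v) v - inner (A v + (- 1 * d) *\<^sub>R v) v"
    by (simp add: inner_add_left inner_diff_left m_def power2_norm_eq_inner)
  also have "\<dots> \<le> 2 * sqrt (2 * m\<^sup>2 * (e\<^sup>2 + d * (e * m)))"
    using half[of 1] half[of "- 1"] by linarith
  finally have "d * m\<^sup>2 \<le> sqrt (2 * m\<^sup>2 * (e\<^sup>2 + d * (e * m)))" by simp
  then have "(d * m\<^sup>2)\<^sup>2 \<le> (sqrt (2 * m\<^sup>2 * (e\<^sup>2 + d * (e * m))))\<^sup>2"
    using \<open>0 < d\<close> by (intro power_mono) auto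
  then have sq: "(d * m\<^sup>2)\<^sup>2 \<le> 2 * m\<^sup>2 * (e\<^sup>2 + d * (e * m))"
    using m0 \<open>0 < d\<close> by simp
  have "d / 3 * m \<le> e"
  proof (rule ccontr)
    assume "\<not> d / 3 * m \<le> e"
    \<comment> \<open>Below d m / 3 the two terms contribute at most 1/9 and 1/3 of (d m)^2;
      doubled, this is 8/9 < 1. That is the origin of the factor 3.\<close>
    then have lt: "e < d * m / 3" by simp
    then have "0 < m" using m0 \<open>0 < d\<close> by (smt (verit) divide_eq_0_iff mult_eq_0_iff)
    have "e\<^sup>2 \<le> (d * m / 3)\<^sup>2" using lt m0 by (intro power_mono) auto
    moreover have "d * (e * m) \<le> d * (d * m / 3 * m)"
      using lt \<open>0 < m\<close> \<open>0 < d\<close> by (intro mult_left_mono mult_right_mono) auto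
    ultimately have "e\<^sup>2 + d * (e * m) \<le> (d * m)\<^sup>2 * (4 / 9)"
      by (simp add: power2_eq_square field_simps)
    then have "2 * m\<^sup>2 * (e\<^sup>2 + d * (e * m)) \<le> 2 * m\<^sup>2 * ((d * m)\<^sup>2 * (4 / 9))"
      by (intro mult_left_mono) auto
    also have "\<dots> = (d * m\<^sup>2)\<^sup>2 * (8 / 9)"
      by (simp add: power2_eq_square)
    finally have "(d * m\<^sup>2)\<^sup>2 \<le> (d * m\<^sup>2)\<^sup>2 * (8 / 9)"
      using sq by linarith
    moreover have "0 < (d * m\<^sup>2)\<^sup>2" using \<open>0 < m\<close> \<open>0 < d\<close> by simp
    ultimately show False by linarith
  qed
  then show ?thesis by (simp add: m_def e_def v_def)
qed

text \<open>The map u -> u - A (A u) / K^2 fixes the kernel of A and contracts its range, because A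
  is bounded below there. The iterates converge geometrically, their images under A tend to 0, and
  the total displacement is proportional to |A u|. This takes the place of the orthogonal projection
  onto the kernel.\<close>

lemma kernel_near:
  fixes A :: "'a::{real_inner,banach} \<Rightarrow> 'a"
  assumes "symmetric_operator A" "0 < c" and low: "\<And>u. c * norm (A u) \<le> norm (A (A u))"
  shows "\<exists>C. \<forall>u. \<exists>w. A w = 0 \<and> norm (u - w) \<le> C * norm (A u)"
proof -
  interpret symmetric_operator A by fact
  obtain K where K: "0 < K" "\<And>u. norm (A u) \<le> norm u * K"
    using T.pos_bounded by blast
  \<comment> \<open>\<open>max 0\<close> covers c > K, which can happen only if A vanishes
    identically.\<close>
  define r where "r = sqrt (max 0 (1 - c\<^sup>2 / K\<^sup>2))"
  have r: "0 \<le> r" "r < 1" using K(1) \<open>0 < c\<close> by (simp_all add: r_def)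
  define f where "f u = u - (1 / K\<^sup>2) *\<^sub>R A (A u)" for u
  have contract: "norm (f (A u)) \<le> r * norm (A u)" for u
  proof -
    define v where "v = A u"
    have "(norm (f v))\<^sup>2 = (norm v)\<^sup>2 - 2 * (1 / K\<^sup>2) * (norm (A v))\<^sup>2 +
        (1 / K\<^sup>2)\<^sup>2 * (norm (A (A v)))\<^sup>2"
      unfolding f_def norm_diff_scaleR_square symmetric[of v "A v", symmetric]
      by (simp only: power2_norm_eq_inner)
    also have "\<dots> \<le> (norm v)\<^sup>2 - 2 * (1 / K\<^sup>2) * (norm (A v))\<^sup>2 +
        (1 / K\<^sup>2)\<^sup>2 * (norm (A v) * K)\<^sup>2"
      by (intro add_left_mono mult_left_mono power_mono K) auto
    also have "\<dots> = (norm v)\<^sup>2 - (norm (A v))\<^sup>2 / K\<^sup>2"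
      using K(1) by (simp add: power_mult_distrib field_simps)
    also have "\<dots> \<le> (norm v)\<^sup>2 - (c * norm v)\<^sup>2 / K\<^sup>2"
      using low[of u] \<open>0 < c\<close>
      by (intro diff_left_mono divide_right_mono power_mono) (auto simp: v_def)
    also have "\<dots> = (1 - c\<^sup>2 / K\<^sup>2) * (norm v)\<^sup>2"
      by (simp add: power_mult_distrib algebra_simps)
    also have "\<dots> \<le> (r * norm v)\<^sup>2"
      unfolding power_mult_distrib r_def by (intro mult_right_mono) simp_all
    finally show ?thesis unfolding v_def by (rule power2_le_imp_le) (use r(1) in simp)
  qed
  have f_A: "A (f u) = f (A u)" for u
    unfolding f_def T.diff T.scaleR ..
  show ?thesis
  proof (intro exI[of _ "1 / K * (1 / (1 - r))"] allI)
    fix u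
    define x where "x n = (f ^^ n) u" for n
    have A_x: "norm (A (x n)) \<le> r ^ n * norm (A u)" for n
    proof (induction n)
      case (Suc n)
      have "norm (A (x (Suc n))) \<le> r * norm (A (x n))"
        using contract[of "x n"] by (simp add: x_def f_A)
      also have "\<dots> \<le> r * (r ^ n * norm (A u))"
        by (intro mult_left_mono Suc r)
      finally show ?case by (simp add: mult.assoc)
    qed (simp add: x_def)
    have step: "norm (x (Suc n) - x n) \<le> 1 / K * norm (A u) * r ^ n" for n
    proof -
      have "norm (x (Suc n) - x n) = 1 / K\<^sup>2 * norm (A (A (x n)))"
        by (simp add: x_def f_def)
      also have "\<dots> \<le> 1 / K\<^sup>2 * (norm (A (x n)) * K)"
        by (intro mult_left_mono K) simp
      also have "\<dots> = 1 / K * norm (A (x n))"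
        using K(1) by (simp add: power2_eq_square)
      also have "\<dots> \<le> 1 / K * (r ^ n * norm (A u))"
        using K(1) by (intro mult_left_mono A_x) simp
      finally show ?thesis by (simp add: mult_ac)
    qed
    have geo: "(\<lambda>n. 1 / K * norm (A u) * r ^ n) sums (1 / K * norm (A u) * (1 / (1 - r)))"
      using r by (intro sums_mult geometric_sums) simp
    have summ: "summable (\<lambda>n. norm (x (Suc n) - x n))"
      using step by (intro summable_comparison_test[OF _ sums_summable[OF geo]]) auto
    define s where "s = (\<Sum>n. x (Suc n) - x n)"
    have "(\<lambda>n. x (Suc n) - x n) sums s"
      unfolding s_def by (rule summable_sums[OF summable_norm_cancel[OF summ]])
    then have "(\<lambda>n. (\<Sum>i<n. x (Suc i) - x i) + x 0) \<longlonglongrightarrow> s + x 0"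
      unfolding sums_def by (rule tendsto_add[OF _ tendsto_const])
    moreover have "(\<Sum>i<n. x (Suc i) - x i) + x 0 = x n" for n
      by (simp add: sum_lessThan_telescope)
    moreover have "x 0 = u" by (simp add: x_def)
    ultimately have lim: "x \<longlonglongrightarrow> u + s"
      by (simp add: add.commute)
    have "norm s \<le> (\<Sum>n. norm (x (Suc n) - x n))"
      unfolding s_def using summ by (rule summable_norm)
    also have "\<dots> \<le> 1 / K * norm (A u) * (1 / (1 - r))"
      using suminf_le[OF step summ sums_summable[OF geo]] sums_unique[OF geo] by simp
    finally have "norm (u - (u + s)) \<le> 1 / K * (1 / (1 - r)) * norm (A u)"
      by (simp add: mult_ac)
    moreover have "A (u + s) = 0"
    proof (rule LIMSEQ_unique)
      show "(\<lambda>n. A (x n)) \<longlonglongrightarrow> A (u + s)" by (rule T.tendsto[OF lim])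
      have "(\<lambda>n. r ^ n * norm (A u)) \<longlonglongrightarrow> 0 * norm (A u)"
        using r by (intro tendsto_intros LIMSEQ_realpow_zero) auto
      then show "(\<lambda>n. A (x n)) \<longlonglongrightarrow> 0"
        by (intro Lim_null_comparison[OF always_eventually[OF allI[OF A_x]]]) simp
    qed
    ultimately show "\<exists>w. A w = 0 \<and> norm (u - w) \<le> 1 / K * (1 / (1 - r)) * norm (A u)" by blast
  qed
qed

text \<open>Lax-Milgram by Banach's fixed point theorem for v -> v - t (X v - f). The choice t = m /
  K^2 minimises the bound 1 - 2 t m + t^2 K^2 on the squared contraction factor.\<close>

lemma coercive_inverse:
  fixes X :: "'a::{real_inner,banach} \<Rightarrow> 'a"
  assumes "bounded_linear X" "0 < m" and coercive: "\<And>u. m * (norm u)\<^sup>2 \<le> inner (X u) u"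
  shows "\<exists>R. bounded_linear R \<and> (\<forall>u. X (R u) = u \<and> R (X u) = u)"
proof -
  interpret X: bounded_linear X by fact
  obtain K where K: "0 < K" "\<And>u. norm (X u) \<le> norm u * K"
    using X.pos_bounded by blast
  have low: "m * norm u \<le> norm (X u)" for u
  proof (cases "u = 0")
    case False
    have "m * norm u * norm u \<le> norm (X u) * norm u"
      using coercive[of u] norm_cauchy_schwarz[of "X u" u] by (simp add: power2_eq_square)
    then show ?thesis using False by simp
  qed simp
  have inj: "inj X"
  proof (rule injI)
    fix u v assume "X u = X v"
    then have "m * norm (u - v) \<le> 0" using low[of "u - v"] by (simp add: X.diff)
    then show "u = v" using \<open>0 < m\<close> by (simp add: mult_le_0_iff)
  qed
  define r where "r = sqrt (max 0 (1 - m\<^sup>2 / K\<^sup>2))"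
  have r: "0 \<le> r" "r < 1" using K(1) \<open>0 < m\<close> by (simp_all add: r_def)
  have contract: "norm (v - (m / K\<^sup>2) *\<^sub>R X v) \<le> r * norm v" for v
  proof -
    have "(norm (v - (m / K\<^sup>2) *\<^sub>R X v))\<^sup>2 =
        (norm v)\<^sup>2 - 2 * (m / K\<^sup>2) * inner (X v) v + (m / K\<^sup>2)\<^sup>2 * (norm (X v))\<^sup>2"
      unfolding norm_diff_scaleR_square by (simp add: inner_commute[of v "X v"])
    also have "\<dots> \<le> (norm v)\<^sup>2 - 2 * (m / K\<^sup>2) * (m * (norm v)\<^sup>2) + (m / K\<^sup>2)\<^sup>2 * (norm v * K)\<^sup>2"
      using \<open>0 < m\<close> by (intro add_mono diff_mono mult_left_mono coercive power_mono K) auto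
    also have "\<dots> = (1 - m\<^sup>2 / K\<^sup>2) * (norm v)\<^sup>2"
      using K(1) by (simp add: power2_eq_square field_simps)
    also have "\<dots> \<le> (r * norm v)\<^sup>2"
      unfolding power_mult_distrib r_def by (intro mult_right_mono) simp_all
    finally show ?thesis by (rule power2_le_imp_le) (use r(1) in simp)
  qed
  have surj: "\<exists>v. X v = f" for f
  proof -
    define g where "g v = v - (m / K\<^sup>2) *\<^sub>R (X v - f)" for v
    have "dist (g v) (g w) \<le> r * dist v w" for v w
    proof -
      have "g v - g w = (v - w) - (m / K\<^sup>2) *\<^sub>R X (v - w)"
        unfolding g_def X.diff by (simp only: scaleR_right_diff_distrib) simp
      then show ?thesis using contract[of "v - w"] by (simp only: dist_norm)
    qed
    then have "\<exists>!v. g v = v"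
      using r by (intro banach_fix_type[of r g]) auto
    then obtain v where "g v = v" by blast
    then show ?thesis using K(1) \<open>0 < m\<close> by (intro exI[of _ v]) (simp add: g_def)
  qed
  define R where "R = inv X"
  have XR: "X (R f) = f" for f
    unfolding R_def using surj by (metis f_inv_into_f rangeI)
  have RX: "R (X u) = u" for u
    using inj by (simp add: R_def)
  have "bounded_linear R"
  proof (rule bounded_linear_intro)
    show "R (f + g) = R f + R g" for f g using RX[of "R f + R g"] by (simp add: X.add XR)
    show "R (c *\<^sub>R f) = c *\<^sub>R R f" for c f using RX[of "c *\<^sub>R R f"] by (simp add: X.scaleR XR)
    show "norm (R f) \<le> norm f * (1 / m)" for f
      using low[of "R f"] \<open>0 < m\<close> by (simp add: XR field_simps)
  qed
  then show ?thesis using XR RX by blast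
qed

text \<open>For z = x + i y the operator is the product of T - z and T minus the conjugate of z, a
  real substitute for T - z. Its form dominates y^2 plus the squared lower bound of T - x, and one
  of these two is positive.\<close>

lemma square_plus_inverse:
  fixes T :: "'a::{real_inner,banach} \<Rightarrow> 'a"
  assumes "symmetric_operator T" "y \<noteq> 0 \<or> x \<notin> approx_spectrum T"
  defines "A \<equiv> \<lambda>u. T u - x *\<^sub>R u"
  shows "\<exists>R. bounded_linear R \<and> (\<forall>u. A (A (R u)) + y\<^sup>2 *\<^sub>R R u = u \<and> R (A (A u) + y\<^sup>2 *\<^sub>R u) = u)"
proof -
  interpret symmetric_operator T by fact
  interpret A: symmetric_operator A unfolding A_def by (rule shift_operator)
  have "\<exists>d\<ge>0. (y \<noteq> 0 \<or> 0 < d) \<and> bounded_below T x d"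
  proof (cases "y = 0")
    case True
    then obtain d where "0 < d" "bounded_below T x d"
      using assms(2) by (auto simp: not_in_approx_spectrum)
    then show ?thesis by (intro exI[of _ d]) simp
  next
    case False
    then show ?thesis by (intro exI[of _ 0]) (simp add: bounded_below_def)
  qed
  then obtain d where d: "0 \<le> d" "y \<noteq> 0 \<or> 0 < d" "bounded_below T x d" by blast
  show ?thesis
  proof (rule coercive_inverse)
    show "bounded_linear (\<lambda>u. A (A u) + y\<^sup>2 *\<^sub>R u)"
      by (intro bounded_linear_add bounded_linear_scaleR_right
          bounded_linear_compose[OF A.bounded A.bounded])
    show "0 < d\<^sup>2 + y\<^sup>2" using d by (auto simp: sum_power2_gt_zero_iff)
    show "(d\<^sup>2 + y\<^sup>2) * (norm u)\<^sup>2 \<le> inner (A (A u) + y\<^sup>2 *\<^sub>R u) u" for u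
    proof -
      have "(d * norm u)\<^sup>2 \<le> (norm (A u))\<^sup>2"
        using bounded_belowD[OF d(3), of u] d(1) by (intro power_mono) (auto simp: A_def)
      then show ?thesis
        by (simp add: inner_add_left A.symmetric power2_norm_eq_inner power_mult_distrib algebra_simps)
    qed
  qed
qed


section \<open>Jacobi operators and the complex spectrum\<close>

lemma bounded_linear_mul: "bounded_linear (mul g)"
proof (cases "bounded (range g)")
  case True
  then obtain B where B: "\<And>n. \<bar>g n\<bar> \<le> B" by (auto simp: bounded_iff)
  show ?thesis
    by (rule bounded_linear_intro[of _ B])
      (use True mul_bounded_by(2)[OF B] in \<open>auto intro!: rl2_eqI simp: algebra_simps\<close>)
next
  case False
  then have "mul g = (\<lambda>_. 0)" by (intro ext rl2_eqI) (simp add: mul.rep_eq)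
  then show ?thesis by (simp add: bounded_linear_zero)
qed

lemma bounded_linear_shift: "bounded_linear (shift k)"
  by (rule bounded_linear_intro[of _ 1]) (auto intro!: rl2_eqI)

text \<open>The weight \<open>a n\<close> sits on the bond between n - 1 and n. Variable weights
  serve to remove bonds, by giving them weight 0.\<close>

definition jacobi :: "(int \<Rightarrow> real) \<Rightarrow> (int \<Rightarrow> real) \<Rightarrow> rl2 \<Rightarrow> rl2" where
  "jacobi a W u = mul a (shift (- 1) u) + shift 1 (mul a u) + mul W u"

abbreviation schr :: "(int \<Rightarrow> real) \<Rightarrow> rl2 \<Rightarrow> rl2" where
  "schr \<equiv> jacobi (\<lambda>_. 1)"

lemma seq_jacobi:
  assumes "bounded (range a)" "bounded (range W)"
  shows "seq (jacobi a W u) n = a n * seq u (n - 1) + a (n + 1) * seq u (n + 1) + W n * seq u n"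
  using assms by (simp add: jacobi_def)

lemma seq_schr:
  "bounded (range W) \<Longrightarrow> seq (schr W u) n = seq u (n - 1) + seq u (n + 1) + W n * seq u n"
  by (simp add: seq_jacobi image_constant_conv)

lemma symmetric_operator_jacobi: "symmetric_operator (jacobi a W)"
proof (rule symmetric_operator.intro)
  have "bounded_linear (\<lambda>u. mul a (shift (- 1) u) + shift 1 (mul a u) + mul W u)"
    by (intro bounded_linear_add bounded_linear_mul
        bounded_linear_compose[OF bounded_linear_mul bounded_linear_shift]
        bounded_linear_compose[OF bounded_linear_shift bounded_linear_mul])
  then show "bounded_linear (jacobi a W)" by (simp add: jacobi_def[abs_def])
  show "inner (jacobi a W u) v = inner u (jacobi a W v)" for u v
    by (simp add: jacobi_def inner_add_left inner_add_right inner_mul inner_shift_left)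
qed

lemma norm_schr_diff_le:
  assumes "bounded (range V)" "bounded (range W)" "\<And>n. \<bar>V n - W n\<bar> \<le> e"
  shows "norm (schr V u - schr W u) \<le> e * norm u"
proof -
  have "schr V u - schr W u = mul (\<lambda>n. V n - W n) u"
    using assms mul_bounded_by(1)[of "\<lambda>n. V n - W n", OF assms(3)]
    by (intro rl2_eqI) (simp add: seq_schr algebra_simps)
  then show ?thesis using mul_bounded_by(2)[of "\<lambda>n. V n - W n", OF assms(3)] by simp
qed

lemma norm_schr_le:
  assumes "\<And>n. \<bar>W n\<bar> \<le> B"
  shows "norm (schr W u) \<le> (2 + B) * norm u"
proof -
  have "norm (schr W u) \<le> norm (mul (\<lambda>_. 1) (shift (- 1) u)) + norm (shift 1 (mul (\<lambda>_. 1) u)) + norm (mul W u)"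
    unfolding jacobi_def by (intro norm_triangle_mono order_refl)
  also have "\<dots> \<le> 1 * norm (shift (- 1) u) + 1 * norm u + B * norm u"
    unfolding norm_shift[of 1] by (intro add_mono mul_bounded_by(2) assms) auto
  finally show ?thesis by (simp add: algebra_simps)
qed

section \<open>Complexification: the complex spectrum from the real approximate spectrum\<close>

definition re_part :: "(int \<Rightarrow> complex) \<Rightarrow> rl2" where "re_part \<psi> = Abs_rl2 (\<lambda>n. Re (\<psi> n))"

definition im_part :: "(int \<Rightarrow> complex) \<Rightarrow> rl2" where "im_part \<psi> = Abs_rl2 (\<lambda>n. Im (\<psi> n))"

definition complexify :: "rl2 \<Rightarrow> rl2 \<Rightarrow> int \<Rightarrow> complex" where
  "complexify a b n = Complex (seq a n) (seq b n)"

lemma complexify_ell2: "complexify a b \<in> ell2"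
  unfolding ell2_def complexify_def mem_Collect_eq cmod_power2 complex.sel
  by (intro summable_on_add seq_square_summable)

lemma ell2_norm_complexify: "ell2_norm (complexify a b) = sqrt ((norm a)\<^sup>2 + (norm b)\<^sup>2)"
  unfolding ell2_norm_def complexify_def cmod_power2 complex.sel norm_rl2_square
  by (simp add: infsum_add seq_square_summable)

lemma seq_parts:
  assumes "\<psi> \<in> ell2"
  shows "seq (re_part \<psi>) n = Re (\<psi> n)" "seq (im_part \<psi>) n = Im (\<psi> n)"
proof -
  have s: "(\<lambda>n. (cmod (\<psi> n))\<^sup>2) summable_on UNIV" using assms by (simp add: ell2_def)
  have "(\<lambda>n. (Re (\<psi> n))\<^sup>2) summable_on UNIV" "(\<lambda>n. (Im (\<psi> n))\<^sup>2) summable_on UNIV"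
    by (rule summable_on_comparison_test[OF s]; simp add: cmod_power2)+
  then show "seq (re_part \<psi>) n = Re (\<psi> n)" "seq (im_part \<psi>) n = Im (\<psi> n)"
    by (simp_all add: re_part_def im_part_def Abs_rl2_inverse)
qed

lemma complexify_parts: "\<psi> \<in> ell2 \<Longrightarrow> complexify (re_part \<psi>) (im_part \<psi>) = \<psi>"
  by (simp add: fun_eq_iff complexify_def seq_parts)

lemma parts_complexify [simp]: "re_part (complexify a b) = a" "im_part (complexify a b) = b"
  by (intro rl2_eqI; simp add: seq_parts[OF complexify_ell2]; simp add: complexify_def)+

lemma complexify_add: "(\<lambda>n. complexify a b n + complexify c d n) = complexify (a + c) (b + d)"
  by (simp add: fun_eq_iff complexify_def complex_eq_iff)

lemma complexify_mult:
  "(\<lambda>n. z * complexify a b n) = complexify (Re z *\<^sub>R a - Im z *\<^sub>R b) (Re z *\<^sub>R b + Im z *\<^sub>R a)"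
  by (simp add: fun_eq_iff complexify_def complex_eq_iff)

lemma complexify_schrodinger_diff:
  assumes "bounded (range W)"
  defines "A \<equiv> \<lambda>z u. schr W u - Re z *\<^sub>R u"
  shows "(\<lambda>n. schrodinger W (complexify a b) n - z * complexify a b n) =
    complexify (A z a + Im z *\<^sub>R b) (A z b - Im z *\<^sub>R a)"
  using assms(1)
  by (simp add: fun_eq_iff complexify_def schrodinger_def complex_eq_iff seq_schr A_def)

lemma resolvent_set_imp_bounded_below:
  assumes W: "bounded (range W)" and "of_real E \<in> resolvent_set (schrodinger W)"
  shows "E \<notin> approx_spectrum (schr W)"
proof
  assume E: "E \<in> approx_spectrum (schr W)"
  obtain R where R: "bounded_op R"
    "\<And>\<psi>. \<psi> \<in> ell2 \<Longrightarrow> R (\<lambda>n. schrodinger W \<psi> n - of_real E * \<psi> n) = \<psi>"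
    using assms(2) by (auto simp: resolvent_set_def)
  obtain C where C: "\<And>\<psi>. \<psi> \<in> ell2 \<Longrightarrow> ell2_norm (R \<psi>) \<le> C * ell2_norm \<psi>"
    using R(1) unfolding bounded_op_def by blast
  have "0 < 1 / (\<bar>C\<bar> + 1)" by (simp add: add_nonneg_pos)
  then obtain u where u: "norm (schr W u - E *\<^sub>R u) < (1 / (\<bar>C\<bar> + 1)) * norm u"
    using in_approx_spectrumE[OF E] by blast
  have "(\<lambda>n. schrodinger W (complexify u 0) n - of_real E * complexify u 0 n) =
      complexify (schr W u - E *\<^sub>R u) 0"
    using complexify_schrodinger_diff[OF W, of u 0 "of_real E"]
      linear_0[OF bounded_linear.linear[OF symmetric_operator.bounded[OF symmetric_operator_jacobi]]]
    by simp
  then have "ell2_norm (complexify u 0) \<le> C * ell2_norm (complexify (schr W u - E *\<^sub>R u) 0)"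
    using R(2)[OF complexify_ell2, of u 0] C[OF complexify_ell2, of "schr W u - E *\<^sub>R u" 0] by simp
  then have "norm u \<le> C * norm (schr W u - E *\<^sub>R u)" by (simp add: ell2_norm_complexify)
  also have "\<dots> \<le> (\<bar>C\<bar> + 1) * norm (schr W u - E *\<^sub>R u)" by (intro mult_right_mono) auto
  also have "\<dots> < norm u" using u by (simp add: field_simps)
  finally show False by simp
qed

lemma resolvent_setI:
  assumes W: "bounded (range W)" and z: "Im z \<noteq> 0 \<or> Re z \<notin> approx_spectrum (schr W)"
  shows "z \<in> resolvent_set (schrodinger W)"
proof -
  define x y where "x = Re z" and "y = Im z"
  define A where "A u = schr W u - x *\<^sub>R u" for u
  interpret T: symmetric_operator "schr W" by (rule symmetric_operator_jacobi)
  interpret A: symmetric_operator A unfolding A_def by (rule T.shift_operator)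
  obtain R where "bounded_linear R" and XR: "\<And>u. A (A (R u)) + y\<^sup>2 *\<^sub>R R u = u"
    and RX: "\<And>u. R (A (A u) + y\<^sup>2 *\<^sub>R u) = u"
    using square_plus_inverse[OF symmetric_operator_jacobi, of y x "\<lambda>_. 1" W] z
    unfolding x_def[symmetric] y_def[symmetric] A_def[symmetric] by blast
  interpret R: bounded_linear R by fact
  have RA: "R (A u) = A (R u)" for u
  proof -
    have "A u = A (A (A (R u)) + y\<^sup>2 *\<^sub>R R u)" by (simp only: XR)
    also have "\<dots> = A (A (A (R u))) + y\<^sup>2 *\<^sub>R A (R u)" by (simp only: A.T.add A.T.scaleR)
    finally show ?thesis using RX[of "A (R u)"] by simp
  qed
  \<comment> \<open>With T - z = A - i y and (A - i y) (A + i y) = A A + y^2, the resolvent is (A +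
    i y) R. Here c and d are the real and imaginary parts of (A + i y) (R p + i R q).\<close>
  define c where "c p q = A (R p) - y *\<^sub>R R q" for p q
  define d where "d p q = A (R q) + y *\<^sub>R R p" for p q
  define S where "S \<psi> = complexify (c (re_part \<psi>) (im_part \<psi>)) (d (re_part \<psi>) (im_part \<psi>))" for \<psi>
  have S: "S (complexify p q) = complexify (c p q) (d p q)" for p q by (simp add: S_def)
  have diff: "(\<lambda>n. schrodinger W (complexify p q) n - z * complexify p q n) =
      complexify (A p + y *\<^sub>R q) (A q - y *\<^sub>R p)" for p q
    using complexify_schrodinger_diff[OF W, of p q z] by (simp add: A_def x_def y_def)
  obtain K where K: "0 \<le> K" "\<And>u. norm (A (R u)) \<le> norm u * K"
    using bounded_linear.nonneg_bounded[OF bounded_linear_compose[OF A.bounded R.bounded_linear_axioms]]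
    by blast
  obtain L where L: "0 \<le> L" "\<And>u. norm (R u) \<le> norm u * L"
    using R.nonneg_bounded by blast
  have cd: "norm (c p q) \<le> norm p * K + \<bar>y\<bar> * (norm q * L)"
    "norm (d p q) \<le> norm q * K + \<bar>y\<bar> * (norm p * L)" for p q
  proof -
    have "norm (c p q) \<le> norm (A (R p)) + norm (y *\<^sub>R R q)"
      unfolding c_def by (rule norm_triangle_ineq4)
    also have "\<dots> \<le> norm p * K + \<bar>y\<bar> * (norm q * L)"
      by (auto intro!: add_mono mult_left_mono K L)
    finally show "norm (c p q) \<le> norm p * K + \<bar>y\<bar> * (norm q * L)" .
    have "norm (d p q) \<le> norm (A (R q)) + norm (y *\<^sub>R R p)"
      unfolding d_def by (rule norm_triangle_ineq)
    also have "\<dots> \<le> norm q * K + \<bar>y\<bar> * (norm p * L)"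
      by (auto intro!: add_mono mult_left_mono K L)
    finally show "norm (d p q) \<le> norm q * K + \<bar>y\<bar> * (norm p * L)" .
  qed
  have "bounded_op S"
    unfolding bounded_op_def
  proof (intro conjI ballI allI)
    fix \<phi> \<psi> :: "int \<Rightarrow> complex" and w assume \<phi>: "\<phi> \<in> ell2" and \<psi>: "\<psi> \<in> ell2"
    obtain p q where \<phi>': "\<phi> = complexify p q" using complexify_parts[OF \<phi>] by metis
    obtain p' q' where \<psi>': "\<psi> = complexify p' q'" using complexify_parts[OF \<psi>] by metis
    show "S (\<lambda>n. \<phi> n + \<psi> n) = (\<lambda>n. S \<phi> n + S \<psi> n)"
      unfolding \<phi>' \<psi>' complexify_add S
      by (simp add: c_def d_def R.add A.T.add algebra_simps)
  next
    fix \<psi> :: "int \<Rightarrow> complex" and w assume \<psi>: "\<psi> \<in> ell2"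
    obtain p q where \<psi>': "\<psi> = complexify p q" using complexify_parts[OF \<psi>] by metis
    show "S \<psi> \<in> ell2" by (simp add: S_def complexify_ell2)
    show "S (\<lambda>n. w * \<psi> n) = (\<lambda>n. w * S \<psi> n)"
      unfolding \<psi>' complexify_mult S
      by (simp add: c_def d_def R.add R.diff R.scaleR A.T.add A.T.diff A.T.scaleR algebra_simps)
  next
    show "\<exists>C. \<forall>\<psi>\<in>ell2. ell2_norm (S \<psi>) \<le> C * ell2_norm \<psi>"
    proof (intro exI[of _ "2 * (K + \<bar>y\<bar> * L)"] ballI)
      fix \<psi> :: "int \<Rightarrow> complex" assume \<psi>: "\<psi> \<in> ell2"
      obtain p q where \<psi>': "\<psi> = complexify p q" using complexify_parts[OF \<psi>] by metis
      define m where "m = sqrt ((norm p)\<^sup>2 + (norm q)\<^sup>2)"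
      have pq: "norm p \<le> m" "norm q \<le> m" by (simp_all add: m_def real_le_rsqrt)
      have "ell2_norm (S \<psi>) \<le> norm (c p q) + norm (d p q)"
        unfolding \<psi>' S ell2_norm_complexify by (rule sqrt_sum_squares_le_sum) simp_all
      also have "\<dots> \<le> (m * K + \<bar>y\<bar> * (m * L)) + (m * K + \<bar>y\<bar> * (m * L))"
        using pq K(1) L(1)
        by (intro add_mono order_trans[OF cd(1)] order_trans[OF cd(2)] mult_left_mono mult_right_mono) auto
      finally show "ell2_norm (S \<psi>) \<le> 2 * (K + \<bar>y\<bar> * L) * ell2_norm \<psi>"
        unfolding \<psi>' ell2_norm_complexify m_def[symmetric] by (simp add: algebra_simps)
    qed
  qed
  moreover have "S (\<lambda>n. schrodinger W \<psi> n - z * \<psi> n) = \<psi> \<and> (\<lambda>n. schrodinger W (S \<psi>) n - z * S \<psi> n) = \<psi>"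
    if \<psi>: "\<psi> \<in> ell2" for \<psi>
  proof
    obtain p q where \<psi>': "\<psi> = complexify p q" using complexify_parts[OF \<psi>] by metis
    have "c (A p + y *\<^sub>R q) (A q - y *\<^sub>R p) = R (A (A p) + y\<^sup>2 *\<^sub>R p)"
      by (simp add: c_def R.add R.diff R.scaleR RA A.T.add A.T.scaleR power2_eq_square algebra_simps)
    moreover have "d (A p + y *\<^sub>R q) (A q - y *\<^sub>R p) = R (A (A q) + y\<^sup>2 *\<^sub>R q)"
      by (simp add: d_def R.add R.diff R.scaleR RA A.T.diff A.T.scaleR power2_eq_square algebra_simps)
    ultimately show "S (\<lambda>n. schrodinger W \<psi> n - z * \<psi> n) = \<psi>"
      unfolding \<psi>' diff S by (simp only: RX)
    have "A (c p q) + y *\<^sub>R d p q = A (A (R p)) + y\<^sup>2 *\<^sub>R R p"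
      by (simp add: c_def d_def A.T.diff A.T.scaleR power2_eq_square algebra_simps)
    moreover have "A (d p q) - y *\<^sub>R c p q = A (A (R q)) + y\<^sup>2 *\<^sub>R R q"
      by (simp add: c_def d_def A.T.add A.T.scaleR power2_eq_square algebra_simps)
    ultimately show "(\<lambda>n. schrodinger W (S \<psi>) n - z * S \<psi> n) = \<psi>"
      unfolding \<psi>' S diff by (simp only: XR)
  qed
  ultimately show ?thesis unfolding resolvent_set_def by blast
qed

theorem op_spectrum_schrodinger:
  assumes "bounded (range W)"
  shows "op_spectrum (schrodinger W) = complex_of_real ` approx_spectrum (schr W)"
proof (intro set_eqI iffI)
  fix z assume "z \<in> op_spectrum (schrodinger W)"
  then have "Im z = 0" "Re z \<in> approx_spectrum (schr W)"
    using resolvent_setI[OF assms, of z] by (auto simp: op_spectrum_def)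
  then show "z \<in> complex_of_real ` approx_spectrum (schr W)"
    by (intro image_eqI[of _ _ "Re z"]) (simp_all add: complex_eq_iff)
next
  fix z assume "z \<in> complex_of_real ` approx_spectrum (schr W)"
  then show "z \<in> op_spectrum (schrodinger W)"
    using resolvent_set_imp_bounded_below[OF assms] by (auto simp: op_spectrum_def)
qed


section \<open>Hyperbolic periodic potentials\<close>

datatype mat2 = Mat2 (m11: real) (m12: real) (m21: real) (m22: real)

instantiation mat2 :: monoid_mult
begin

definition one_mat2 :: mat2 where "1 = Mat2 1 0 0 1"

definition times_mat2 :: "mat2 \<Rightarrow> mat2 \<Rightarrow> mat2" where
  "A * B = Mat2 (m11 A * m11 B + m12 A * m21 B) (m11 A * m12 B + m12 A * m22 B)
                (m21 A * m11 B + m22 A * m21 B) (m21 A * m12 B + m22 A * m22 B)"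

instance
  by standard (simp_all add: one_mat2_def times_mat2_def algebra_simps)

end

lemma mat2_one_sel [simp]: "m11 1 = 1" "m12 1 = 0" "m21 1 = 0" "m22 1 = 1"
  by (simp_all add: one_mat2_def)

lemma mat2_times_sel [simp]:
  "m11 (A * B) = m11 A * m11 B + m12 A * m21 B"
  "m12 (A * B) = m11 A * m12 B + m12 A * m22 B"
  "m21 (A * B) = m21 A * m11 B + m22 A * m21 B"
  "m22 (A * B) = m21 A * m12 B + m22 A * m22 B"
  by (simp_all add: times_mat2_def)

definition trace2 :: "mat2 \<Rightarrow> real" where "trace2 A = m11 A + m22 A"

definition det2 :: "mat2 \<Rightarrow> real" where "det2 A = m11 A * m22 A - m12 A * m21 A"

lemma det2_one [simp]: "det2 1 = 1"
  by (simp add: det2_def)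

lemma det2_mult: "det2 (A * B) = det2 A * det2 B"
  by (simp add: det2_def algebra_simps)

text \<open>Conjugacy is written as A C = C B to avoid inverse matrices: equality of the traces
  times det C is a polynomial consequence of the four entry equations.\<close>

lemma trace2_conjugate:
  assumes "A * C = C * B" "det2 C \<noteq> 0"
  shows "trace2 A = trace2 B"
proof -
  have "m11 (A * C) = m11 (C * B)" "m12 (A * C) = m12 (C * B)"
    "m21 (A * C) = m21 (C * B)" "m22 (A * C) = m22 (C * B)" using assms(1) by simp_all
  then have "trace2 A * det2 C = trace2 B * det2 C"
    unfolding trace2_def det2_def mat2_times_sel by algebra
  then show ?thesis using assms(2) by simp
qed

definition step :: "real \<Rightarrow> mat2" where "step x = Mat2 x (- 1) 1 0"

lemma step_sel [simp]: "m11 (step x) = x" "m12 (step x) = - 1" "m21 (step x) = 1" "m22 (step x) = 0"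
  by (simp_all add: step_def)

lemma det2_step [simp]: "det2 (step x) = 1"
  by (simp add: det2_def)

text \<open>With v = E - W it carries the pair (u n, u (n - 1)) of a solution at energy E to (u (n +
  j), u (n + j - 1)). The energy is absorbed into v, so that shifts of the potential and of the
  energy look alike.\<close>

primrec transfer_matrix :: "(int \<Rightarrow> real) \<Rightarrow> int \<Rightarrow> nat \<Rightarrow> mat2" where
  "transfer_matrix v n 0 = 1"
| "transfer_matrix v n (Suc j) = step (v (n + int j)) * transfer_matrix v n j"

lemma transfer_matrix_add:
  "transfer_matrix v n (i + j) = transfer_matrix v (n + int i) j * transfer_matrix v n i"
  by (induction j) (simp_all add: mult.assoc add.assoc)

lemma transfer_matrix_cong:
  assumes "\<And>i. i < j \<Longrightarrow> v (n + int i) = w (m + int i)"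
  shows "transfer_matrix v n j = transfer_matrix w m j"
  using assms by (induction j) simp_all

lemma det2_transfer_matrix [simp]: "det2 (transfer_matrix v n j) = 1"
  by (induction j) (simp_all add: det2_mult)

lemma periodic_mult:
  fixes v :: "int \<Rightarrow> 'a"
  assumes "\<And>n. v (n + p) = v n"
  shows "v (n + k * p) = v n"
proof -
  have nat: "v (n + int m * p) = v n" for m n
  proof (induction m)
    case (Suc m)
    have "v (n + int (Suc m) * p) = v ((n + int m * p) + p)" by (simp add: algebra_simps)
    then show ?case using assms Suc by simp
  qed simp
  show ?thesis
  proof (cases "0 \<le> k")
    case True
    then show ?thesis using nat[of n "nat k"] by simp
  next
    case False
    then show ?thesis using nat[of "n + k * p" "nat (- k)"] by simp
  qed
qed

lemma periodic_mod:
  fixes v :: "int \<Rightarrow> 'a"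
  assumes "\<And>n. v (n + p) = v n"
  shows "v (n mod p) = v n"
  using periodic_mult[of v p "n mod p" "n div p", OF assms] by (simp add: mult.commute)

lemma transfer_matrix_power:
  assumes "\<And>n. v (n + int p) = v n"
  shows "transfer_matrix v n (N * p) = transfer_matrix v n p ^ N"
proof (induction N)
  case (Suc N)
  have "transfer_matrix v n (Suc N * p) = transfer_matrix v n (N * p + p)" by (simp add: add.commute)
  also have "\<dots> = transfer_matrix v (n + int N * int p) p * transfer_matrix v n (N * p)"
    by (simp add: transfer_matrix_add)
  also have "transfer_matrix v (n + int N * int p) p = transfer_matrix v n p"
  proof (rule transfer_matrix_cong)
    fix i
    show "v (n + int N * int p + int i) = v (n + int i)"
      using periodic_mult[of v "int p" "n + int i" "int N", OF assms] by (simp add: algebra_simps)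
  qed
  finally show ?case using Suc by simp
qed simp

lemma trace2_transfer_matrix_shift:
  assumes "\<And>n. v (n + int p) = v n"
  shows "trace2 (transfer_matrix v n p) = trace2 (transfer_matrix v 0 p)"
proof -
  have "trace2 (transfer_matrix v (n + 1) p) = trace2 (transfer_matrix v n p)" for n
  proof (rule trace2_conjugate)
    show "transfer_matrix v (n + 1) p * step (v n) = step (v n) * transfer_matrix v n p"
      using transfer_matrix_add[of v n 1 p] assms[of n] by simp
  qed simp
  then show ?thesis
    using periodic_mod[of "\<lambda>n. trace2 (transfer_matrix v n p)" 1 n] by simp
qed

text \<open>Cayley-Hamilton gives A^n = U_{n-1} A - U_{n-2}, where U_{n-1} = sin (n x) / sin x is
  the Chebyshev polynomial of the second kind at cos x. If n x is a multiple of pi, the power is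
  therefore scalar.\<close>

lemma mat2_power_trigonometric:
  assumes "trace2 A = 2 * cos x" "det2 A = 1" "sin x \<noteq> 0"
  shows "A ^ n = Mat2 ((sin (n * x) * m11 A - sin (n * x - x)) / sin x) (sin (n * x) * m12 A / sin x)
      (sin (n * x) * m21 A / sin x) ((sin (n * x) * m22 A - sin (n * x - x)) / sin x)"
proof (induction n)
  case (Suc n)
  have s1: "sin (real (Suc n) * x) = 2 * cos x * sin (n * x) - sin (n * x - x)"
    by (simp add: distrib_right sin_add sin_diff)
  have s2: "real (Suc n) * x - x = n * x" by (simp add: distrib_right)
  have tr: "m22 A = 2 * cos x - m11 A" using assms(1) by (simp add: trace2_def)
  have dt: "m12 A * m21 A = m11 A * m22 A - 1" using assms(2) by (simp add: det2_def)
  have "A ^ Suc n = A * A ^ n" by simp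
  also have "\<dots> = Mat2 ((sin (real (Suc n) * x) * m11 A - sin (n * x)) / sin x)
      (sin (real (Suc n) * x) * m12 A / sin x) (sin (real (Suc n) * x) * m21 A / sin x)
      ((sin (real (Suc n) * x) * m22 A - sin (n * x)) / sin x)"
  proof (rule mat2.expand, intro conjI)
    have "m11 A * (sin (n * x) * m11 A - sin (n * x - x)) + sin (n * x) * (m12 A * m21 A) =
        (2 * cos x * sin (n * x) - sin (n * x - x)) * m11 A - sin (n * x)"
      unfolding dt tr by algebra
    then show "m11 (A * A ^ n) = m11 (Mat2 ((sin (real (Suc n) * x) * m11 A - sin (n * x)) / sin x)
      (sin (real (Suc n) * x) * m12 A / sin x) (sin (real (Suc n) * x) * m21 A / sin x)
      ((sin (real (Suc n) * x) * m22 A - sin (n * x)) / sin x))"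
      unfolding s1 using assms(3) by (simp add: Suc field_simps)
    have "m22 A * (sin (n * x) * m22 A - sin (n * x - x)) + sin (n * x) * (m12 A * m21 A) =
        (2 * cos x * sin (n * x) - sin (n * x - x)) * m22 A - sin (n * x)"
      unfolding dt tr by algebra
    then show "m22 (A * A ^ n) = m22 (Mat2 ((sin (real (Suc n) * x) * m11 A - sin (n * x)) / sin x)
      (sin (real (Suc n) * x) * m12 A / sin x) (sin (real (Suc n) * x) * m21 A / sin x)
      ((sin (real (Suc n) * x) * m22 A - sin (n * x)) / sin x))"
      unfolding s1 using assms(3) by (simp add: Suc field_simps)
    show "m12 (A * A ^ n) = m12 (Mat2 ((sin (real (Suc n) * x) * m11 A - sin (n * x)) / sin x)
      (sin (real (Suc n) * x) * m12 A / sin x) (sin (real (Suc n) * x) * m21 A / sin x)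
      ((sin (real (Suc n) * x) * m22 A - sin (n * x)) / sin x))"
      unfolding s1 using assms(3) by (simp add: Suc tr field_simps)
    show "m21 (A * A ^ n) = m21 (Mat2 ((sin (real (Suc n) * x) * m11 A - sin (n * x)) / sin x)
      (sin (real (Suc n) * x) * m12 A / sin x) (sin (real (Suc n) * x) * m21 A / sin x)
      ((sin (real (Suc n) * x) * m22 A - sin (n * x)) / sin x))"
      unfolding s1 using assms(3) by (simp add: Suc tr field_simps)
  qed
  finally show ?case unfolding s2 .
qed (simp add: one_mat2_def assms)

text \<open>
  A pair is a column of the transfer matrix of \<open>a + t\<close>, as polynomials in \<open>t\<close>.
\<close>

primrec column_poly :: "(int \<Rightarrow> real) \<Rightarrow> real poly \<times> real poly \<Rightarrow> int \<Rightarrow> nat \<Rightarrow> real poly \<times> real poly" where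
  "column_poly a c n 0 = c"
| "column_poly a c n (Suc j) =
    ([:a (n + int j), 1:] * fst (column_poly a c n j) - snd (column_poly a c n j),
     fst (column_poly a c n j))"

lemma transfer_matrix_poly:
  "transfer_matrix (\<lambda>m. a m + t) n j =
    Mat2 (poly (fst (column_poly a (1, 0) n j)) t) (poly (fst (column_poly a (0, 1) n j)) t)
      (poly (snd (column_poly a (1, 0) n j)) t) (poly (snd (column_poly a (0, 1) n j)) t)"
proof (induction j)
  case 0
  show ?case by (simp add: one_mat2_def)
next
  case (Suc j)
  show ?case by (simp only: transfer_matrix.simps Suc) (simp add: times_mat2_def algebra_simps)
qed

lemma degree_linear_mult:
  fixes p :: "real poly"
  assumes "p \<noteq> 0"
  shows "degree ([:x, 1:] * p) = Suc (degree p)"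
  using assms by (subst degree_mult_eq) auto

text \<open>The exact degree of the upper left entry makes the trace nonconstant under shifts of the
  potential, and later bounds the number of eigenvalues of a box by its length.\<close>

lemma degree_column_poly_1:
  "degree (fst (column_poly a (1, 0) n j)) = j \<and> fst (column_poly a (1, 0) n j) \<noteq> 0 \<and>
   degree (snd (column_poly a (1, 0) n j)) \<le> j - 1"
proof (induction j)
  case (Suc j)
  let ?p = "fst (column_poly a (1, 0) n j)" and ?q = "snd (column_poly a (1, 0) n j)"
  have "degree ([:a (n + int j), 1:] * ?p - ?q) = Suc j"
  proof -
    have "degree ([:a (n + int j), 1:] * ?p) = Suc j" using Suc degree_linear_mult[of ?p] by simp
    moreover have "degree (- ?q) < Suc j" using Suc by auto
    ultimately show ?thesis using degree_add_eq_left[of "- ?q"] by (metis diff_conv_add_uminus)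
  qed
  then show ?case using Suc by (auto simp del: mult_pCons_left)
qed simp

lemma degree_column_poly_2:
  "degree (fst (column_poly a (0, 1) n j)) \<le> j \<and> degree (snd (column_poly a (0, 1) n j)) \<le> j - 1"
proof (induction j)
  case (Suc j)
  let ?p = "fst (column_poly a (0, 1) n j)" and ?q = "snd (column_poly a (0, 1) n j)"
  have "degree ([:a (n + int j), 1:] * ?p) \<le> Suc j"
    using degree_mult_le[of "[:a (n + int j), 1:]" ?p] Suc by simp
  then have "degree ([:a (n + int j), 1:] * ?p - ?q) \<le> Suc j"
    using Suc by (intro degree_diff_le) auto
  then show ?case using Suc by (simp del: mult_pCons_left)
qed simp

lemma nonconstant_poly_interval:
  fixes q :: "real poly"
  assumes "0 < degree q" "0 < e"
  shows "\<exists>t\<in>{0..e}. poly q t \<noteq> c"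
proof (rule ccontr)
  assume "\<not> ?thesis"
  then have "{0..e} \<subseteq> {t. poly (q - [:c:]) t = 0}" by auto
  moreover have "q - [:c:] \<noteq> 0" using assms(1) by auto
  then have "finite {t. poly (q - [:c:]) t = 0}" by (rule poly_roots_finite)
  ultimately show False using \<open>0 < e\<close> infinite_Icc[of 0 e] finite_subset by blast
qed

text \<open>
  The trace is a nonconstant polynomial of a shift of the potential, so it takes a value
  \<open>2 cos x\<close> with \<open>x\<close> a rational multiple of \<open>pi\<close>.
\<close>

lemma periodic_shift_finite_order:
  fixes v :: "int \<Rightarrow> real"
  assumes "0 < p" "0 < e"
    and small: "\<And>t. t \<in> {0..e} \<Longrightarrow> \<bar>trace2 (transfer_matrix (\<lambda>m. v m + t) 0 p)\<bar> \<le> 2"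
  shows "\<exists>t\<in>{0..e}. \<exists>N\<ge>2. \<exists>s. (s = 1 \<or> s = - 1) \<and>
    transfer_matrix (\<lambda>m. v m + t) 0 p ^ N = Mat2 s 0 0 s"
proof -
  define q where "q = fst (column_poly v (1, 0) 0 p) + snd (column_poly v (0, 1) 0 p)"
  have tr: "trace2 (transfer_matrix (\<lambda>m. v m + t) 0 p) = poly q t" for t
    by (simp add: transfer_matrix_poly trace2_def q_def)
  have "degree (snd (column_poly v (0, 1) 0 p)) < degree (fst (column_poly v (1, 0) 0 p))"
    using degree_column_poly_1[of v 0 p] degree_column_poly_2[of v 0 p] \<open>0 < p\<close> by linarith
  then have "degree q = degree (fst (column_poly v (1, 0) 0 p))"
    unfolding q_def by (rule degree_add_eq_left)
  then have "0 < degree q" using degree_column_poly_1[of v 0 p] \<open>0 < p\<close> by simp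
  then obtain t1 where t1: "t1 \<in> {0..e}" "poly q t1 \<noteq> poly q 0"
    using nonconstant_poly_interval \<open>0 < e\<close> by blast
  have le2: "\<bar>poly q t\<bar> \<le> 2" if "t \<in> {0..e}" for t using small[OF that] tr by simp
  define lo hi where "lo = min (poly q 0) (poly q t1)" and "hi = max (poly q 0) (poly q t1)"
  have lohi: "lo < hi" "- 2 \<le> lo" "hi \<le> 2"
    using t1 le2[of 0] le2[of t1] \<open>0 < e\<close> by (auto simp: lo_def hi_def min_def max_def abs_le_iff)
  have "arccos (hi / 2) < arccos (lo / 2)"
    using lohi by (intro arccos_less_arccos) auto
  then have "arccos (hi / 2) / pi < arccos (lo / 2) / pi" by (simp add: divide_strict_right_mono)
  then obtain r where r: "r \<in> \<rat>" "arccos (hi / 2) / pi < r" "r < arccos (lo / 2) / pi"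
    using Rats_dense_in_real by blast
  define x where "x = pi * r"
  have x: "arccos (hi / 2) < x" "x < arccos (lo / 2)"
    using r by (simp_all add: x_def field_simps)
  have x0: "0 < x" "x < pi"
    using x arccos_lbound[of "hi / 2"] arccos_ubound[of "lo / 2"] lohi by auto
  then have r01: "0 < r" "r < 1" by (auto simp: x_def zero_less_mult_iff)
  obtain a N :: nat where aN: "N \<noteq> 0" "\<bar>r\<bar> = a / N"
    using r(1) Rats_abs_nat_div_natE by metis
  \<comment> \<open>Since x lies strictly between 0 and pi, r is not an integer. The bound ensures
    that a period N p contains two neighbouring sites even if p = 1.\<close>
  have N2: "N \<ge> 2"
  proof (rule ccontr)
    assume "\<not> N \<ge> 2"
    then have "N = 1" using aN(1) by simp
    then show False using aN(2) r01 by simp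
  qed
  have Nx: "N * x = a * pi" using aN r01 by (simp add: x_def field_simps)
  have "lo / 2 < cos x" "cos x < hi / 2"
    using cos_monotone_0_pi[of x "arccos (lo / 2)"] cos_monotone_0_pi[of "arccos (hi / 2)" x]
      x x0 lohi arccos_lbound[of "hi / 2"] arccos_ubound[of "lo / 2"] by auto
  then have "lo < 2 * cos x" "2 * cos x < hi" by simp_all
  moreover have "continuous_on {0..t1} (poly q)" by (intro continuous_intros)
  ultimately have "\<exists>t. 0 \<le> t \<and> t \<le> t1 \<and> poly q t = 2 * cos x"
    using t1(1) IVT'[of "poly q" 0 "2 * cos x" t1] IVT2'[of "poly q" t1 "2 * cos x" 0]
    by (auto simp: lo_def hi_def min_def max_def split: if_splits)
  then obtain t where "0 \<le> t" "t \<le> t1" and tx: "poly q t = 2 * cos x" by blast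
  then have t: "t \<in> {0..e}" "poly q t = 2 * cos x" using t1(1) by simp_all
  define A where "A = transfer_matrix (\<lambda>m. v m + t) 0 p"
  have "sin x \<noteq> 0" using sin_gt_zero[OF x0] by simp
  then have "A ^ N = Mat2 ((sin (N * x) * m11 A - sin (N * x - x)) / sin x) (sin (N * x) * m12 A / sin x)
      (sin (N * x) * m21 A / sin x) ((sin (N * x) * m22 A - sin (N * x - x)) / sin x)"
    using tr t by (intro mat2_power_trigonometric) (simp_all add: A_def)
  also have "sin (N * x) = 0" unfolding Nx by simp
  also have "sin (N * x - x) = - (cos (a * pi) * sin x)" unfolding Nx by (simp add: sin_diff)
  finally have "A ^ N = Mat2 (cos (a * pi)) 0 0 (cos (a * pi))"
    using \<open>sin x \<noteq> 0\<close> by simp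
  moreover have "cos (a * pi) = 1 \<or> cos (a * pi) = - 1"
    by (cases "even a") (simp_all add: cos_npi)
  ultimately show ?thesis using t(1) N2 unfolding A_def by blast
qed

text \<open>
  When the monodromy is \<open>1\<close> or \<open>-1\<close>, changing two neighbouring values by \<open>-s\<close> and \<open>s\<close>
  turns the trace \<open>2\<close> into \<open>2 + s\<^sup>2\<close>.
\<close>

lemma hyperbolic_perturbation:
  fixes v :: "int \<Rightarrow> real"
  assumes "0 < p" and per: "\<And>n. v (n + int p) = v n" and "0 < e"
  shows "\<exists>P>0. \<exists>w. (\<forall>n. w (n + int P) = w n) \<and> (\<forall>n. \<bar>w n - v n\<bar> \<le> e) \<and>
    2 < \<bar>trace2 (transfer_matrix w 0 P)\<bar>"
proof (cases "\<exists>t\<in>{0..e / 2}. 2 < \<bar>trace2 (transfer_matrix (\<lambda>m. v m + t) 0 p)\<bar>")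
  case True
  then obtain t where t: "t \<in> {0..e / 2}" "2 < \<bar>trace2 (transfer_matrix (\<lambda>m. v m + t) 0 p)\<bar>" by blast
  then show ?thesis using \<open>0 < p\<close> \<open>0 < e\<close> per by (intro exI[of _ p] exI[of _ "\<lambda>m. v m + t"] conjI) auto
next
  case False
  then have "\<exists>t\<in>{0..e / 2}. \<exists>N\<ge>2. \<exists>\<sigma>. (\<sigma> = 1 \<or> \<sigma> = - 1) \<and>
      transfer_matrix (\<lambda>m. v m + t) 0 p ^ N = Mat2 \<sigma> 0 0 \<sigma>"
    using \<open>0 < p\<close> \<open>0 < e\<close> by (intro periodic_shift_finite_order) (auto simp: not_less)
  then obtain t N \<sigma> where t: "t \<in> {0..e / 2}" and "N \<ge> 2" and \<sigma>: "\<sigma> = 1 \<or> \<sigma> = - 1"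
    and AN: "transfer_matrix (\<lambda>m. v m + t) 0 p ^ N = Mat2 \<sigma> 0 0 \<sigma>" by blast
  define u where "u m = v m + t" for m
  define L where "L = N * p"
  have "N * 1 \<le> N * p" using \<open>0 < p\<close> by (intro mult_left_mono) auto
  then have "L \<ge> 2" using \<open>N \<ge> 2\<close> unfolding L_def by linarith
  have u_per: "u (n + int L) = u n" for n
    using periodic_mult[of v "int p" n "int N", OF per] by (simp add: u_def L_def)
  have uL: "transfer_matrix u 0 L = Mat2 \<sigma> 0 0 \<sigma>"
    unfolding L_def using AN per by (subst transfer_matrix_power) (simp_all add: u_def[abs_def])
  \<comment> \<open>Half of \<open>e\<close> is spent on the shift \<open>t\<close>, half on the two
    sites. Changes a and b at sites 0 and 1 turn the trace 2 \<sigma> into \<sigma> (2 - a b): one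
    site alone has no effect, and the signs must be opposite.\<close>
  define s where "s = e / 2"
  define w where "w n = u n + (if n mod int L = 0 then - s else if n mod int L = 1 then s else 0)" for n
  define B where "B = transfer_matrix u 2 (L - 2)"
  have split: "transfer_matrix f 0 L = transfer_matrix f 2 (L - 2) * (step (f 1) * step (f 0))" for f
  proof -
    have "transfer_matrix f 0 (2 + (L - 2)) = transfer_matrix f (0 + int 2) (L - 2) * transfer_matrix f 0 2"
      by (rule transfer_matrix_add)
    moreover have "transfer_matrix f 0 2 = step (f 1) * step (f 0)" by (simp add: numeral_2_eq_2)
    ultimately show ?thesis
      by (simp only: le_add_diff_inverse[OF \<open>L \<ge> 2\<close>] of_nat_numeral add_0)
  qed
  have "transfer_matrix w 2 (L - 2) = B"
    unfolding B_def
  proof (rule transfer_matrix_cong)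
    fix i assume "i < L - 2"
    then have "(2 + int i) mod int L = 2 + int i" by simp
    then show "w (2 + int i) = u (2 + int i)" by (simp add: w_def)
  qed
  moreover have "w 0 = u 0 - s" "w 1 = u 1 + s" using \<open>L \<ge> 2\<close> by (simp_all add: w_def)
  ultimately have wL: "transfer_matrix w 0 L = B * (step (u 1 + s) * step (u 0 - s))"
    using split[of w] by simp
  have BS: "B * (step (u 1) * step (u 0)) = Mat2 \<sigma> 0 0 \<sigma>"
    using split[of u] uL by (simp add: B_def)
  define C where "C = Mat2 (- 1) (u 1) (- u 0) (u 1 * u 0 - 1)"
  have SC: "(step (u 1) * step (u 0)) * C = 1"
    by (simp add: C_def step_def times_mat2_def one_mat2_def algebra_simps)
  have "B = B * ((step (u 1) * step (u 0)) * C)" by (simp add: SC)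
  also have "\<dots> = Mat2 \<sigma> 0 0 \<sigma> * C" by (simp only: BS[symmetric] mult.assoc)
  finally have "B = Mat2 \<sigma> 0 0 \<sigma> * C" .
  then have "trace2 (transfer_matrix w 0 L) = \<sigma> * (2 + s\<^sup>2)"
    by (simp add: wL C_def trace2_def power2_eq_square algebra_simps)
  then have "2 < \<bar>trace2 (transfer_matrix w 0 L)\<bar>"
    using \<sigma> \<open>0 < e\<close> by (auto simp: s_def abs_mult)
  moreover have "w (n + int L) = w n" for n using u_per by (simp add: w_def)
  moreover have "\<bar>w n - v n\<bar> \<le> e" for n
    using t \<open>0 < e\<close> by (auto simp: w_def u_def s_def)
  ultimately show ?thesis using \<open>L \<ge> 2\<close> by (intro exI[of _ L] exI[of _ w]) auto
qed


section \<open>Spectral gaps of periodic and sieved operators\<close>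

lemma bounded_range_periodic:
  fixes v :: "int \<Rightarrow> real"
  assumes "0 < P" "\<And>n. v (n + int P) = v n"
  shows "bounded (range v)"
proof -
  have "v n \<in> v ` {0..<int P}" for n
    using periodic_mod[of v "int P" n, OF assms(2)] \<open>0 < P\<close>
    by (intro image_eqI[of _ _ "n mod int P"]) auto
  then have "range v \<subseteq> v ` {0..<int P}" by blast
  then show ?thesis by (rule finite_imp_bounded[OF finite_subset]) simp
qed

lemma transfer_matrix_periodic:
  assumes "\<And>n. v (n + int p) = v n"
  shows "transfer_matrix v (n + k * int p) j = transfer_matrix v n j"
proof (rule transfer_matrix_cong)
  fix i show "v (n + k * int p + int i) = v (n + int i)"
    using periodic_mult[of v "int p" "n + int i" k, OF assms] by (simp add: algebra_simps)
qed

lemma transfer_matrix_entries_le: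
  assumes "\<And>n. \<bar>v n\<bar> \<le> B"
  shows "\<bar>m11 (transfer_matrix v n j)\<bar> \<le> (B + 1) ^ j \<and> \<bar>m12 (transfer_matrix v n j)\<bar> \<le> (B + 1) ^ j \<and>
    \<bar>m21 (transfer_matrix v n j)\<bar> \<le> (B + 1) ^ j \<and> \<bar>m22 (transfer_matrix v n j)\<bar> \<le> (B + 1) ^ j"
proof (induction j)
  case (Suc j)
  have B: "0 \<le> B" using assms[of 0] by linarith
  have *: "\<bar>v (n + int j) * x - y\<bar> \<le> (B + 1) ^ Suc j" "\<bar>x\<bar> \<le> (B + 1) ^ Suc j"
    if "\<bar>x\<bar> \<le> (B + 1) ^ j" "\<bar>y\<bar> \<le> (B + 1) ^ j" for x y
  proof -
    have "\<bar>v (n + int j) * x\<bar> \<le> B * (B + 1) ^ j"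
      unfolding abs_mult using assms that B by (intro mult_mono) auto
    then show "\<bar>v (n + int j) * x - y\<bar> \<le> (B + 1) ^ Suc j"
      using that(2) by (simp add: distrib_right)
    have "0 \<le> B * (B + 1) ^ j" using B by simp
    then show "\<bar>x\<bar> \<le> (B + 1) ^ Suc j" using that(1) by (simp add: distrib_right)
  qed
  show ?case using Suc *[of "m11 (transfer_matrix v n j)" "m21 (transfer_matrix v n j)"]
      *[of "m12 (transfer_matrix v n j)" "m22 (transfer_matrix v n j)"] by simp
qed simp

text \<open>Discrete variation of constants: each step passes on the earlier error with factor at
  most B + 1 and adds one term f i. Here x i stands for the solution at site n - 1 + i, so x 1 and x
  0 form the initial pair.\<close>

lemma transfer_matrix_error:
  fixes x f :: "nat \<Rightarrow> real"
  assumes v: "\<And>n. \<bar>v n\<bar> \<le> B"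
    and rec: "\<And>i. i < j \<Longrightarrow> x (Suc (Suc i)) = v (n + int i) * x (Suc i) - x i + f i"
  shows "\<bar>x (Suc j) - (m11 (transfer_matrix v n j) * x 1 + m12 (transfer_matrix v n j) * x 0)\<bar>
      \<le> (B + 1) ^ j * (\<Sum>i<j. \<bar>f i\<bar>) \<and>
    \<bar>x j - (m21 (transfer_matrix v n j) * x 1 + m22 (transfer_matrix v n j) * x 0)\<bar>
      \<le> (B + 1) ^ j * (\<Sum>i<j. \<bar>f i\<bar>)"
  using rec
proof (induction j)
  case (Suc j)
  have B: "0 \<le> B" using v[of 0] by linarith
  let ?M = "transfer_matrix v n j" and ?s = "\<Sum>i<j. \<bar>f i\<bar>"
  define e1 e2 where "e1 = x (Suc j) - (m11 ?M * x 1 + m12 ?M * x 0)"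
    and "e2 = x j - (m21 ?M * x 1 + m22 ?M * x 0)"
  have IH: "\<bar>e1\<bar> \<le> (B + 1) ^ j * ?s" "\<bar>e2\<bar> \<le> (B + 1) ^ j * ?s"
    using Suc unfolding e1_def e2_def by simp_all
  have C1: "1 \<le> (B + 1) ^ Suc j" using B by (intro one_le_power) simp
  have s: "0 \<le> ?s" by (simp add: sum_nonneg)
  have "\<bar>v (n + int j) * e1\<bar> \<le> B * ((B + 1) ^ j * ?s)"
    unfolding abs_mult using v IH(1) B by (intro mult_mono) auto
  moreover have "1 * \<bar>f j\<bar> \<le> (B + 1) ^ Suc j * \<bar>f j\<bar>" using C1 by (intro mult_right_mono) auto
  ultimately have "\<bar>v (n + int j) * e1 - e2 + f j\<bar> \<le> (B + 1) ^ Suc j * (?s + \<bar>f j\<bar>)"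
    using IH(2) by (simp add: algebra_simps)
  moreover have "x (Suc (Suc j)) - (m11 (transfer_matrix v n (Suc j)) * x 1 +
      m12 (transfer_matrix v n (Suc j)) * x 0) = v (n + int j) * e1 - e2 + f j"
    using Suc.prems[of j] by (simp add: e1_def e2_def algebra_simps)
  moreover have "\<bar>e1\<bar> \<le> (B + 1) ^ Suc j * (?s + \<bar>f j\<bar>)"
  proof -
    have "(B + 1) ^ j * ?s \<le> (B + 1) ^ Suc j * (?s + \<bar>f j\<bar>)"
      using B s by (intro mult_mono) auto
    then show ?thesis using IH(1) by linarith
  qed
  moreover have "x (Suc j) - (m21 (transfer_matrix v n (Suc j)) * x 1 +
      m22 (transfer_matrix v n (Suc j)) * x 0) = e1"
    by (simp add: e1_def)
  ultimately show ?case by (simp only: sum.lessThan_Suc)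
qed simp

text \<open>Fits runs of Q sites whose position depends on x into one fixed set of shifts, as
  \<open>norm_le_sum_shifts\<close> demands.\<close>

lemma sum_lessThan_le_window:
  fixes g :: "int \<Rightarrow> real"
  assumes "- int Q \<le> a" "a \<le> 0" and "\<And>n. 0 \<le> g n"
  shows "(\<Sum>i<Q. g (x + a + int i)) \<le> (\<Sum>j\<in>{- int Q..int Q}. g (x + j))"
proof -
  have "(\<Sum>i<Q. g (x + a + int i)) = (\<Sum>j\<in>(\<lambda>i. a + int i) ` {..<Q}. g (x + j))"
    by (subst sum.reindex) (auto simp: inj_on_def add.assoc)
  also have "\<dots> \<le> (\<Sum>j\<in>{- int Q..int Q}. g (x + j))"
    using assms by (intro sum_mono2) auto
  finally show ?thesis .
qed

text \<open>
  Cayley-Hamilton for the monodromy \<open>M\<close>: since \<open>M + M\<^sup>-\<^sup>1\<close> is the scalar \<open>tr M\<close>, a solution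
  satisfies \<open>u (x + Q) + u (x - Q) = tr M * u x\<close>, which forces \<open>u = 0\<close> if \<open>\<bar>tr M\<bar> > 2\<close>.
\<close>

lemma hyperbolic_not_in_spectrum:
  assumes "0 < Q" and per: "\<And>n. W (n + int Q) = W n"
    and hyp: "2 < \<bar>trace2 (transfer_matrix (\<lambda>n. E - W n) 0 Q)\<bar>"
  shows "E \<notin> approx_spectrum (schr W)"
proof -
  define v where "v n = E - W n" for n
  have v_per: "v (n + int Q) = v n" for n using per by (simp add: v_def)
  obtain B where B: "\<And>n. \<bar>v n\<bar> \<le> B"
    using bounded_range_periodic[of Q v, OF \<open>0 < Q\<close> v_per] by (auto simp: bounded_iff)
  have "0 \<le> B" using B[of 0] by linarith
  have bW: "bounded (range W)" using bounded_range_periodic[of Q W, OF \<open>0 < Q\<close> per] .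
  define \<tau> where "\<tau> = trace2 (transfer_matrix v 0 Q)"
  define C where "C = (B + 1) ^ Q"
  have C: "1 \<le> C" using \<open>0 \<le> B\<close> by (simp add: C_def)
  define J where "J = {- int Q..int Q}"
  \<comment> \<open>C bounds the error of the forward step. The backward step applies a row of the
    inverse monodromy, with entries at most C, to two errors of size C, whence
    \<open>2 * C * C\<close>.\<close>
  define D where "D = (C + 2 * C * C) * card J + 1"
  have "0 < D" using C by (simp add: D_def add_nonneg_pos)
  have "(\<bar>\<tau>\<bar> - 2) * norm u \<le> D * norm (schr W u - E *\<^sub>R u)" for u
  proof -
    define f where "f = schr W u - E *\<^sub>R u"
    have f: "seq u (n + 1) = v n * seq u n - seq u (n - 1) + seq f n" for n
      by (simp add: f_def seq_schr[OF bW] v_def algebra_simps)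
    define w where "w = shift (int Q) u + shift (- int Q) u - \<tau> *\<^sub>R u"
    have "norm w \<le> (C + 2 * C * C) * card J * norm f"
    proof (rule norm_le_sum_shifts)
      fix n
      define M where "M = transfer_matrix v n Q"
      have M': "transfer_matrix v (n - int Q) Q = M"
        using transfer_matrix_periodic[of v Q n "- 1" Q, OF v_per] by (simp add: M_def)
      have tau: "m22 M = \<tau> - m11 M"
        using trace2_transfer_matrix_shift[of v Q n, OF v_per] by (simp add: \<tau>_def M_def trace2_def)
      have det: "m11 M * m22 M - m12 M * m21 M = 1"
        using det2_transfer_matrix[of v n Q] by (simp add: det2_def M_def)
      define S where "S = (\<Sum>j\<in>J. \<bar>seq f (n + j)\<bar>)"
      have S1: "(\<Sum>i<Q. \<bar>seq f (n + int i)\<bar>) \<le> S"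
        unfolding S_def J_def using sum_lessThan_le_window[of Q 0 "\<lambda>n. \<bar>seq f n\<bar>" n] by simp
      have S2: "(\<Sum>i<Q. \<bar>seq f (n - int Q + int i)\<bar>) \<le> S"
        unfolding S_def J_def using sum_lessThan_le_window[of Q "- int Q" "\<lambda>n. \<bar>seq f n\<bar>" n] by simp
      define a b c d where "a = seq u (n - int Q)" and "b = seq u (n - int Q - 1)"
        and "c = seq u n" and "d = seq u (n - 1)"
      have fwd: "\<bar>seq u (n + int Q) - (m11 M * c + m12 M * d)\<bar> \<le> C * S"
      proof -
        have "\<bar>seq u (n - 1 + int (Suc Q)) - (m11 M * seq u (n - 1 + int 1) + m12 M * seq u (n - 1 + int 0))\<bar>
            \<le> (B + 1) ^ Q * (\<Sum>i<Q. \<bar>seq f (n + int i)\<bar>)"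
          unfolding M_def
        proof (rule conjunct1[OF transfer_matrix_error[of v B, OF B]])
          fix i show "seq u (n - 1 + int (Suc (Suc i))) =
              v (n + int i) * seq u (n - 1 + int (Suc i)) - seq u (n - 1 + int i) + seq f (n + int i)"
            using f[of "n + int i"] by (simp add: algebra_simps)
        qed
        also have "\<dots> \<le> C * S"
          unfolding C_def[symmetric] using S1 C by (intro mult_left_mono) auto
        finally show ?thesis by (simp add: c_def d_def add.commute)
      qed
      have bwd: "\<bar>c - (m11 M * a + m12 M * b)\<bar> \<le> C * S \<and> \<bar>d - (m21 M * a + m22 M * b)\<bar> \<le> C * S"
      proof -
        let ?x = "\<lambda>i. seq u (n - int Q - 1 + int i)"
        have "\<bar>?x (Suc Q) - (m11 M * ?x 1 + m12 M * ?x 0)\<bar>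
            \<le> (B + 1) ^ Q * (\<Sum>i<Q. \<bar>seq f (n - int Q + int i)\<bar>) \<and>
          \<bar>?x Q - (m21 M * ?x 1 + m22 M * ?x 0)\<bar>
            \<le> (B + 1) ^ Q * (\<Sum>i<Q. \<bar>seq f (n - int Q + int i)\<bar>)"
          unfolding M'[symmetric]
        proof (rule transfer_matrix_error[of v B, OF B])
          fix i show "?x (Suc (Suc i)) =
              v (n - int Q + int i) * ?x (Suc i) - ?x i + seq f (n - int Q + int i)"
            using f[of "n - int Q + int i"] by (simp add: algebra_simps)
        qed
        moreover have "(B + 1) ^ Q * (\<Sum>i<Q. \<bar>seq f (n - int Q + int i)\<bar>) \<le> C * S"
          unfolding C_def[symmetric] using S2 C by (intro mult_left_mono) auto
        ultimately show ?thesis by (simp add: a_def b_def c_def d_def)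
      qed
      define e1 e2 where "e1 = c - (m11 M * a + m12 M * b)" and "e2 = d - (m21 M * a + m22 M * b)"
      have e: "\<bar>e1\<bar> \<le> C * S" "\<bar>e2\<bar> \<le> C * S" using bwd by (simp_all add: e1_def e2_def)
      have Mb: "\<bar>m22 M\<bar> \<le> C" "\<bar>m12 M\<bar> \<le> C"
        using transfer_matrix_entries_le[of v B n Q, OF B] by (simp_all add: M_def C_def)
      have "m22 M * e1 - m12 M * e2 = m22 M * c - m12 M * d - (m11 M * m22 M - m12 M * m21 M) * a"
        by (simp add: e1_def e2_def algebra_simps)
      then have inv: "a = m22 M * c - m12 M * d - (m22 M * e1 - m12 M * e2)" by (simp add: det)
      have "\<bar>m22 M * e1\<bar> \<le> C * (C * S)" "\<bar>m12 M * e2\<bar> \<le> C * (C * S)"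
        unfolding abs_mult using Mb e C by (intro mult_mono; simp)+
      then have "\<bar>m22 M * e1 - m12 M * e2\<bar> \<le> 2 * C * C * S" by (simp add: algebra_simps)
      moreover have "seq w n = (seq u (n + int Q) - (m11 M * c + m12 M * d)) - (m22 M * e1 - m12 M * e2)"
      proof -
        have "seq w n = seq u (n + int Q) + a - \<tau> * c"
          by (simp add: w_def a_def c_def)
        also have "\<dots> = (seq u (n + int Q) - (m11 M * c + m12 M * d)) - (m22 M * e1 - m12 M * e2)"
          using inv unfolding tau by (simp add: algebra_simps)
        finally show ?thesis .
      qed
      ultimately have "\<bar>seq w n\<bar> \<le> C * S + 2 * C * C * S" using fwd by linarith
      then show "\<bar>seq w n\<bar> \<le> (C + 2 * C * C) * (\<Sum>j\<in>J. \<bar>seq f (n + j)\<bar>)"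
        by (simp add: S_def distrib_right)
    qed (use C in \<open>auto simp: J_def\<close>)
    then have w: "norm w \<le> D * norm f"
      unfolding D_def distrib_right[of _ 1] mult_1 using norm_ge_zero[of f] by linarith
    have "norm (\<tau> *\<^sub>R u) = norm (shift (int Q) u + shift (- int Q) u - w)" by (simp add: w_def)
    also have "\<dots> \<le> norm (shift (int Q) u) + norm (shift (- int Q) u) + norm w"
      by (intro norm_triangle_le_diff norm_triangle_mono add_mono norm_triangle_ineq order_refl)
    finally show ?thesis using w by (simp add: f_def algebra_simps)
  qed
  then have "bounded_below (schr W) E ((\<bar>\<tau>\<bar> - 2) / D)"
    using \<open>0 < D\<close> by (simp add: bounded_below_def field_simps)
  moreover have "0 < (\<bar>\<tau>\<bar> - 2) / D" using hyp \<open>0 < D\<close> by (simp add: \<tau>_def v_def[abs_def])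
  ultimately show ?thesis unfolding not_in_approx_spectrum by blast
qed

text \<open>A zero at n removes the bond between n - 1 and n, so the boxes left over are the Q sites
  starting at c and their translates by multiples of Q.\<close>

definition hopping_cut :: "int \<Rightarrow> nat \<Rightarrow> int \<Rightarrow> real" where
  "hopping_cut c Q n = (if (n - c) mod int Q = 0 then 0 else 1)"

lemma bounded_range_hopping_cut: "bounded (range (hopping_cut c Q))"
  by (rule mul_bounded_by(1)[where B = 1]) (simp add: hopping_cut_def)

text \<open>On each box the recursion starts from boundary value 0 and must return to 0 after Q
  steps, so P times the first value is bounded by the inhomogeneity. If P is nonzero this controls
  the first value and then, through transfer matrices, the whole box. Periodicity makes the
  constants the same for all boxes.\<close>

lemma spectrum_cut_root:
  assumes "0 < Q" and per: "\<And>n. W (n + int Q) = W n"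
    and E: "E \<in> approx_spectrum (jacobi (hopping_cut c Q) W)"
  shows "m11 (transfer_matrix (\<lambda>n. E - W n) c Q) = 0"
proof (rule ccontr)
  define v where "v n = E - W n" for n
  define P where "P = m11 (transfer_matrix v c Q)"
  assume "m11 (transfer_matrix (\<lambda>n. E - W n) c Q) \<noteq> 0"
  then have "P \<noteq> 0" by (simp add: P_def v_def[abs_def])
  have v_per: "v (n + int Q) = v n" for n using per by (simp add: v_def)
  obtain B where B: "\<And>n. \<bar>v n\<bar> \<le> B"
    using bounded_range_periodic[of Q v, OF \<open>0 < Q\<close> v_per] by (auto simp: bounded_iff)
  have "0 \<le> B" using B[of 0] by linarith
  have bW: "bounded (range W)" using bounded_range_periodic[of Q W, OF \<open>0 < Q\<close> per] .
  define C where "C = (B + 1) ^ Q"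
  have C: "1 \<le> C" using \<open>0 \<le> B\<close> by (simp add: C_def)
  define J where "J = {- int Q..int Q}"
  define D where "D = C * (C / \<bar>P\<bar>) + C"
  have "0 \<le> D" using C by (simp add: D_def)
  have *: "norm u \<le> D * card J * norm (jacobi (hopping_cut c Q) W u - E *\<^sub>R u)" for u
  proof (rule norm_le_sum_shifts)
    fix x
    define f where "f = jacobi (hopping_cut c Q) W u - E *\<^sub>R u"
    define r where "r = nat ((x - c) mod int Q)"
    have r: "int r = (x - c) mod int Q" "r < Q" using \<open>0 < Q\<close> by (simp_all add: r_def nat_less_iff)
    define b where "b = x - int r"
    define k where "k = (x - c) div int Q"
    have b: "b = c + k * int Q" using div_mult_mod_eq[of "x - c" "int Q"] unfolding b_def k_def r(1) by linarith
    have cutb: "hopping_cut c Q (b + int i) = (if i = 0 \<or> i = Q then 0 else 1)" if "i \<le> Q" for i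
    proof -
      have "(b + int i - c) mod int Q = int i mod int Q" by (simp add: b)
      then show ?thesis using that \<open>0 < Q\<close> by (cases "i = Q") (auto simp: hopping_cut_def)
    qed
    \<comment> \<open>Zeros at the outer neighbours b - 1 and b + Q of the box turn the equation
      with removed bonds into the ordinary recursion with Dirichlet data.\<close>
    define X where "X i = (if i = 0 \<or> i = Suc Q then 0 else seq u (b + int i - 1))" for i
    define g where "g i = seq f (b + int i)" for i
    have rec: "X (Suc (Suc i)) = v (b + int i) * X (Suc i) - X i + g i" if "i < Q" for i
    proof -
      have "g i = hopping_cut c Q (b + int i) * seq u (b + int i - 1) +
          hopping_cut c Q (b + int (Suc i)) * seq u (b + int (Suc i)) - v (b + int i) * seq u (b + int i)"
        unfolding g_def f_def
        by (simp add: seq_jacobi[OF bounded_range_hopping_cut bW] v_def algebra_simps)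
      also have "hopping_cut c Q (b + int i) * seq u (b + int i - 1) = X i"
        using that by (subst cutb) (auto simp: X_def)
      also have "hopping_cut c Q (b + int (Suc i)) * seq u (b + int (Suc i)) = X (Suc (Suc i))"
        using that by (subst cutb) (auto simp: X_def add_ac)
      also have "seq u (b + int i) = X (Suc i)" using that by (simp add: X_def)
      finally show ?thesis by simp
    qed
    define S where "S = (\<Sum>j\<in>J. \<bar>seq f (x + j)\<bar>)"
    have S: "(\<Sum>i<Q. \<bar>g i\<bar>) \<le> S"
      unfolding S_def J_def g_def b_def
      using sum_lessThan_le_window[of Q "- int r" "\<lambda>n. \<bar>seq f n\<bar>" x] r(2) by simp
    have Tb: "transfer_matrix v b Q = transfer_matrix v c Q"
      unfolding b by (rule transfer_matrix_periodic[of v Q, OF v_per])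
    have "\<bar>X (Suc Q) - (m11 (transfer_matrix v b Q) * X 1 + m12 (transfer_matrix v b Q) * X 0)\<bar> \<le>
        (B + 1) ^ Q * (\<Sum>i<Q. \<bar>g i\<bar>)"
      by (rule conjunct1[OF transfer_matrix_error[of v B Q X b g, OF B rec]])
    also have "\<dots> \<le> C * S" unfolding C_def[symmetric] using S C by (intro mult_left_mono) auto
    finally have "\<bar>P\<bar> * \<bar>X 1\<bar> \<le> C * S" by (simp add: Tb X_def[of 0] X_def[of "Suc Q"] P_def abs_mult)
    then have X1: "\<bar>X 1\<bar> \<le> C / \<bar>P\<bar> * S" using \<open>P \<noteq> 0\<close> by (simp add: field_simps)
    have le: "(B + 1) ^ r \<le> C" unfolding C_def using \<open>0 \<le> B\<close> r(2) by (intro power_increasing) auto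
    have "\<bar>X (Suc r) - (m11 (transfer_matrix v b r) * X 1 + m12 (transfer_matrix v b r) * X 0)\<bar> \<le>
        (B + 1) ^ r * (\<Sum>i<r. \<bar>g i\<bar>)"
      by (rule conjunct1[OF transfer_matrix_error[of v B r X b g, OF B rec]]) (use r(2) in simp)
    also have "\<dots> \<le> C * S"
    proof (intro mult_mono le)
      have "(\<Sum>i<r. \<bar>g i\<bar>) \<le> (\<Sum>i<Q. \<bar>g i\<bar>)" using r(2) by (intro sum_mono2) auto
      then show "(\<Sum>i<r. \<bar>g i\<bar>) \<le> S" using S by linarith
    qed (use C in \<open>auto simp: sum_nonneg\<close>)
    finally have 1: "\<bar>X (Suc r) - m11 (transfer_matrix v b r) * X 1\<bar> \<le> C * S"
      by (simp add: X_def[of 0])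
    have "\<bar>m11 (transfer_matrix v b r)\<bar> \<le> C"
      using transfer_matrix_entries_le[of v B b r, OF B] le by linarith
    then have "\<bar>m11 (transfer_matrix v b r) * X 1\<bar> \<le> C * (C / \<bar>P\<bar> * S)"
      unfolding abs_mult using X1 C by (intro mult_mono) auto
    then have "\<bar>X (Suc r)\<bar> \<le> C * (C / \<bar>P\<bar> * S) + C * S" using 1 by linarith
    moreover have "X (Suc r) = seq u x" using r(2) by (simp add: X_def b_def)
    ultimately show "\<bar>seq u x\<bar> \<le> D * (\<Sum>j\<in>J. \<bar>seq (jacobi (hopping_cut c Q) W u - E *\<^sub>R u) (x + j)\<bar>)"
      unfolding f_def[symmetric] S_def[symmetric] by (simp add: D_def algebra_simps)
  qed (use \<open>0 \<le> D\<close> in \<open>auto simp: J_def\<close>)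
  have "norm u \<le> (D * card J + 1) * norm (jacobi (hopping_cut c Q) W u - E *\<^sub>R u)" for u
    unfolding distrib_right mult_1
    using *[of u] norm_ge_zero[of "jacobi (hopping_cut c Q) W u - E *\<^sub>R u"] by linarith
  note * = this
  have "0 < D * card J + 1" using \<open>0 \<le> D\<close> by (simp add: add_nonneg_pos)
  then have "bounded_below (jacobi (hopping_cut c Q) W) E (1 / (D * card J + 1))"
    using * by (simp add: bounded_below_def field_simps)
  then show False using E \<open>0 < D * card J + 1\<close> by (auto simp: approx_spectrum_def)
qed

section \<open>Sieved potentials and their renormalisation\<close>

lemma sieve_periodic:
  assumes "\<And>n. U (n + int P) = U n"
  shows "sieve k U (n + int (k * P)) = sieve k U n"
proof (cases "k = 0")
  case False
  then show ?thesis using assms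
    by (auto simp: sieve_def dvd_add_left_iff div_plus_div_distrib_dvd_left)
qed simp

text \<open>Powers of the single matrix \<open>step E\<close> are linear combinations of it and the
  identity; these are the linear relations that all such combinations satisfy.\<close>

lemma transfer_matrix_const_entries:
  "m12 (transfer_matrix (\<lambda>_. E) n j) = - m21 (transfer_matrix (\<lambda>_. E) n j) \<and>
   m11 (transfer_matrix (\<lambda>_. E) n j) - m22 (transfer_matrix (\<lambda>_. E) n j) =
     E * m21 (transfer_matrix (\<lambda>_. E) n j)"
  by (induction j) (auto simp: algebra_simps)

text \<open>
  Eliminating the \<open>k - 1\<close> free sites between multiples of \<open>k\<close> turns the sieved operator at
  energy \<open>E\<close> into an unsieved one with a renormalised coupling; this fails only where the
  coupling \<open>m11 (transfer_matrix (\<lambda>_. E) 0 (k - 1))\<close>, a Chebyshev polynomial in \<open>E\<close>, vanishes.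
\<close>

lemma trace2_sieve:
  fixes k :: nat and E l :: real and U :: "int \<Rightarrow> real"
  assumes "k \<ge> 1" "\<And>n. U (n + int P) = U n"
  defines "F \<equiv> transfer_matrix (\<lambda>_. E) 0 (k - 1)"
  assumes F: "m11 F \<noteq> 0"
  shows "trace2 (transfer_matrix (\<lambda>n. E - l * sieve k U n) 0 (k * P)) =
    trace2 (transfer_matrix (\<lambda>m. m11 F * (E - l * U m) - 2 * m21 F) 0 P)"
proof -
  define v where "v n = E - l * sieve k U n" for n
  define w where "w m = m11 F * (E - l * U m) - 2 * m21 F" for m
  \<comment> \<open>C passes from the pair (u (k m), u (k m - 1)) to the pair (u (k m), u (k (m -
    1))) of values at consecutive multiples of k. Its determinant is \<open>m11 F\<close>, which is
    why this must not vanish.\<close>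
  define C where "C = Mat2 1 0 (- m21 F) (m11 F)"
  have m12: "m12 F = - m21 F" unfolding F_def using transfer_matrix_const_entries by blast
  have det: "m11 F * m22 F - m12 F * m21 F = 1"
    using det2_transfer_matrix[of "\<lambda>_. E" 0 "k - 1"] by (simp add: det2_def F_def)
  have block: "transfer_matrix v (int (k * m)) k = F * step (E - l * U (int m))" for m
  proof -
    have "transfer_matrix v (int (k * m)) (1 + (k - 1)) =
        transfer_matrix v (int (k * m) + int 1) (k - 1) * transfer_matrix v (int (k * m)) 1"
      by (rule transfer_matrix_add)
    moreover have "transfer_matrix v (int (k * m) + int 1) (k - 1) = F"
      unfolding F_def
    proof (rule transfer_matrix_cong)
      fix i assume "i < k - 1"
      then have "\<not> int k dvd 1 + int i" by (intro zdvd_not_zless) auto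
      then have "\<not> int k dvd int (k * m) + int 1 + int i"
        by (simp add: add.assoc dvd_add_right_iff)
      then show "v (int (k * m) + int 1 + int i) = E" by (simp add: v_def sieve_def)
    qed
    moreover have "v (int (k * m)) = E - l * U (int m)" using \<open>k \<ge> 1\<close> by (simp add: v_def sieve_def)
    ultimately show ?thesis using \<open>k \<ge> 1\<close> by simp
  qed
  have conj: "C * (F * step x) = step (m11 F * x - 2 * m21 F) * C" for x
    using det m12 by (intro mat2.expand) (simp add: C_def algebra_simps)
  have "C * transfer_matrix v 0 (k * j) = transfer_matrix w 0 j * C" for j
  proof (induction j)
    case (Suc j)
    have "transfer_matrix v 0 (k * j + k) =
        transfer_matrix v (0 + int (k * j)) k * transfer_matrix v 0 (k * j)"
      by (rule transfer_matrix_add)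
    then have "transfer_matrix v 0 (k * Suc j) = F * step (E - l * U (int j)) * transfer_matrix v 0 (k * j)"
      using block[of j] by (simp add: add.commute)
    then have "C * transfer_matrix v 0 (k * Suc j) =
        (C * (F * step (E - l * U (int j)))) * transfer_matrix v 0 (k * j)" by (simp add: mult.assoc)
    also have "\<dots> = step (w (int j)) * (C * transfer_matrix v 0 (k * j))"
      by (simp only: conj w_def mult.assoc)
    finally show ?case by (simp add: Suc mult.assoc)
  qed simp
  then have "trace2 (transfer_matrix w 0 P) = trace2 (transfer_matrix v 0 (k * P))"
    using F by (intro trace2_conjugate[of _ C]) (simp_all add: C_def det2_def)
  then show ?thesis by (simp add: v_def[abs_def] w_def[abs_def])
qed

text \<open>The hyperbolic perturbation is made for the renormalised potential and pulled back along
  the affine map U -> a (E - l U) - 2 c. This map has slope of modulus |a l|, which explains the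
  tolerance \<open>\<bar>a * l\<bar> * e\<close>.\<close>

lemma gap_opening:
  fixes V :: "int \<Rightarrow> real"
  assumes "0 < p" and per: "\<And>n. V (n + int p) = V n"
    and "k \<ge> 1" "l \<noteq> 0" "0 < e" and F: "m11 (transfer_matrix (\<lambda>_. E) 0 (k - 1)) \<noteq> 0"
  shows "\<exists>P>0. \<exists>U. (\<forall>n. U (n + int P) = U n) \<and> (\<forall>n. \<bar>U n - V n\<bar> \<le> e) \<and>
    E \<notin> approx_spectrum (schr (\<lambda>n. l * sieve k U n))"
proof -
  define a c where "a = m11 (transfer_matrix (\<lambda>_. E) 0 (k - 1))"
    and "c = m21 (transfer_matrix (\<lambda>_. E) 0 (k - 1))"
  have "a * l \<noteq> 0" using F \<open>l \<noteq> 0\<close> by (simp add: a_def)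
  define v where "v m = a * (E - l * V m) - 2 * c" for m
  have "\<exists>P>0. \<exists>w. (\<forall>n. w (n + int P) = w n) \<and> (\<forall>n. \<bar>w n - v n\<bar> \<le> \<bar>a * l\<bar> * e) \<and>
      2 < \<bar>trace2 (transfer_matrix w 0 P)\<bar>"
    by (rule hyperbolic_perturbation[OF \<open>0 < p\<close>]) (use per \<open>a * l \<noteq> 0\<close> \<open>0 < e\<close> in \<open>auto simp: v_def\<close>)
  then obtain P w where "P > 0" and w_per: "\<And>n. w (n + int P) = w n"
    and wv: "\<And>n. \<bar>w n - v n\<bar> \<le> \<bar>a * l\<bar> * e" and hyp: "2 < \<bar>trace2 (transfer_matrix w 0 P)\<bar>" by blast
  define U where "U m = (a * E - 2 * c - w m) / (a * l)" for m
  have U_per: "U (n + int P) = U n" for n by (simp add: U_def w_per)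
  have wU: "a * (E - l * U m) - 2 * c = w m" for m
    using \<open>a * l \<noteq> 0\<close> by (simp add: U_def field_simps)
  have "U n - V n = - (w n - v n) / (a * l)" for n
    using \<open>a * l \<noteq> 0\<close> by (simp add: U_def v_def field_simps)
  then have "\<bar>U n - V n\<bar> \<le> e" for n
    using wv[of n] \<open>a * l \<noteq> 0\<close> by (simp add: abs_divide pos_divide_le_eq mult.commute)
  moreover have "E \<notin> approx_spectrum (schr (\<lambda>n. l * sieve k U n))"
  proof (rule hyperbolic_not_in_spectrum)
    show "0 < k * P" using \<open>P > 0\<close> \<open>k \<ge> 1\<close> by simp
    show "l * sieve k U (n + int (k * P)) = l * sieve k U n" for n
      by (simp only: sieve_periodic[of U P k n, OF U_per])
    show "2 < \<bar>trace2 (transfer_matrix (\<lambda>n. E - l * sieve k U n) 0 (k * P))\<bar>"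
      unfolding trace2_sieve[of k U P, OF \<open>k \<ge> 1\<close> U_per F] a_def[symmetric] c_def[symmetric] wU
      by (rule hyp)
  qed
  ultimately show ?thesis using \<open>P > 0\<close> U_per by blast
qed


section \<open>Localisation of the spectrum by gap regions\<close>

text \<open>The points whose whole j-neighbourhood lies in J, built one layer at a time because the
  decay estimate advances by layers.\<close>

primrec erode :: "int set \<Rightarrow> nat \<Rightarrow> int set" where
  "erode J 0 = J"
| "erode J (Suc j) = {n \<in> erode J j. n - 1 \<in> erode J j \<and> n + 1 \<in> erode J j}"

lemma erode_Suc_iff:
  "n \<in> erode J (Suc j) \<longleftrightarrow> n \<in> erode J j \<and> n - 1 \<in> erode J j \<and> n + 1 \<in> erode J j"
  by simp

lemma erode_subset: "erode J j \<subseteq> J"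
  by (induction j) auto

lemma erodeI:
  assumes "\<And>d. \<bar>d\<bar> \<le> int j \<Longrightarrow> n + d \<in> J"
  shows "n \<in> erode J j"
  using assms
proof (induction j arbitrary: n)
  case 0
  then show ?case using 0[of 0] by simp
next
  case (Suc j)
  have "n + e \<in> erode J j" if "\<bar>e\<bar> \<le> 1" for e
  proof (rule Suc.IH)
    fix d :: int assume "\<bar>d\<bar> \<le> int j"
    then have "\<bar>e + d\<bar> \<le> int (Suc j)" using that by linarith
    then show "n + e + d \<in> J" using Suc.prems[of "e + d"] by (simp add: add.assoc)
  qed
  from this[of 0] this[of "- 1"] this[of 1] show ?case by simp
qed

abbreviation restr :: "int set \<Rightarrow> rl2 \<Rightarrow> rl2" where
  "restr A \<equiv> mul (indicat_real A)"

lemma seq_restr [simp]: "seq (restr A u) n = (if n \<in> A then seq u n else 0)"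
  by (subst seq_mul) simp_all

lemma norm_restr_diff:
  assumes "B \<subseteq> A"
  shows "(norm (restr (A - B) u))\<^sup>2 = (norm (restr A u))\<^sup>2 - (norm (restr B u))\<^sup>2"
proof -
  have split: "restr A u = restr B u + restr (A - B) u"
    using assms by (intro rl2_eqI) auto
  have "restr B (restr (A - B) u) = 0"
    by (intro rl2_eqI) auto
  then have "inner (restr B u) (restr (A - B) u) = 0" by (simp add: inner_mul)
  then show ?thesis
    unfolding split by (simp add: norm_add_Pythagorean orthogonal_def)
qed

lemma norm_mul_le: "(\<And>n. \<bar>g n\<bar> \<le> 1) \<Longrightarrow> norm (mul g u) \<le> norm u"
  using mul_bounded_by(2)[of g 1 u] by simp

text \<open>The commutator with an indicator only involves bonds on which the indicator jumps. The
  ends of such a bond lie in the previous erosion but not in the next one; each of the two hopping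
  terms contributes one copy of the mass there.\<close>

lemma norm_commutator_restr_erode:
  assumes W: "bounded (range W)"
  shows "norm (schr W (restr (erode J (Suc j)) u) - restr (erode J (Suc j)) (schr W u)) \<le>
    2 * norm (restr (erode J j - erode J (Suc (Suc j))) u)"
proof -
  define h where "h = indicat_real (erode J (Suc j))"
  define y where "y = restr (erode J j - erode J (Suc (Suc j))) u"
  define g1 g2 where "g1 n = h (n - 1) - h n" and "g2 n = h (n + 1) - h n" for n
  have h: "bounded (range h)" by (simp add: h_def)
  have g: "\<bar>g1 n\<bar> \<le> 1" "\<bar>g2 n\<bar> \<le> 1" for n by (auto simp: g1_def g2_def h_def indicator_def)
  note bg = mul_bounded_by(1)[of g1, OF g(1)] mul_bounded_by(1)[of g2, OF g(2)]
  have y: "seq y n = seq u n" if "n \<in> erode J j - erode J (Suc (Suc j))" for n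
    using that by (simp add: y_def)
  have "schr W (mul h u) - mul h (schr W u) = mul g1 (shift (- 1) y) + mul g2 (shift 1 y)"
  proof (rule rl2_eqI)
    fix n
    have 1: "g1 n * seq y (n - 1) = g1 n * seq u (n - 1)"
    proof (cases "g1 n = 0")
      case False
      then have "n - 1 \<in> erode J (Suc j) \<longleftrightarrow> n \<notin> erode J (Suc j)"
        by (auto simp: g1_def h_def indicator_def simp del: erode.simps)
      then have "n - 1 \<in> erode J j - erode J (Suc (Suc j))"
        using erode_Suc_iff[of "n - 1" J "Suc j"] erode_Suc_iff[of "n - 1" J j] erode_Suc_iff[of n J j]
        by (auto simp del: erode.simps)
      then show ?thesis by (simp only: y)
    qed simp
    have 2: "g2 n * seq y (n + 1) = g2 n * seq u (n + 1)"
    proof (cases "g2 n = 0")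
      case False
      then have "n + 1 \<in> erode J (Suc j) \<longleftrightarrow> n \<notin> erode J (Suc j)"
        by (auto simp: g2_def h_def indicator_def simp del: erode.simps)
      then have "n + 1 \<in> erode J j - erode J (Suc (Suc j))"
        using erode_Suc_iff[of "n + 1" J "Suc j"] erode_Suc_iff[of "n + 1" J j] erode_Suc_iff[of n J j]
        by (auto simp del: erode.simps)
      then show ?thesis by (simp only: y)
    qed simp
    have "seq (schr W (mul h u) - mul h (schr W u)) n = g1 n * seq u (n - 1) + g2 n * seq u (n + 1)"
      by (simp add: seq_schr[OF W] h g1_def g2_def algebra_simps)
    also have "\<dots> = g1 n * seq y (n - 1) + g2 n * seq y (n + 1)" by (simp only: 1 2)
    also have "\<dots> = seq (mul g1 (shift (- 1) y) + mul g2 (shift 1 y)) n" by (simp add: bg)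
    finally show "seq (schr W (mul h u) - mul h (schr W u)) n =
        seq (mul g1 (shift (- 1) y) + mul g2 (shift 1 y)) n" .
  qed
  then have "norm (schr W (mul h u) - mul h (schr W u)) \<le>
      norm (mul g1 (shift (- 1) y)) + norm (mul g2 (shift 1 y))" by (simp only: norm_triangle_ineq)
  also have "\<dots> \<le> norm (shift (- 1) y) + norm (shift 1 y)" by (intro add_mono norm_mul_le g)
  finally show ?thesis by (simp add: h_def y_def)
qed

text \<open>
  An approximate eigenfunction decays exponentially into a region where the potential coincides
  with one for which \<open>E\<close> lies in a spectral gap: the mass in the \<open>j\<close>-th erosion is controlled by
  the mass that the next two erosions strip off.
\<close>

lemma decay_in_gap_region:
  assumes W: "bounded (range W)" and W': "bounded (range W')"
    and agree: "\<And>n. n \<in> J \<Longrightarrow> W n = W' n"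
    and gap: "bounded_below (schr W') E d" and "0 < d"
  shows "(norm (restr (erode J (2 * j)) u))\<^sup>2 \<le>
    (8 / (8 + d\<^sup>2)) ^ j * (norm u)\<^sup>2 + 2 / d\<^sup>2 * (norm (schr W u - E *\<^sub>R u))\<^sup>2"
proof -
  define f where "f = schr W u - E *\<^sub>R u"
  define m where "m j = (norm (restr (erode J j) u))\<^sup>2" for j
  have sub: "erode J (Suc j) \<subseteq> erode J j" for j by auto
  have mono: "m (Suc j) \<le> m j" for j
  proof -
    have "0 \<le> (norm (restr (erode J j - erode J (Suc j)) u))\<^sup>2" by simp
    then show ?thesis unfolding m_def norm_restr_diff[OF sub] by simp
  qed
  have step: "d\<^sup>2 * m (Suc j) \<le> 2 * (norm f)\<^sup>2 + 8 * (m j - m (Suc (Suc j)))" for j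
  proof -
    define A where "A = erode J (Suc j)"
    define x where "x = restr A u"
    have A: "A \<subseteq> J" unfolding A_def by (rule erode_subset)
    have "schr W' x = schr W x"
      using A agree by (intro rl2_eqI) (auto simp: seq_schr[OF W] seq_schr[OF W'] x_def)
    then have eq: "schr W' x - E *\<^sub>R x = (schr W x - restr A (schr W u)) + restr A f"
    proof -
      have "restr A f = restr A (schr W u) - E *\<^sub>R x"
        unfolding f_def x_def by (intro rl2_eqI) (simp add: algebra_simps)
      then show ?thesis using \<open>schr W' x = schr W x\<close> by simp
    qed
    define b where "b = norm (restr (erode J j - erode J (Suc (Suc j))) u)"
    have "d * norm x \<le> norm (schr W' x - E *\<^sub>R x)" using gap by (rule bounded_belowD)
    also have "\<dots> \<le> norm (schr W x - restr A (schr W u)) + norm (restr A f)"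
      unfolding eq by (rule norm_triangle_ineq)
    also have "\<dots> \<le> 2 * b + norm f"
      using norm_commutator_restr_erode[OF W, of J j u] norm_mul_indicat_le[of A f]
      unfolding x_def A_def b_def by linarith
    finally have "(d * norm x)\<^sup>2 \<le> (2 * b + norm f)\<^sup>2"
      using \<open>0 < d\<close> by (intro power_mono) auto
    also have "\<dots> \<le> 2 * (2 * b)\<^sup>2 + 2 * (norm f)\<^sup>2"
      using zero_le_power2[of "2 * b - norm f"] by (simp add: power2_sum power2_diff)
    finally have "d\<^sup>2 * (norm x)\<^sup>2 \<le> 8 * b\<^sup>2 + 2 * (norm f)\<^sup>2" by (simp add: power_mult_distrib)
    moreover have "b\<^sup>2 = m j - m (Suc (Suc j))"
      unfolding b_def m_def using sub[of j] sub[of "Suc j"] by (intro norm_restr_diff) blast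
    ultimately show ?thesis unfolding x_def A_def m_def by simp
  qed
  \<comment> \<open>Monotonicity of m turns \<open>step\<close> into (8 + d^2) m (2 j + 2) \<le> 8 m
    (2 j) + 2 |f|^2. The additive term 2 / d^2 |f|^2 is the fixed point of this affine
    recursion.\<close>
  have "m (2 * j) \<le> (8 / (8 + d\<^sup>2)) ^ j * (norm u)\<^sup>2 + 2 / d\<^sup>2 * (norm f)\<^sup>2"
  proof (induction j)
    case 0
    have "m 0 \<le> (norm u)\<^sup>2" unfolding m_def by (intro power_mono norm_mul_indicat_le) simp
    moreover have "0 \<le> 2 / d\<^sup>2 * (norm f)\<^sup>2" by simp
    ultimately show ?case unfolding power_0 mult_1 mult_0_right by linarith
  next
    case (Suc j)
    define t where "t = 8 + d\<^sup>2"
    have t: "0 < t" by (simp add: t_def add_pos_nonneg)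
    have "d\<^sup>2 * m (2 * Suc j) \<le> d\<^sup>2 * m (Suc (2 * j))"
      using mono[of "Suc (2 * j)"] by (simp add: mult_left_mono)
    then have "t * m (2 * Suc j) \<le> 2 * (norm f)\<^sup>2 + 8 * m (2 * j)"
      using step[of "2 * j"] by (simp add: t_def algebra_simps)
    also have "\<dots> \<le> 2 * (norm f)\<^sup>2 + 8 * ((8 / t) ^ j * (norm u)\<^sup>2 + 2 / d\<^sup>2 * (norm f)\<^sup>2)"
      using Suc by (simp add: t_def)
    also have "\<dots> = t * ((8 / t) ^ Suc j * (norm u)\<^sup>2 + 2 / d\<^sup>2 * (norm f)\<^sup>2)"
    proof -
      have "2 * (norm f)\<^sup>2 + 8 * (2 / d\<^sup>2 * (norm f)\<^sup>2) = t * (2 / d\<^sup>2 * (norm f)\<^sup>2)"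
        using \<open>0 < d\<close> by (simp add: t_def field_simps)
      moreover have "8 * ((8 / t) ^ j * (norm u)\<^sup>2) = t * ((8 / t) ^ Suc j * (norm u)\<^sup>2)"
        using t by simp
      ultimately show ?thesis by (simp only: distrib_left)
    qed
    finally show ?case using t by (simp add: t_def)
  qed
  then show ?thesis by (simp add: m_def f_def)
qed

section \<open>Cutting the line inside a gap region\<close>

lemma norm_hopping_cut_le:
  assumes W: "bounded (range W)" and A: "\<And>n. (n - c) mod int Q = 0 \<Longrightarrow> n \<in> A \<and> n - 1 \<in> A"
  shows "norm (jacobi (hopping_cut c Q) W u - schr W u) \<le> 2 * norm (restr A u)"
proof -
  define g1 g2 where "g1 n = hopping_cut c Q n - 1" and "g2 n = hopping_cut c Q (n + 1) - 1" for n
  have g: "\<bar>g1 n\<bar> \<le> 1" "\<bar>g2 n\<bar> \<le> 1" for n by (auto simp: g1_def g2_def hopping_cut_def)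
  note bg = mul_bounded_by(1)[of g1, OF g(1)] mul_bounded_by(1)[of g2, OF g(2)]
  define y where "y = restr A u"
  have "jacobi (hopping_cut c Q) W u - schr W u = mul g1 (shift (- 1) y) + mul g2 (shift 1 y)"
  proof (rule rl2_eqI)
    fix n
    have y: "g1 n * seq y (n - 1) = g1 n * seq u (n - 1)" "g2 n * seq y (n + 1) = g2 n * seq u (n + 1)"
      using A[of n] A[of "n + 1"] by (auto simp: g1_def g2_def hopping_cut_def y_def)
    have "seq (jacobi (hopping_cut c Q) W u - schr W u) n = g1 n * seq u (n - 1) + g2 n * seq u (n + 1)"
      by (simp add: seq_schr[OF W] seq_jacobi[OF bounded_range_hopping_cut W] g1_def g2_def algebra_simps)
    also have "\<dots> = seq (mul g1 (shift (- 1) y) + mul g2 (shift 1 y)) n"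
      unfolding y[symmetric] by (simp add: bg)
    finally show "seq (jacobi (hopping_cut c Q) W u - schr W u) n =
        seq (mul g1 (shift (- 1) y) + mul g2 (shift 1 y)) n" .
  qed
  then have "norm (jacobi (hopping_cut c Q) W u - schr W u) \<le>
      norm (mul g1 (shift (- 1) y)) + norm (mul g2 (shift 1 y))" by (simp only: norm_triangle_ineq)
  also have "\<dots> \<le> norm (shift (- 1) y) + norm (shift 1 y)" by (intro add_mono norm_mul_le g)
  finally show ?thesis by (simp add: y_def)
qed

lemma spectrum_near_hopping_cut:
  assumes W: "bounded (range W)" and W': "bounded (range W')"
    and agree: "\<And>n. n \<in> J \<Longrightarrow> W n = W' n"
    and gap: "bounded_below (schr W') E d" and "0 < d"
    and sites: "\<And>n. (n - c) mod int Q = 0 \<Longrightarrow> n \<in> erode J (2 * j) \<and> n - 1 \<in> erode J (2 * j)"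
    and E: "E \<in> approx_spectrum (schr W)"
  shows "\<exists>E'\<in>approx_spectrum (jacobi (hopping_cut c Q) W). \<bar>E' - E\<bar> \<le> 4 * sqrt ((8 / (8 + d\<^sup>2)) ^ j)"
proof -
  define t where "t = sqrt ((8 / (8 + d\<^sup>2)) ^ j)"
  have pos: "0 < 8 + d\<^sup>2" by (simp add: add_pos_nonneg)
  have t: "0 < t" "t\<^sup>2 = (8 / (8 + d\<^sup>2)) ^ j" using pos by (simp_all add: t_def)
  \<comment> \<open>The residual f can be made as small as desired. The second bound keeps its share
    in the decay estimate below t^2 / 2, so the mass at the cut is at most 3/2 t; the two hopping
    terms double it to 3 t, and f itself adds t, which gives the factor 4.\<close>
  define \<kappa> where "\<kappa> = min t (d * t / 2)"
  have "0 < \<kappa>" using t \<open>0 < d\<close> by (simp add: \<kappa>_def)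
  then obtain u where u: "norm (schr W u - E *\<^sub>R u) < \<kappa> * norm u"
    using in_approx_spectrumE[OF E] by blast
  then have "u \<noteq> 0" by (intro notI) simp
  define f where "f = schr W u - E *\<^sub>R u"
  have f: "norm f \<le> t * norm u" "norm f \<le> d * t / 2 * norm u"
  proof -
    have "\<kappa> * norm u \<le> t * norm u" "\<kappa> * norm u \<le> d * t / 2 * norm u"
      by (intro mult_right_mono; simp add: \<kappa>_def)+
    then show "norm f \<le> t * norm u" "norm f \<le> d * t / 2 * norm u" using u unfolding f_def by linarith+
  qed
  have "(norm f)\<^sup>2 \<le> (d * t / 2 * norm u)\<^sup>2" using f(2) by (intro power_mono) auto
  then have "2 / d\<^sup>2 * (norm f)\<^sup>2 \<le> 2 / d\<^sup>2 * (d * t / 2 * norm u)\<^sup>2" by (intro mult_left_mono) auto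
  also have "\<dots> = t\<^sup>2 * (norm u)\<^sup>2 / 2" using \<open>0 < d\<close> by (simp add: power2_eq_square)
  finally have "(norm (restr (erode J (2 * j)) u))\<^sup>2 \<le> t\<^sup>2 * (norm u)\<^sup>2 + t\<^sup>2 * (norm u)\<^sup>2 / 2"
    using decay_in_gap_region[where J = J and j = j and u = u, OF W W' agree gap \<open>0 < d\<close>]
    unfolding t(2) f_def by linarith
  also have "\<dots> \<le> (3 / 2 * t * norm u)\<^sup>2"
    using zero_le_power2[of "t * norm u"] by (simp add: power_mult_distrib power_divide)
  finally have "norm (restr (erode J (2 * j)) u) \<le> 3 / 2 * t * norm u"
    by (rule power2_le_imp_le) (use t in simp)
  then have "norm (jacobi (hopping_cut c Q) W u - schr W u) \<le> 3 * t * norm u"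
    using norm_hopping_cut_le[where A = "erode J (2 * j)" and u = u and c = c and Q = Q, OF W sites] by linarith
  then have "norm ((jacobi (hopping_cut c Q) W u - schr W u) + f) \<le> 4 * t * norm u"
    using f(1) norm_triangle_ineq[of "jacobi (hopping_cut c Q) W u - schr W u" f] by linarith
  then have "norm (jacobi (hopping_cut c Q) W u - E *\<^sub>R u) \<le> (4 * t) * norm u"
    by (simp add: f_def)
  then show ?thesis
    using symmetric_operator.approx_spectrum_near[OF symmetric_operator_jacobi \<open>u \<noteq> 0\<close>]
    unfolding t_def by blast
qed

text \<open>
  The upper left entry of the transfer matrix across a box is the characteristic polynomial of
  the Dirichlet operator on the box.
\<close>

definition box_eigenvalues :: "(int \<Rightarrow> real) \<Rightarrow> int \<Rightarrow> nat \<Rightarrow> real set" where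
  "box_eigenvalues W c Q = {x. m11 (transfer_matrix (\<lambda>n. x - W n) c Q) = 0}"

lemma box_eigenvalues_finite: "finite (box_eigenvalues W c Q)" "card (box_eigenvalues W c Q) \<le> Q"
proof -
  define q where "q = fst (column_poly (\<lambda>n. - W n) (1, 0) c Q)"
  have q: "q \<noteq> 0" "degree q = Q" using degree_column_poly_1[of "\<lambda>n. - W n" c Q] by (auto simp: q_def)
  have eq: "box_eigenvalues W c Q = {x. poly q x = 0}"
    using transfer_matrix_poly[of "\<lambda>n. - W n"] by (simp add: box_eigenvalues_def q_def)
  show "finite (box_eigenvalues W c Q)" unfolding eq using q(1) by (rule poly_roots_finite)
  show "card (box_eigenvalues W c Q) \<le> Q" unfolding eq using card_poly_roots_bound[OF q(1)] q(2) by simp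
qed

text \<open>\<open>U\<close> is evaluated at n and not relative to the start of the block, so each
  block shows a piece of \<open>U i\<close> in its original phase.\<close>

definition interleave :: "nat \<Rightarrow> nat \<Rightarrow> (nat \<Rightarrow> int \<Rightarrow> real) \<Rightarrow> int \<Rightarrow> real" where
  "interleave T L U n = U (nat ((n mod int (T * L)) div int L)) n"

lemma interleave_periodic:
  assumes "\<And>i n. U i (n + int q) = U i n" "q dvd L"
  shows "interleave T L U (n + int (T * L)) = interleave T L U n"
proof -
  obtain r where r: "L = q * r" using assms(2) by blast
  have "U i (n + int (T * L)) = U i n" for i
    using periodic_mult[of "U i" "int q" n "int (T * r)", OF assms(1)] by (simp add: r mult_ac)
  then show ?thesis by (simp add: interleave_def)
qed

text \<open>There is one cut per period, in the middle of block i, where E lies in a gap. After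
  sieving, a half block has length h \<ge> 2 j + 1, so both ends of the removed bond survive 2 j
  erosions of the block. The place of the cut depends on E only through i.\<close>

lemma spectrum_interleave:
  fixes U :: "nat \<Rightarrow> int \<Rightarrow> real" and l :: real and j :: nat
  assumes U: "\<And>i n. U i (n + int q) = U i n" and "0 < q" "i < T" "k \<ge> 1"
    and gap: "bounded_below (schr (\<lambda>n. l * sieve k (U i) n)) E d" "0 < d"
  defines "L \<equiv> (4 * j + 2) * q"
  defines "W \<equiv> \<lambda>n. l * sieve k (interleave T L U) n"
  assumes E: "E \<in> approx_spectrum (schr W)"
  shows "\<exists>E'\<in>box_eigenvalues W (int (i * (k * L) + k * ((2 * j + 1) * q))) (k * (T * L)).
    \<bar>E' - E\<bar> \<le> 4 * sqrt ((8 / (8 + d\<^sup>2)) ^ j)"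
proof -
  define Q where "Q = k * (T * L)"
  define s where "s = int (i * (k * L))"
  define h where "h = int (k * ((2 * j + 1) * q))"
  define c where "c = s + h"
  have "0 < L" using \<open>0 < q\<close> by (simp add: L_def)
  have "0 < Q" using \<open>0 < L\<close> \<open>k \<ge> 1\<close> \<open>i < T\<close> by (simp add: Q_def)
  have kL: "int (k * L) = 2 * h" by (simp add: L_def h_def)
  have "1 * (2 * j + 1) \<le> (k * q) * (2 * j + 1)" using \<open>0 < q\<close> \<open>k \<ge> 1\<close> by (intro mult_right_mono) auto
  then have h: "int (2 * j + 1) \<le> h" unfolding h_def by (simp only: zle_int mult_1) (simp only: mult_ac)
  have "Suc i * (k * L) \<le> T * (k * L)" using \<open>i < T\<close> by (intro mult_right_mono) auto
  then have "int (Suc i * (k * L)) \<le> int Q" unfolding Q_def zle_int by (simp only: mult_ac)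
  then have sQ: "s + 2 * h \<le> int Q" using kL by (simp add: s_def)
  have "0 \<le> s" by (simp add: s_def)
  define J where "J = {n. s \<le> n mod int Q \<and> n mod int Q < s + 2 * h}"
  have W_per: "W (n + int Q) = W n" for n
  proof -
    have "interleave T L U (n + int (T * L)) = interleave T L U n" for n
      by (rule interleave_periodic[of U q, OF U]) (simp add: L_def)
    then show ?thesis unfolding W_def Q_def by (simp only: sieve_periodic)
  qed
  have W: "bounded (range W)" by (rule bounded_range_periodic[of Q W, OF \<open>0 < Q\<close> W_per])
  have W': "bounded (range (\<lambda>n. l * sieve k (U i) n))"
  proof (rule bounded_range_periodic[of "k * q"])
    show "0 < k * q" using \<open>0 < q\<close> \<open>k \<ge> 1\<close> by simp
    show "l * sieve k (U i) (n + int (k * q)) = l * sieve k (U i) n" for n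
      by (simp only: sieve_periodic[of "U i" q, OF U])
  qed
  have agree: "W n = l * sieve k (U i) n" if n: "n \<in> J" for n
  proof (cases "int k dvd n")
    case True
    then obtain m where m: "n = int k * m" by blast
    have "n mod int Q = int k * (m mod int (T * L))" 
      using mult_mod_right[of "int k" m "int (T * L)"] by (simp add: m Q_def)
    then have "int k * (int i * int L) \<le> int k * (m mod int (T * L))"
      "int k * (m mod int (T * L)) < int k * ((int i + 1) * int L)"
      using n unfolding J_def s_def kL[symmetric] by (simp_all add: algebra_simps)
    then have "int i * int L \<le> m mod int (T * L)" "m mod int (T * L) < (int i + 1) * int L"
      using \<open>k \<ge> 1\<close> by simp_all
    then have "(int i * int L + (m mod int (T * L) - int i * int L)) div int L = int i"
      using \<open>0 < L\<close> by (subst div_mult_self3) (auto simp: algebra_simps intro!: div_pos_pos_trivial)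
    then have "(m mod int (T * L)) div int L = int i" by (simp only: add_diff_cancel_left' add_diff_eq)
    then show ?thesis using \<open>k \<ge> 1\<close> by (simp add: W_def sieve_def m interleave_def)
  qed (simp add: W_def sieve_def)
  have sites: "n \<in> erode J (2 * j) \<and> n - 1 \<in> erode J (2 * j)" if n: "(n - c) mod int Q = 0" for n
  proof -
    have J: "n + d \<in> J" if "- h \<le> d" "d < h" for d
    proof -
      have "(n + d) mod int Q = ((n - c) + (c + d)) mod int Q" by simp
      also have "\<dots> = (c + d) mod int Q" using n by (metis add_0 mod_add_left_eq)
      also have "\<dots> = c + d" using that sQ \<open>0 \<le> s\<close> by (intro mod_pos_pos_trivial) (auto simp: c_def)
      finally show ?thesis using that by (simp add: J_def c_def)
    qed
    show ?thesis
    proof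
      show "n \<in> erode J (2 * j)" by (rule erodeI, rule J) (use h in auto)
      show "n - 1 \<in> erode J (2 * j)"
      proof (rule erodeI)
        fix d assume "\<bar>d\<bar> \<le> int (2 * j)"
        then show "n - 1 + d \<in> J" using J[of "d - 1"] h by (simp add: algebra_simps)
      qed
    qed
  qed
  obtain E' where E': "E' \<in> approx_spectrum (jacobi (hopping_cut c Q) W)"
    "\<bar>E' - E\<bar> \<le> 4 * sqrt ((8 / (8 + d\<^sup>2)) ^ j)"
    using spectrum_near_hopping_cut[OF W W' agree gap sites E] by blast
  have "E' \<in> box_eigenvalues W c Q"
    unfolding box_eigenvalues_def mem_Collect_eq
    by (rule spectrum_cut_root[of Q W, OF \<open>0 < Q\<close> W_per E'(1)])
  then show ?thesis using E'(2) unfolding c_def s_def h_def Q_def of_nat_add by blast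
qed


section \<open>Absence of isolated points\<close>

text \<open>The Wronskian of two solutions is constant, and for square-summable ones it tends to 0,
  hence vanishes. Subtracting the right multiple then leaves a solution with two consecutive zeros,
  which the recursion propagates in both directions.\<close>

lemma eigenvector_unique:
  assumes W: "bounded (range W)" and w: "schr W w = E *\<^sub>R w" "w \<noteq> 0" and w': "schr W w' = E *\<^sub>R w'"
  shows "\<exists>c. w' = c *\<^sub>R w"
proof -
  have rec: "seq u (n + 1) = (E - W n) * seq u n - seq u (n - 1)" if "schr W u = E *\<^sub>R u" for u n
    using arg_cong[OF that, of "\<lambda>x. seq x n"] by (simp add: seq_schr[OF W] algebra_simps)
  define Wr where "Wr n = seq w n * seq w' (n + 1) - seq w (n + 1) * seq w' n" for n
  have "Wr (n + 1) = Wr n" for n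
  proof -
    have "seq u (n + 1 + 1) = (E - W (n + 1)) * seq u (n + 1) - seq u n" if "schr W u = E *\<^sub>R u" for u
      using rec[OF that, of "n + 1"] by simp
    from this[OF w(1)] this[OF w'] show ?thesis unfolding Wr_def by algebra
  qed
  then have const: "Wr n = Wr 0" for n using periodic_mod[of Wr 1 n] by simp
  have "(\<lambda>i. seq w (int i) * seq w' (int i + 1) - seq w (int i + 1) * seq w' (int i))
      \<longlonglongrightarrow> 0 * 0 - 0 * 0"
    by (intro tendsto_intros seq_tendsto_0) (auto intro!: injI)
  then have "(\<lambda>i. Wr (int i)) \<longlonglongrightarrow> 0" by (simp add: Wr_def)
  moreover have "(\<lambda>i. Wr (int i)) = (\<lambda>_. Wr 0)" by (rule ext) (rule const)
  ultimately have "Wr 0 = 0" by (simp add: LIMSEQ_const_iff)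
  then have Wr0: "Wr n = 0" for n using trans[OF const[of n]] by blast
  obtain m where m: "seq w m \<noteq> 0" using w(2) by (metis rl2_eqI seq_zero)
  define c where "c = seq w' m / seq w m"
  define y where "y = w' - c *\<^sub>R w"
  interpret T: symmetric_operator "schr W" by (rule symmetric_operator_jacobi)
  have y: "schr W y = E *\<^sub>R y"
    by (simp add: y_def T.T.diff T.T.scaleR w(1) w' algebra_simps)
  have y0: "seq y m = 0" "seq y (m + 1) = 0"
    using m Wr0[of m] by (simp_all add: y_def c_def Wr_def field_simps)
  have "seq y n = 0 \<and> seq y (n + 1) = 0" for n
  proof (induction n rule: int_induct[where k = m])
    case base
    show ?case using y0 by simp
  next
    case (step1 i)
    then show ?case using rec[OF y, of "i + 1"] by simp
  next
    case (step2 i)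
    have "seq y (i - 1) = (E - W i) * seq y i - seq y (i + 1)" using rec[OF y, of i] by linarith
    then show ?case using step2 by simp
  qed
  then have "y = 0" by (intro rl2_eqI) simp
  then show ?thesis by (auto simp: y_def)
qed

text \<open>
  An isolated point of the spectrum would be a simple eigenvalue. Translates of its eigenvector
  by almost periods are nearly eigenvectors, hence nearly multiples of it, so the eigenvector
  would not decay.
\<close>

lemma almost_periodic_no_isolated_spectrum:
  assumes W: "bounded (range W)"
    and ap: "\<And>e. 0 < e \<Longrightarrow> \<exists>q>0. \<forall>i n. \<bar>W (n + i * int q) - W n\<bar> \<le> e"
  shows "\<not> E isolated_in approx_spectrum (schr W)"
proof
  assume "E isolated_in approx_spectrum (schr W)"
  then obtain S where E: "E \<in> approx_spectrum (schr W)" and S: "open S" "S \<inter> approx_spectrum (schr W) = {E}"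
    by (auto simp: isolated_in_def)
  then have "E \<in> S" by blast
  then obtain d where d: "0 < d" "ball E d \<subseteq> S" using S(1) open_contains_ball by metis
  have iso: "E' = E" if "E' \<in> approx_spectrum (schr W)" "\<bar>E' - E\<bar> < d" for E'
  proof -
    have "E' \<in> ball E d" using that(2) by (simp add: dist_real_def abs_minus_commute)
    then show ?thesis using d(2) S(2) that(1) by blast
  qed
  interpret T: symmetric_operator "schr W" by (rule symmetric_operator_jacobi)
  define A where "A u = schr W u - E *\<^sub>R u" for u
  have symA: "symmetric_operator A" unfolding A_def by (rule T.shift_operator)
  have "\<exists>C. \<forall>u. \<exists>w. A w = 0 \<and> norm (u - w) \<le> C * norm (A u)"
  proof (rule kernel_near[OF symA])
    show "0 < d / 3" using d by simp
    show "d / 3 * norm (A u) \<le> norm (A (A u))" for u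
      unfolding A_def using T.isolated_spectrum_square_bound[OF d(1) iso] by blast
  qed
  then obtain C' where C': "\<And>u. \<exists>w. A w = 0 \<and> norm (u - w) \<le> C' * norm (A u)" by blast
  define C where "C = \<bar>C'\<bar> + 1"
  have "0 < C" by (simp add: C_def)
  have C: "\<exists>w. A w = 0 \<and> norm (u - w) \<le> C * norm (A u)" for u
  proof -
    obtain w where w: "A w = 0" "norm (u - w) \<le> C' * norm (A u)" using C' by blast
    have "C' * norm (A u) \<le> C * norm (A u)" by (intro mult_right_mono) (auto simp: C_def)
    then show ?thesis using w by (intro exI[of _ w]) simp
  qed
  obtain u where u: "norm (A u) < 1 / C * norm u"
    using in_approx_spectrumE[OF E, of "1 / C"] \<open>0 < C\<close> unfolding A_def by auto
  obtain w where w: "A w = 0" "norm (u - w) \<le> C * norm (A u)" using C by blast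
  have "w \<noteq> 0"
  proof
    assume "w = 0"
    then have "norm u \<le> C * norm (A u)" using w(2) by simp
    also have "\<dots> < norm u" using u \<open>0 < C\<close> by (simp add: field_simps)
    finally show False by simp
  qed
  have eig: "schr W x = E *\<^sub>R x" if "A x = 0" for x using that by (simp add: A_def)
  obtain m where m: "seq w m \<noteq> 0" using \<open>w \<noteq> 0\<close> by (metis rl2_eqI seq_zero)
  \<comment> \<open>A translate of w will be within \<eta> of some c w. The first bound forces |c|
    \<ge> 3/4, the second then leaves 3/4 - 1/4 = 1/2 of the value at m.\<close>
  define \<eta> where "\<eta> = min (norm w / 4) (\<bar>seq w m\<bar> / 4)"
  have \<eta>: "0 < \<eta>" "\<eta> \<le> norm w / 4" "\<eta> \<le> \<bar>seq w m\<bar> / 4" using m \<open>w \<noteq> 0\<close> by (simp_all add: \<eta>_def)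
  define e where "e = \<eta> / (C * norm w)"
  have "0 < e" using \<eta>(1) \<open>0 < C\<close> \<open>w \<noteq> 0\<close> by (simp add: e_def)
  then obtain q where "q > 0" and q: "\<And>i n. \<bar>W (n + i * int q) - W n\<bar> \<le> e" using ap by blast
  have lower: "\<bar>seq w m\<bar> / 2 \<le> \<bar>seq w (m + int i * int q)\<bar>" for i
  proof -
    define x where "x = shift (int i * int q) w"
    define g where "g n = W n - W (n + int i * int q)" for n
    have g: "\<bar>g n\<bar> \<le> e" for n using q[of n "int i"] by (simp add: g_def abs_minus_commute)
    have "A x = mul g x"
    proof (rule rl2_eqI)
      fix n
      have "seq (A w) (n + int i * int q) = 0" using w(1) by simp
      then show "seq (A x) n = seq (mul g x) n"
        using mul_bounded_by(1)[of g, OF g]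
        by (simp add: A_def seq_schr[OF W] x_def g_def algebra_simps)
    qed
    then have "norm (A x) \<le> e * norm w"
      using mul_bounded_by(2)[of g e x, OF g] by (simp add: x_def)
    obtain y where y: "A y = 0" "norm (x - y) \<le> C * norm (A x)" using C by blast
    have "C * norm (A x) \<le> C * (e * norm w)"
      using \<open>norm (A x) \<le> e * norm w\<close> \<open>0 < C\<close> by (intro mult_left_mono) auto
    also have "\<dots> = \<eta>" using \<open>0 < C\<close> \<open>w \<noteq> 0\<close> by (simp add: e_def)
    finally have xy: "norm (x - y) \<le> \<eta>" using y(2) by linarith
    obtain c where c: "y = c *\<^sub>R w"
      using eigenvector_unique[OF W eig[OF w(1)] \<open>w \<noteq> 0\<close> eig[OF y(1)]] by blast
    have "norm w \<le> norm y + norm (x - y)"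
      using norm_triangle_sub[of x y] by (simp add: x_def)
    then have "3 / 4 * norm w \<le> \<bar>c\<bar> * norm w" using xy \<eta>(2) by (simp add: c)
    then have "3 / 4 \<le> \<bar>c\<bar>" using \<open>w \<noteq> 0\<close> by (simp add: mult_le_cancel_right)
    then have "3 / 4 * \<bar>seq w m\<bar> \<le> \<bar>c\<bar> * \<bar>seq w m\<bar>" by (intro mult_right_mono) auto
    also have "\<dots> = \<bar>seq y m\<bar>" by (simp add: c abs_mult)
    also have "\<dots> \<le> \<bar>seq x m\<bar> + \<eta>" using abs_seq_le_norm[of "x - y" m] xy by simp
    finally show ?thesis using \<eta>(3) by (simp add: x_def)
  qed
  have "(\<lambda>i. seq w (m + int i * int q)) \<longlonglongrightarrow> 0"
    using \<open>q > 0\<close> by (intro seq_tendsto_0 injI) simp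
  then have "(\<lambda>i. \<bar>seq w (m + int i * int q)\<bar>) \<longlonglongrightarrow> 0" by (rule tendsto_rabs_zero)
  then have "\<bar>seq w m\<bar> / 2 \<le> 0" using lower by (intro LIMSEQ_le_const) auto
  then show False using m by simp
qed


section \<open>Thin spectra near periodic potentials\<close>

text \<open>For k = 1 the box is empty, its transfer matrix is the identity, and there are no
  exceptional energies.\<close>

abbreviation exceptional :: "nat \<Rightarrow> real set" where
  "exceptional k \<equiv> box_eigenvalues (\<lambda>_. 0) 0 (k - 1)"

lemma sieve_bounded:
  assumes "\<And>n. \<bar>U n\<bar> \<le> B"
  shows "\<bar>sieve k U n\<bar> \<le> B"
proof -
  have "0 \<le> B" using assms[of 0] by linarith
  then show ?thesis using assms by (simp add: sieve_def)
qed

lemma sieve_diff_le: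
  assumes "\<And>n. \<bar>U n - V n\<bar> \<le> e"
  shows "\<bar>sieve k U n - sieve k V n\<bar> \<le> e"
  using sieve_bounded[of "\<lambda>n. U n - V n" e k n, OF assms] by (simp add: sieve_def split: if_splits)

lemma bounded_range_scaled_sieve:
  assumes "\<And>n. \<bar>U n\<bar> \<le> B"
  shows "bounded (range (\<lambda>n. l * sieve k U n))"
proof (rule mul_bounded_by(1))
  show "\<bar>l * sieve k U n\<bar> \<le> \<bar>l\<bar> * B" for n
    unfolding abs_mult by (intro mult_left_mono sieve_bounded assms) simp
qed

text \<open>Compact sets exhausting the nonzero reals. For M = 0 the set degenerates to {0}, as 1 /
  0 = 0.\<close>

definition coupling_range :: "nat \<Rightarrow> real set" where
  "coupling_range M = {l. 1 / real M \<le> \<bar>l\<bar> \<and> \<bar>l\<bar> \<le> real M}"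

lemma compact_energy_coupling:
  fixes Z :: "real set" and \<eta> R :: real
  assumes "finite Z"
  shows "compact {(l, E). l \<in> coupling_range M \<and> \<bar>E\<bar> \<le> R \<and> (\<forall>z\<in>Z. \<eta> \<le> \<bar>E - z\<bar>)}"
proof -
  have "closed (coupling_range M)" unfolding coupling_range_def
    by (intro closed_Collect_conj closed_Collect_le continuous_intros)
  moreover have "bounded (coupling_range M)" by (auto simp: coupling_range_def bounded_iff)
  ultimately have c1: "compact (coupling_range M)" by (simp add: compact_eq_bounded_closed)
  let ?C = "{E :: real. \<bar>E\<bar> \<le> R \<and> (\<forall>z\<in>Z. \<eta> \<le> \<bar>E - z\<bar>)}"
  have "?C = {E. \<bar>E\<bar> \<le> R} \<inter> (\<Inter>z\<in>Z. {E. \<eta> \<le> \<bar>E - z\<bar>})" by auto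
  moreover have "closed \<dots>"
    by (intro closed_Int closed_INT ballI closed_Collect_le continuous_intros)
  ultimately have "closed ?C" by simp
  moreover have "bounded ?C" by (auto simp: bounded_iff)
  ultimately have c2: "compact ?C" by (simp add: compact_eq_bounded_closed)
  have "{(l, E). l \<in> coupling_range M \<and> \<bar>E\<bar> \<le> R \<and> (\<forall>z\<in>Z. \<eta> \<le> \<bar>E - z\<bar>)} =
      coupling_range M \<times> {E. \<bar>E\<bar> \<le> R \<and> (\<forall>z\<in>Z. \<eta> \<le> \<bar>E - z\<bar>)}" by auto
  then show ?thesis using compact_Times[OF c1 c2] by simp
qed

text \<open>Each triple (k, l, E) has its own gap potential, whose gap survives nearby. Within
  radius t = gap / (4 (B + 1)) a change of coupling costs at most t B and a change of energy at most
  t, together a quarter of the gap constant, so half of it is certainly left. A finite subcover then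
  supplies the family, a common period and a common constant.\<close>

lemma finite_gap_family:
  fixes V :: "int \<Rightarrow> real"
  assumes "0 < p" and per: "\<And>n. V (n + int p) = V n" and "0 < e" "0 < \<eta>"
  shows "\<exists>(T :: nat) (q :: nat) U d. 0 < T \<and> 0 < q \<and> 0 < d \<and> (\<forall>i n. U i (n + int q) = U i n) \<and> (\<forall>i n. \<bar>U i n - V n\<bar> \<le> e) \<and>
    (\<forall>k\<in>{1..M}. \<forall>l\<in>coupling_range M. \<forall>E. \<bar>E\<bar> \<le> R \<longrightarrow> (\<forall>z\<in>exceptional k. \<eta> \<le> \<bar>E - z\<bar>) \<longrightarrow>
      (\<exists>i<T. bounded_below (schr (\<lambda>n. l * sieve k (U i) n)) E d))"
proof (cases "M = 0")
  case True
  show ?thesis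
    by (rule exI[of _ "1 :: nat"], rule exI[of _ p], rule exI[of _ "\<lambda>_. V"], rule exI[of _ "1 :: real"])
      (use True assms in auto)
next
  case False
  obtain B0 where B0: "\<And>n. \<bar>V n\<bar> \<le> B0"
    using bounded_range_periodic[of p V, OF \<open>0 < p\<close> per] by (auto simp: bounded_iff)
  define B where "B = B0 + e"
  have "0 \<le> B" using B0[of 0] \<open>0 < e\<close> by (simp add: B_def)
  define X where "X k = {(l, E). l \<in> coupling_range M \<and> \<bar>E\<bar> \<le> R \<and> (\<forall>z\<in>exceptional k. \<eta> \<le> \<bar>E - z\<bar>)}" for k
  define S where "S = (\<Union>k\<in>{1..M}. {k} \<times> X k)"
  have "compact ({k} \<times> X k)" for k
    unfolding X_def by (intro compact_Times compact_energy_coupling box_eigenvalues_finite) simp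
  then have "compact S" unfolding S_def by (intro compact_UN) auto
  have "\<exists>P U d. 0 < P \<and> (\<forall>n. U (n + int P) = U n) \<and> (\<forall>n. \<bar>U n - V n\<bar> \<le> e) \<and> 0 < d \<and>
      bounded_below (schr (\<lambda>n. l * sieve k U n)) E d" if x: "(k, l, E) \<in> S" for k l E
  proof -
    have k: "k \<ge> 1" "(l, E) \<in> X k" using x by (auto simp: S_def)
    have "l \<noteq> 0" using k(2) False by (auto simp: X_def coupling_range_def)
    have "E \<notin> exceptional k" using k(2) \<open>0 < \<eta>\<close> by (auto simp: X_def)
    then have "m11 (transfer_matrix (\<lambda>_. E) 0 (k - 1)) \<noteq> 0" by (simp add: box_eigenvalues_def)
    from gap_opening[where V = V and p = p and k = k and l = l and E = E,
        OF \<open>0 < p\<close> per k(1) \<open>l \<noteq> 0\<close> \<open>0 < e\<close> this]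
    show ?thesis unfolding not_in_approx_spectrum by blast
  qed
  then have "\<forall>x\<in>S. \<exists>y. case (x, y) of ((k, l, E), (P, U, d)) \<Rightarrow>
      0 < P \<and> (\<forall>n. U (n + int P) = U n) \<and> (\<forall>n. \<bar>U n - V n\<bar> \<le> e) \<and> (0 :: real) < d \<and>
      bounded_below (schr (\<lambda>n. l * sieve k U n)) E d" by fastforce
  then obtain F where F: "\<And>x. x \<in> S \<Longrightarrow> case (x, F x) of ((k, l, E), (P, U, d)) \<Rightarrow>
      0 < P \<and> (\<forall>n. U (n + int P) = U n) \<and> (\<forall>n. \<bar>U n - V n\<bar> \<le> e) \<and> (0 :: real) < d \<and>
      bounded_below (schr (\<lambda>n. l * sieve k U n)) E d" by (metis (no_types, lifting) bchoice)
  define per_of pot_of gap_of where "per_of x = fst (F x)" and "pot_of x = fst (snd (F x))"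
    and "gap_of x = snd (snd (F x))" for x
  have F': "0 < per_of x" "pot_of x (n + int (per_of x)) = pot_of x n" "\<bar>pot_of x n - V n\<bar> \<le> e"
    "0 < gap_of x" "bounded_below (schr (\<lambda>n. fst (snd x) * sieve (fst x) (pot_of x) n)) (snd (snd x)) (gap_of x)"
    if "x \<in> S" for x n
    using F[OF that] by (auto simp: per_of_def pot_of_def gap_of_def split: prod.splits)
  define N where "N x = {fst x} \<times> ball (fst (snd x)) (gap_of x / (4 * (B + 1))) \<times>
      ball (snd (snd x)) (gap_of x / (4 * (B + 1)))" for x
  have op: "open (N x)" for x unfolding N_def by (intro open_Times open_ball open_discrete)
  have cov: "S \<subseteq> (\<Union>x\<in>S. N x)"
  proof
    fix x assume "x \<in> S"
    have "x \<in> N x" using F'(4)[OF \<open>x \<in> S\<close>] \<open>0 \<le> B\<close> by (cases x) (simp add: N_def)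
    then show "x \<in> (\<Union>x\<in>S. N x)" using \<open>x \<in> S\<close> by blast
  qed
  obtain S' where S': "S' \<subseteq> S" "finite S'" "S \<subseteq> (\<Union>x\<in>S'. N x)"
    by (rule compactE_image[OF \<open>compact S\<close> op cov])
  obtain xs where xs: "set xs = S'" using finite_list[OF S'(2)] by blast
  \<comment> \<open>Indices beyond the list are filled with V. Together with T = length xs + 1 this
    keeps the family nonempty even if no triple has to be served.\<close>
  define U where "U i = (if i < length xs then pot_of (xs ! i) else V)" for i
  define q where "q = p * (\<Prod>x\<in>S'. per_of x)"
  define d where "d = Min (insert 1 ((\<lambda>x. gap_of x / 2) ` S'))"
  have "0 < d" using S' F'(4) by (auto simp: d_def)
  have d: "d \<le> gap_of x / 2" if "x \<in> S'" for x
    unfolding d_def by (rule Min_le) (use S'(2) that in auto)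
  have "0 < q" using \<open>0 < p\<close> S' F'(1) by (auto simp: q_def intro!: prod_pos)
  have U: "U i (n + int q) = U i n \<and> \<bar>U i n - V n\<bar> \<le> e" for i n
  proof (cases "i < length xs")
    case True
    then have x: "xs ! i \<in> S'" "xs ! i \<in> S" using xs S'(1) nth_mem[OF True] by auto
    have "per_of (xs ! i) dvd q" unfolding q_def using x(1) S'(2) by (intro dvd_mult dvd_prodI)
    then obtain r where "q = per_of (xs ! i) * r" by blast
    then show ?thesis using True F'(3)[OF x(2)]
        periodic_mult[of "pot_of (xs ! i)" "int (per_of (xs ! i))" n "int r", OF F'(2)[OF x(2)]]
      by (simp add: U_def mult.commute)
  next
    case False
    have "V (n + int q) = V n"
      using periodic_mult[of V "int p" n "int (\<Prod>x\<in>S'. per_of x)", OF per] by (simp add: q_def mult.commute)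
    then show ?thesis using False \<open>0 < e\<close> by (simp add: U_def)
  qed
  have "\<exists>i<length xs + 1. bounded_below (schr (\<lambda>n. l * sieve k (U i) n)) E d"
    if k: "k \<in> {1..M}" and l: "l \<in> coupling_range M" and E: "\<bar>E\<bar> \<le> R" "\<forall>z\<in>exceptional k. \<eta> \<le> \<bar>E - z\<bar>"
    for k l E
  proof -
    have "(k, l, E) \<in> S" using k l E by (auto simp: S_def X_def)
    then obtain x where x: "x \<in> S'" "(k, l, E) \<in> N x" using S'(3) by blast
    then have "x \<in> S" using S'(1) by blast
    obtain i where i: "i < length xs" "xs ! i = x" using x(1) xs by (metis in_set_conv_nth)
    define t where "t = gap_of x / (4 * (B + 1))"
    obtain l0 E0 where x': "x = (k, l0, E0)" "\<bar>l0 - l\<bar> < t" "\<bar>E0 - E\<bar> < t"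
      using x(2) by (cases x) (auto simp: N_def t_def dist_real_def)
    have "0 < t" using F'(4)[OF \<open>x \<in> S\<close>] \<open>0 \<le> B\<close> by (simp add: t_def)
    have tB: "t * (B + 1) = gap_of x / 4" using \<open>0 \<le> B\<close> by (simp add: t_def field_simps)
    have Ub: "\<bar>pot_of x n\<bar> \<le> B" for n
      using F'(3)[OF \<open>x \<in> S\<close>, of n] B0[of n] unfolding B_def by linarith
    have "bounded_below (schr (\<lambda>n. l * sieve k (pot_of x) n)) E (gap_of x - t * B - \<bar>E0 - E\<bar>)"
    proof (rule bounded_below_perturb)
      show "bounded_below (schr (\<lambda>n. l0 * sieve k (pot_of x) n)) E0 (gap_of x)"
        using F'(5)[OF \<open>x \<in> S\<close>] by (simp add: x'(1))
      show "norm (schr (\<lambda>n. l0 * sieve k (pot_of x) n) u - schr (\<lambda>n. l * sieve k (pot_of x) n) u) \<le> t * B * norm u" for u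
      proof (rule norm_schr_diff_le)
        show "bounded (range (\<lambda>n. l0 * sieve k (pot_of x) n))" "bounded (range (\<lambda>n. l * sieve k (pot_of x) n))"
          by (rule bounded_range_scaled_sieve[of "pot_of x" B, OF Ub])+
        show "\<bar>l0 * sieve k (pot_of x) n - l * sieve k (pot_of x) n\<bar> \<le> t * B" for n
          unfolding left_diff_distrib[symmetric] abs_mult
          using x'(2) \<open>0 < t\<close> sieve_bounded[of "pot_of x" B k n, OF Ub] by (intro mult_mono) auto
      qed
    qed
    moreover have "d \<le> gap_of x - t * B - \<bar>E0 - E\<bar>"
    proof -
      have "t * B + t = gap_of x / 4" using tB by (simp add: algebra_simps)
      moreover have "0 < gap_of x" using F'(4)[OF \<open>x \<in> S\<close>] .
      ultimately show ?thesis using d[OF x(1)] x'(3) by linarith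
    qed
    ultimately have "bounded_below (schr (\<lambda>n. l * sieve k (U i) n)) E d"
      using i unfolding bounded_below_def
      by (auto simp: U_def intro: order_trans[OF mult_right_mono[OF _ norm_ge_zero]])
    then show ?thesis using i(1) by (intro exI[of _ i]) simp
  qed
  note gaps = this
  show ?thesis
    by (rule exI[of _ "length xs + 1"], rule exI[of _ q], rule exI[of _ U], rule exI[of _ d])
      (use \<open>0 < q\<close> \<open>0 < d\<close> U gaps in auto)
qed

text \<open>M is at once the reciprocal exponent and the reciprocal bound. Covers of this kind for
  arbitrarily large M therefore make every Hausdorff measure of positive exponent vanish, and the
  Lebesgue measure too.\<close>

definition thin :: "nat \<Rightarrow> real set \<Rightarrow> bool" where
  "thin M K \<longleftrightarrow> (\<exists>A :: (real \<times> real) set. finite A \<and> (\<forall>a\<in>A. 0 < snd a) \<and>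
    K \<subseteq> (\<Union>a\<in>A. cball (fst a) (snd a)) \<and> (\<Sum>a\<in>A. (2 * snd a) powr (1 / real M)) < 1 / real M)"

lemma thin_two_radii:
  assumes "finite Y" "finite Z" "0 < \<rho>" "0 < \<eta>" "0 < M"
    and cover: "K \<subseteq> (\<Union>y\<in>Y. cball y \<rho>) \<union> (\<Union>z\<in>Z. cball z \<eta>)"
    and "real (card Y) * (2 * \<rho>) powr (1 / real M) < 1 / (2 * real M)"
    and "real (card Z) * (2 * \<eta>) powr (1 / real M) < 1 / (2 * real M)"
  shows "thin M K"
  unfolding thin_def
proof (intro exI[of _ "(\<lambda>y. (y, \<rho>)) ` Y \<union> (\<lambda>z. (z, \<eta>)) ` Z"] conjI)
  let ?f = "\<lambda>a :: real \<times> real. (2 * snd a) powr (1 / real M)"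
  show "finite ((\<lambda>y. (y, \<rho>)) ` Y \<union> (\<lambda>z. (z, \<eta>)) ` Z)" using assms by simp
  show "\<forall>a\<in>(\<lambda>y. (y, \<rho>)) ` Y \<union> (\<lambda>z. (z, \<eta>)) ` Z. 0 < snd a" using assms by auto
  show "K \<subseteq> (\<Union>a\<in>(\<lambda>y. (y, \<rho>)) ` Y \<union> (\<lambda>z. (z, \<eta>)) ` Z. cball (fst a) (snd a))"
    using cover by simp
  have "sum ?f ((\<lambda>y. (y, \<rho>)) ` Y \<union> (\<lambda>z. (z, \<eta>)) ` Z) \<le>
      sum ?f ((\<lambda>y. (y, \<rho>)) ` Y) + sum ?f ((\<lambda>z. (z, \<eta>)) ` Z)"
    using assms(1,2) by (subst sum_Un) (auto intro!: sum_nonneg)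
  also have "\<dots> = real (card Y) * (2 * \<rho>) powr (1 / real M) + real (card Z) * (2 * \<eta>) powr (1 / real M)"
    by (simp add: sum.reindex inj_on_def)
  also have "\<dots> < 1 / (2 * real M) + 1 / (2 * real M)" using assms by (intro add_strict_mono)
  also have "\<dots> = 1 / real M" by simp
  finally show "sum ?f ((\<lambda>y. (y, \<rho>)) ` Y \<union> (\<lambda>z. (z, \<eta>)) ` Z) < 1 / real M" .
qed

definition sieves_thin :: "nat \<Rightarrow> (int \<Rightarrow> real) \<Rightarrow> bool" where
  "sieves_thin M W \<longleftrightarrow> (\<forall>k\<in>{1..M}. \<forall>l\<in>coupling_range M.
     thin M (approx_spectrum (schr (\<lambda>n. l * sieve k W n))))"

lemma approx_spectrum_schr_perturb:
  assumes V: "bounded (range V)" and W: "bounded (range W)" and VW: "\<And>n. \<bar>V n - W n\<bar> \<le> r"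
    and "E \<in> approx_spectrum (schr W)" and "0 < s"
  shows "\<exists>E'\<in>approx_spectrum (schr V). \<bar>E' - E\<bar> \<le> r + s"
proof -
  obtain u where u: "norm (schr W u - E *\<^sub>R u) < s * norm u"
    using in_approx_spectrumE[OF assms(4,5)] by blast
  then have "u \<noteq> 0" by (intro notI) simp
  have "norm ((schr V u - schr W u) + (schr W u - E *\<^sub>R u)) \<le> r * norm u + s * norm u"
    using norm_schr_diff_le[OF V W VW, of u] u
      norm_triangle_ineq[of "schr V u - schr W u" "schr W u - E *\<^sub>R u"] by linarith
  then have "norm (schr V u - E *\<^sub>R u) \<le> (r + s) * norm u" by (simp add: distrib_right)
  then show ?thesis
    by (rule symmetric_operator.approx_spectrum_near[OF symmetric_operator_jacobi \<open>u \<noteq> 0\<close>])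
qed

text \<open>The order of choices matters: \<eta> depends on M only; the family and its constant d
  come next; then j, large enough for the exponential factor to beat the linear count of box
  eigenvalues; and last r, so small that a perturbation at most doubles the radii of the
  cover.\<close>

lemma periodic_near_sieves_thin:
  fixes V :: "int \<Rightarrow> real"
  assumes "0 < p" and per: "\<And>n. V (n + int p) = V n" and "0 < e" and "0 < M"
  shows "\<exists>P V' r. 0 < P \<and> 0 < r \<and> (\<forall>n. V' (n + int P) = V' n) \<and> (\<forall>n. \<bar>V' n - V n\<bar> \<le> e) \<and>
    (\<forall>W. (\<forall>n. \<bar>W n - V' n\<bar> \<le> r) \<longrightarrow> sieves_thin M W)"
proof -
  obtain B0 where B0: "\<And>n. \<bar>V n\<bar> \<le> B0"
    using bounded_range_periodic[of p V, OF \<open>0 < p\<close> per] by (auto simp: bounded_iff)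
  define B where "B = B0 + e"
  have "0 \<le> B" using B0[of 0] \<open>0 < e\<close> by (simp add: B_def)
  define R where "R = 2 + real M * B"
  \<comment> \<open>Chosen so that 4 \<eta> to the power 1 / M equals 1 / (4 M^2); at most M
    exceptional balls of radius 2 \<eta> then contribute at most 1 / (4 M).\<close>
  define \<eta> where "\<eta> = (1 / (4 * (real M)\<^sup>2)) powr real M / 4"
  have "0 < \<eta>" using \<open>0 < M\<close> by (simp add: \<eta>_def)
  have eta: "real M * (2 * (2 * \<eta>)) powr (1 / real M) < 1 / (2 * real M)"
    using \<open>0 < M\<close> by (simp add: \<eta>_def powr_powr power2_eq_square) (simp add: field_simps)
  obtain T q :: nat and U :: "nat \<Rightarrow> int \<Rightarrow> real" and d :: real where
    family: "0 < T \<and> 0 < q \<and> 0 < d \<and> (\<forall>i n. U i (n + int q) = U i n) \<and> (\<forall>i n. \<bar>U i n - V n\<bar> \<le> e) \<and>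
      (\<forall>k\<in>{1..M}. \<forall>l\<in>coupling_range M. \<forall>E. \<bar>E\<bar> \<le> R \<longrightarrow> (\<forall>z\<in>exceptional k. \<eta> \<le> \<bar>E - z\<bar>) \<longrightarrow>
        (\<exists>i<T. bounded_below (schr (\<lambda>n. l * sieve k (U i) n)) E d))"
    using finite_gap_family[where V = V and p = p and M = M and R = R,
        OF \<open>0 < p\<close> per \<open>0 < e\<close> \<open>0 < \<eta>\<close>] by (elim exE) (rule that)
  then have "0 < T" "0 < q" "0 < d" by simp_all
  have U: "U i (n + int q) = U i n" "\<bar>U i n - V n\<bar> \<le> e" for i n
    using family by simp_all
  have gaps: "\<exists>i<T. bounded_below (schr (\<lambda>n. l * sieve k (U i) n)) E d"
    if "k \<in> {1..M}" "l \<in> coupling_range M" "\<bar>E\<bar> \<le> R" "\<forall>z\<in>exceptional k. \<eta> \<le> \<bar>E - z\<bar>" for k l E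
    using family that by blast
  define x where "x = sqrt (8 / (8 + d\<^sup>2)) powr (1 / real M)"
  have "0 < 8 / (8 + d\<^sup>2)" "8 / (8 + d\<^sup>2) < 1" using \<open>0 < d\<close> by (simp_all add: add_pos_nonneg)
  then have "0 < sqrt (8 / (8 + d\<^sup>2))" "sqrt (8 / (8 + d\<^sup>2)) < 1" by simp_all
  then have x: "0 < x" "x < 1"
    using powr_less_mono2[of "1 / real M" "sqrt (8 / (8 + d\<^sup>2))" 1] \<open>0 < M\<close> by (simp_all add: x_def)
  define \<rho> where "\<rho> j = 4 * sqrt ((8 / (8 + d\<^sup>2)) ^ j)" for j
  have \<rho>_pos: "0 < \<rho> j" for j using \<open>0 < 8 / (8 + d\<^sup>2)\<close> by (simp add: \<rho>_def)
  have \<rho>_powr: "(2 * (2 * \<rho> j)) powr (1 / real M) = 16 powr (1 / real M) * x ^ j" for j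
  proof -
    have "2 * (2 * \<rho> j) = 16 * sqrt (8 / (8 + d\<^sup>2)) ^ j" by (simp add: \<rho>_def real_sqrt_power)
    then show ?thesis
      using \<open>0 < sqrt (8 / (8 + d\<^sup>2))\<close>
      by (simp add: powr_mult x_def powr_realpow[symmetric] powr_powr mult.commute)
  qed
  define D where "D = real (T * (M * (T * q))) * 16 powr (1 / real M)"
  have "(\<lambda>j. D * (4 * (real j * x ^ j) + 2 * x ^ j)) \<longlonglongrightarrow> D * (4 * 0 + 2 * 0)"
    using x by (intro tendsto_intros powser_times_n_limit_0 LIMSEQ_realpow_zero) auto
  then have "\<forall>\<^sub>F j in sequentially. D * (4 * (real j * x ^ j) + 2 * x ^ j) < 1 / (2 * real M)"
    using \<open>0 < M\<close> by (intro order_tendstoD) auto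
  then obtain j where "D * (4 * (real j * x ^ j) + 2 * x ^ j) < 1 / (2 * real M)"
    by (meson eventually_sequentially order_refl)
  \<comment> \<open>There are T possible cuts, and each box has at most M T L sites, hence at most
    that many eigenvalues.\<close>
  then have j: "real (T * (M * (T * ((4 * j + 2) * q)))) * (2 * (2 * \<rho> j)) powr (1 / real M) < 1 / (2 * real M)"
    unfolding \<rho>_powr D_def by (simp add: algebra_simps)
  define L where "L = (4 * j + 2) * q"
  define V' where "V' = interleave T L U"
  have V'_per: "V' (n + int (T * L)) = V' n" for n
    unfolding V'_def by (rule interleave_periodic[of U q, OF U(1)]) (simp add: L_def)
  have V'V: "\<bar>V' n - V n\<bar> \<le> e" for n by (simp add: V'_def interleave_def U(2))
  have V'B: "\<bar>V' n\<bar> \<le> B" for n using V'V[of n] B0[of n] unfolding B_def by linarith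
  \<comment> \<open>The coupling magnifies a perturbation of size r up to M r. This uses half of the
    admissible displacement of the spectrum; the other half is the slack of the approximate
    eigenvector.\<close>
  define r where "r = min \<eta> (\<rho> j) / (2 * real M)"
  have "0 < r" using \<open>0 < \<eta>\<close> \<rho>_pos \<open>0 < M\<close> by (simp add: r_def)
  have Mr: "real M * r \<le> min \<eta> (\<rho> j) / 2" using \<open>0 < M\<close> by (simp add: r_def)
  have "thin M (approx_spectrum (schr (\<lambda>n. l * sieve k W n)))"
    if W: "\<And>n. \<bar>W n - V' n\<bar> \<le> r" and k: "k \<in> {1..M}" and l: "l \<in> coupling_range M" for W k l
  proof -
    define c where "c i = int (i * (k * L) + k * ((2 * j + 1) * q))" for i
    define Q where "Q = k * (T * L)"
    define Y where "Y = (\<Union>i<T. box_eigenvalues (\<lambda>n. l * sieve k V' n) (c i) Q)"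
    have lM: "\<bar>l\<bar> \<le> real M" using l by (simp add: coupling_range_def)
    have WB: "\<bar>W n\<bar> \<le> B + r" for n using W[of n] V'B[of n] by linarith
    have bW: "bounded (range (\<lambda>n. l * sieve k W n))" "bounded (range (\<lambda>n. l * sieve k V' n))"
      using bounded_range_scaled_sieve[of W "B + r", OF WB] bounded_range_scaled_sieve[of V' B, OF V'B] .
    have near: "\<bar>l * sieve k V' n - l * sieve k W n\<bar> \<le> real M * r" for n
      unfolding right_diff_distrib[symmetric] abs_mult
      using lM W sieve_diff_le[of V' W r k n] \<open>0 < r\<close>
      by (intro mult_mono) (auto simp: abs_minus_commute)
    have cover: "approx_spectrum (schr (\<lambda>n. l * sieve k W n)) \<subseteq>
        (\<Union>y\<in>Y. cball y (2 * \<rho> j)) \<union> (\<Union>z\<in>exceptional k. cball z (2 * \<eta>))"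
    proof
      fix E assume "E \<in> approx_spectrum (schr (\<lambda>n. l * sieve k W n))"
      then obtain E1 where E1: "E1 \<in> approx_spectrum (schr (\<lambda>n. l * sieve k V' n))"
        "\<bar>E1 - E\<bar> \<le> real M * r + min \<eta> (\<rho> j) / 2"
        using approx_spectrum_schr_perturb[OF bW(2) bW(1) near, of E "min \<eta> (\<rho> j) / 2"]
          \<open>0 < \<eta>\<close> \<rho>_pos[of j] by (metis half_gt_zero min_less_iff_conj)
      then have E1E: "\<bar>E1 - E\<bar> \<le> \<eta>" "\<bar>E1 - E\<bar> \<le> \<rho> j" using Mr by linarith+
      show "E \<in> (\<Union>y\<in>Y. cball y (2 * \<rho> j)) \<union> (\<Union>z\<in>exceptional k. cball z (2 * \<eta>))"
      \<comment> \<open>The distinction is made at E1 rather than E: the block structure is that of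
        V', so localisation applies to its spectrum.\<close>
      proof (cases "\<forall>z\<in>exceptional k. \<eta> \<le> \<bar>E1 - z\<bar>")
        case True
        have "\<bar>E1\<bar> \<le> R"
        proof (rule symmetric_operator.approx_spectrum_bound[OF symmetric_operator_jacobi _ E1(1)])
          fix u
          have "\<bar>l * sieve k V' n\<bar> \<le> real M * B" for n
            unfolding abs_mult using lM \<open>0 \<le> B\<close> sieve_bounded[of V' B k n, OF V'B]
            by (intro mult_mono) auto
          then show "norm (schr (\<lambda>n. l * sieve k V' n) u) \<le> R * norm u"
            unfolding R_def by (rule norm_schr_le)
        qed
        then obtain i where i: "i < T" "bounded_below (schr (\<lambda>n. l * sieve k (U i) n)) E1 d"
          using gaps[OF k l _ True] by blast
        obtain y where "y \<in> box_eigenvalues (\<lambda>n. l * sieve k V' n) (c i) Q" "\<bar>y - E1\<bar> \<le> \<rho> j"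
          using spectrum_interleave[where U = U and q = q and T = T and i = i and k = k and l = l
              and j = j, OF U(1) \<open>0 < q\<close> i(1) _ i(2) \<open>0 < d\<close>] E1(1) k
          unfolding V'_def L_def c_def Q_def \<rho>_def by auto
        then have "y \<in> Y" "\<bar>y - E\<bar> \<le> 2 * \<rho> j" using i(1) E1E(2) unfolding Y_def by (blast, linarith)
        then show ?thesis by (auto simp: dist_real_def)
      next
        case False
        then obtain z where "z \<in> exceptional k" "\<bar>E1 - z\<bar> < \<eta>" by (auto simp: not_le)
        moreover from this have "\<bar>z - E\<bar> \<le> 2 * \<eta>" using E1E(1) by linarith
        ultimately show ?thesis by (auto simp: dist_real_def)
      qed
    qed
    have "finite Y" unfolding Y_def by (intro finite_UN_I box_eigenvalues_finite) simp
    have cardY: "card Y \<le> T * (M * (T * L))"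
    proof -
      have "card Y \<le> (\<Sum>i<T. card (box_eigenvalues (\<lambda>n. l * sieve k V' n) (c i) Q))"
        unfolding Y_def by (rule card_UN_le) simp
      also have "\<dots> \<le> (\<Sum>i<T. Q)" by (intro sum_mono box_eigenvalues_finite)
      also have "\<dots> \<le> T * (M * (T * L))" using k by (simp add: Q_def)
      finally show ?thesis .
    qed
    have cardZ: "card (exceptional k) \<le> M"
    proof -
      have "k - 1 \<le> M" using k by (intro diff_le_self[THEN order_trans]) simp
      then show ?thesis by (rule order_trans[OF box_eigenvalues_finite(2)])
    qed
    show ?thesis
    proof (rule thin_two_radii[OF \<open>finite Y\<close> box_eigenvalues_finite(1) _ _ \<open>0 < M\<close> cover])
      have "real (card Y) * (2 * (2 * \<rho> j)) powr (1 / real M) \<le>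
          real (T * (M * (T * L))) * (2 * (2 * \<rho> j)) powr (1 / real M)"
        using cardY by (intro mult_right_mono) (simp_all only: of_nat_le_iff powr_ge_zero)
      then show "real (card Y) * (2 * (2 * \<rho> j)) powr (1 / real M) < 1 / (2 * real M)"
        using j unfolding L_def by linarith
      have "real (card (exceptional k)) * (2 * (2 * \<eta>)) powr (1 / real M) \<le>
          real M * (2 * (2 * \<eta>)) powr (1 / real M)"
        using cardZ by (intro mult_right_mono) (simp_all only: of_nat_le_iff powr_ge_zero)
      then show "real (card (exceptional k)) * (2 * (2 * \<eta>)) powr (1 / real M) < 1 / (2 * real M)"
        using eta by linarith
    qed (use \<rho>_pos \<open>0 < \<eta>\<close> in auto)
  qed
  then have "sieves_thin M W" if "\<forall>n. \<bar>W n - V' n\<bar> \<le> r" for W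
    using that unfolding sieves_thin_def by blast
  moreover have "0 < T * L" using \<open>0 < T\<close> \<open>0 < q\<close> by (simp add: L_def)
  ultimately show ?thesis using \<open>0 < r\<close> V'_per V'V by blast
qed


section \<open>Cantor spectra of dimension zero\<close>

text \<open>A single term of the sum is already below 1 / M \<le> 1, so every diameter is at most 1;
  for such numbers the power 1 / M can only increase the value, so the diameter itself is below 1 /
  M.\<close>

lemma thin_small_cover:
  assumes "thin M K" "0 < M"
  obtains A where "finite A" "K \<subseteq> (\<Union>a\<in>A. cball (fst a) (snd a))"
    "\<And>a. a \<in> A \<Longrightarrow> 0 < snd a \<and> 2 * snd a \<le> 1 / real M \<and> 2 * snd a \<le> 1"
    "(\<Sum>a\<in>A. (2 * snd a) powr (1 / real M)) < 1 / real M"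
proof -
  obtain A :: "(real \<times> real) set" where A: "finite A" "\<And>a. a \<in> A \<Longrightarrow> 0 < snd a"
    "K \<subseteq> (\<Union>a\<in>A. cball (fst a) (snd a))" "(\<Sum>a\<in>A. (2 * snd a) powr (1 / real M)) < 1 / real M"
    using assms(1) unfolding thin_def by blast
  have "2 * snd a \<le> 1 / real M" "2 * snd a \<le> 1" if a: "a \<in> A" for a
  proof -
    define t where "t = 2 * snd a"
    have t: "0 < t" using A(2)[OF a] by (simp add: t_def)
    have "t powr (1 / real M) \<le> (\<Sum>a\<in>A. (2 * snd a) powr (1 / real M))"
      unfolding t_def by (rule member_le_sum[OF a]) (use A(1) in auto)
    then have lt: "t powr (1 / real M) < 1 / real M" using A(4) by linarith
    moreover have "1 / real M \<le> 1" using \<open>0 < M\<close> by simp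
    ultimately have "t powr (1 / real M) < 1" by linarith
    have "t \<le> 1"
    proof (rule ccontr)
      assume "\<not> t \<le> 1"
      then have "1 \<le> t powr (1 / real M)" by (intro ge_one_powr_ge_zero) auto
      then show False using \<open>t powr (1 / real M) < 1\<close> by simp
    qed
    then have "t powr 1 \<le> t powr (1 / real M)" using t \<open>1 / real M \<le> 1\<close> by (intro powr_mono') auto
    then show "2 * snd a \<le> 1 / real M" "2 * snd a \<le> 1" using lt t \<open>t \<le> 1\<close> by (simp_all add: t_def)
  qed
  then show ?thesis using A that by blast
qed

lemma hausdorff_premeasure_le:
  fixes K :: "real set"
  assumes "finite A" "K \<subseteq> (\<Union>a\<in>A. cball (fst a) (snd a))"
    and "\<And>a. a \<in> A \<Longrightarrow> 0 < snd a \<and> 2 * snd a \<le> \<delta>" and "0 < \<delta>" "0 < s"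
  shows "hausdorff_premeasure \<delta> s K \<le> ennreal (\<Sum>a\<in>A. (2 * snd a) powr s)"
proof -
  obtain h where h: "bij_betw h {0..<card A} A" using ex_bij_betw_nat_finite[OF assms(1)] by blast
  \<comment> \<open>The finite cover is padded with empty sets, which have diameter 0 and contribute
    \<open>0 powr s = 0\<close>.\<close>
  define U where "U i = (if i < card A then cball (fst (h i)) (snd (h i)) else {})" for i
  have hA: "h i \<in> A" if "i < card A" for i using h that by (auto simp: bij_betw_def)
  have diam: "diameter (U i) = (if i < card A then 2 * snd (h i) else 0)" for i
    using assms(3)[OF hA, of i] by (cases "i < card A") (auto simp: U_def diameter_cball)
  have "K \<subseteq> (\<Union>i. U i)"
  proof
    fix x assume "x \<in> K"
    then obtain a where a: "a \<in> A" "x \<in> cball (fst a) (snd a)" using assms(2) by blast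
    have "a \<in> h ` {0..<card A}" using a(1) h by (simp add: bij_betw_def)
    then obtain i where "i < card A" "h i = a" by auto
    then show "x \<in> (\<Union>i. U i)" using a(2) by (intro UN_I[of i]) (simp_all add: U_def)
  qed
  moreover have "bounded (U i) \<and> diameter (U i) \<le> \<delta>" for i
    unfolding diam using assms(3)[OF hA, of i] \<open>0 < \<delta>\<close> by (simp add: U_def)
  ultimately have "hausdorff_premeasure \<delta> s K \<le> (\<Sum>i. ennreal (diameter (U i) powr s))"
    unfolding hausdorff_premeasure_def by (intro INF_lower) simp
  also have "\<dots> = (\<Sum>i\<in>{0..<card A}. ennreal (diameter (U i) powr s))"
    by (rule suminf_finite) (auto simp: diam)
  also have "\<dots> = (\<Sum>i\<in>{0..<card A}. ennreal ((2 * snd (h i)) powr s))"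
    by (intro sum.cong) (auto simp: diam)
  also have "\<dots> = (\<Sum>a\<in>A. ennreal ((2 * snd a) powr s))"
    by (rule sum.reindex_bij_betw[OF h])
  finally show ?thesis by (simp add: sum_ennreal)
qed

text \<open>One M above 1 / \<delta>, 1 / s and 1 / e settles scale, exponent and size together: the
  diameters are at most 1, so passing from exponent 1 / M to the larger s only decreases the
  sum.\<close>

lemma hausdorff_dim_0_if_thin:
  assumes thin: "\<And>m. \<exists>M\<ge>m. thin M K"
  shows "hausdorff_dim K = 0"
proof -
  have "hausdorff_premeasure \<delta> s K = 0" if "0 < \<delta>" "0 < s" for \<delta> s
  proof -
    have "hausdorff_premeasure \<delta> s K \<le> 0 + ennreal e" if "0 < e" for e
    proof -
      obtain m :: nat where m: "1 / \<delta> < m" "1 / s < m" "1 / e < m"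
        by (metis reals_Archimedean2 max_less_iff_conj)
      then have "0 < real m" using \<open>0 < \<delta>\<close> by (meson less_trans zero_less_divide_1_iff)
      obtain M where "M \<ge> m" and M: "thin M K" using thin by blast
      have "0 < M" using \<open>0 < real m\<close> \<open>M \<ge> m\<close> by simp
      have *: "1 / real M \<le> x" if "0 < x" "1 / x < real m" for x
      proof -
        have "1 / x < real M" using that(2) \<open>M \<ge> m\<close> by (meson less_le_trans of_nat_le_iff)
        then show ?thesis using that(1) \<open>0 < M\<close> by (simp add: field_simps)
      qed
      have small: "1 / real M \<le> \<delta>" "1 / real M \<le> s" "1 / real M \<le> e"
        using * m that \<open>0 < \<delta>\<close> \<open>0 < s\<close> by simp_all
      obtain A where A: "finite A" "K \<subseteq> (\<Union>a\<in>A. cball (fst a) (snd a))"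
        "\<And>a. a \<in> A \<Longrightarrow> 0 < snd a \<and> 2 * snd a \<le> 1 / real M \<and> 2 * snd a \<le> 1"
        "(\<Sum>a\<in>A. (2 * snd a) powr (1 / real M)) < 1 / real M"
        by (rule thin_small_cover[OF M \<open>0 < M\<close>]) (rule that)
      have "hausdorff_premeasure \<delta> s K \<le> ennreal (\<Sum>a\<in>A. (2 * snd a) powr s)"
        by (rule hausdorff_premeasure_le[OF A(1,2)])
          (use A(3) small(1) \<open>0 < \<delta>\<close> \<open>0 < s\<close> in \<open>auto intro: order_trans\<close>)
      also have "\<dots> \<le> ennreal e"
      proof (rule ennreal_leI)
        have "(\<Sum>a\<in>A. (2 * snd a) powr s) \<le> (\<Sum>a\<in>A. (2 * snd a) powr (1 / real M))"
        proof (rule sum_mono)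
          fix a assume "a \<in> A"
          then show "(2 * snd a) powr s \<le> (2 * snd a) powr (1 / real M)"
            using A(3)[of a] small(2) by (intro powr_mono') auto
        qed
        then show "(\<Sum>a\<in>A. (2 * snd a) powr s) \<le> e" using A(4) small(3) by linarith
      qed
      finally show ?thesis by simp
    qed
    then have "hausdorff_premeasure \<delta> s K \<le> 0" by (rule ennreal_le_epsilon)
    then show ?thesis by simp
  qed
  then have "hausdorff_measure s K = 0" if "0 < s" for s
    using that unfolding hausdorff_measure_def by (simp add: SUP_eq_const)
  then have "hausdorff_dim K \<le> 0 + ennreal e" if "0 < e" for e
    unfolding hausdorff_dim_def using that by (intro INF_lower2[of e]) auto
  then have "hausdorff_dim K \<le> 0" by (rule ennreal_le_epsilon)
  then show ?thesis by simp
qed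

text \<open>Diameters at most 1 are bounded by their powers 1 / M, so the total length of the cover
  is below 1 / M, eventually less than the length of any given interval.\<close>

lemma interior_empty_if_thin:
  assumes thin: "\<And>m. \<exists>M\<ge>m. thin M K"
  shows "interior K = {}"
proof (rule ccontr)
  assume "interior K \<noteq> {}"
  then obtain x r where r: "0 < r" "cball x r \<subseteq> K"
    by (metis ex_in_conv mem_interior_cball)
  obtain m :: nat where m: "1 / (2 * r) < m" using reals_Archimedean2 by blast
  then have "0 < real m" using r(1) by (meson less_trans zero_less_divide_1_iff zero_less_mult_iff zero_less_numeral)
  obtain M where "M \<ge> m" and M: "thin M K" using thin by blast
  have "0 < M" using \<open>0 < real m\<close> \<open>M \<ge> m\<close> by simp
  obtain A where A: "finite A" "K \<subseteq> (\<Union>a\<in>A. cball (fst a) (snd a))"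
    "\<And>a. a \<in> A \<Longrightarrow> 0 < snd a \<and> 2 * snd a \<le> 1 / real M \<and> 2 * snd a \<le> 1"
    "(\<Sum>a\<in>A. (2 * snd a) powr (1 / real M)) < 1 / real M"
    by (rule thin_small_cover[OF M \<open>0 < M\<close>]) (rule that)
  have len: "emeasure lborel (cball y t) = ennreal (2 * t)" if "0 < t" for y t :: real
    using that by (simp add: cball_eq_atLeastAtMost)
  have "ennreal (2 * r) \<le> emeasure lborel (\<Union>a\<in>A. cball (fst a) (snd a))"
    unfolding len[OF r(1), of x, symmetric] using r(2) A(1,2) by (intro emeasure_mono) auto
  also have "\<dots> \<le> (\<Sum>a\<in>A. emeasure lborel (cball (fst a) (snd a)))"
    by (rule emeasure_subadditive_finite) (use A(1) in auto)
  also have "\<dots> = (\<Sum>a\<in>A. ennreal (2 * snd a))"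
    using A(3) by (intro sum.cong refl len) auto
  also have "\<dots> = ennreal (\<Sum>a\<in>A. 2 * snd a)"
    by (rule sum_ennreal) (use A(3) in \<open>auto simp: less_imp_le\<close>)
  finally have "2 * r \<le> (\<Sum>a\<in>A. 2 * snd a)"
    using A(3) by (subst (asm) ennreal_le_iff) (auto intro!: sum_nonneg simp: less_imp_le)
  also have "\<dots> \<le> (\<Sum>a\<in>A. (2 * snd a) powr (1 / real M))"
  proof (rule sum_mono)
    fix a assume "a \<in> A"
    then have "(2 * snd a) powr 1 \<le> (2 * snd a) powr (1 / real M)"
      using A(3)[of a] \<open>0 < M\<close> by (intro powr_mono') auto
    then show "2 * snd a \<le> (2 * snd a) powr (1 / real M)" using A(3)[OF \<open>a \<in> A\<close>] by simp
  qed
  finally have "2 * r < 1 / real M" using A(4) by linarith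
  moreover have "1 / (2 * r) < real M" using m \<open>M \<ge> m\<close> by (meson less_le_trans of_nat_le_iff)
  ultimately show False using r(1) \<open>0 < M\<close> by (simp add: field_simps)
qed

section \<open>Limit-periodic potentials and genericity\<close>

lemma periodic_funE:
  assumes "periodic_fun V"
  obtains p :: nat where "0 < p" "\<And>n. V (n + int p) = V n"
proof -
  obtain p where "p > 0" "\<And>n. V (n + p) = V n" using assms by (auto simp: periodic_fun_def)
  then show ?thesis using that[of "nat p"] by simp
qed

lemma limit_periodic_approx:
  assumes "V \<in> limit_periodic" "0 < e"
  obtains V0 where "periodic_fun (apply_bcontfun V0)" "dist V0 V < e"
  using assms unfolding limit_periodic_def closure_approachable by blast

lemma abs_apply_diff_le_dist: "\<bar>apply_bcontfun V n - apply_bcontfun W n\<bar> \<le> dist V W"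
  for V W :: "int \<Rightarrow>\<^sub>C real"
  using dist_bounded[of V n W] by (simp add: dist_real_def)

text \<open>Sieving turns a period p into k p and does not increase uniform distances, so the sieved
  periodic approximants provide the almost periods.\<close>

lemma sieve_limit_periodic_almost_periodic:
  assumes V: "V \<in> limit_periodic" and "k \<ge> 1" "0 < e"
  shows "\<exists>q>0. \<forall>i n. \<bar>c * sieve k (apply_bcontfun V) (n + i * int q) - c * sieve k (apply_bcontfun V) n\<bar> \<le> e"
proof -
  define s where "s = \<bar>c\<bar> + 1"
  define t where "t = e / (2 * s)"
  have "0 < s" by (simp add: s_def add_nonneg_pos)
  then have "0 < t" using \<open>0 < e\<close> by (simp add: t_def)
  obtain V0 where V0: "periodic_fun (apply_bcontfun V0)" "dist V0 V < t"
    by (rule limit_periodic_approx[OF V \<open>0 < t\<close>])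
  obtain p where p: "0 < p" "\<And>n. apply_bcontfun V0 (n + int p) = apply_bcontfun V0 n"
    by (rule periodic_funE[OF V0(1)]) blast
  define f g where "f n = sieve k (apply_bcontfun V) n" and "g n = sieve k (apply_bcontfun V0) n" for n
  have fg: "\<bar>f n - g n\<bar> \<le> t" for n
    unfolding f_def g_def
  proof (rule sieve_diff_le)
    show "\<bar>apply_bcontfun V m - apply_bcontfun V0 m\<bar> \<le> t" for m
      using abs_apply_diff_le_dist[of V m V0] V0(2) by (simp add: dist_commute)
  qed
  have g_per: "g (n + int (k * p)) = g n" for n
    unfolding g_def by (rule sieve_periodic[of "apply_bcontfun V0" p, OF p(2)])
  have "\<bar>c * f (n + i * int (k * p)) - c * f n\<bar> \<le> e" for i n
  proof -
    have "g (n + i * int (k * p)) = g n" by (rule periodic_mult[of g "int (k * p)", OF g_per])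
    then have "\<bar>f (n + i * int (k * p)) - f n\<bar> \<le> 2 * t"
      using fg[of n] fg[of "n + i * int (k * p)"] by linarith
    then have "\<bar>c\<bar> * \<bar>f (n + i * int (k * p)) - f n\<bar> \<le> s * (2 * t)"
      using \<open>0 < t\<close> by (intro mult_mono) (auto simp: s_def)
    also have "\<dots> = e" using \<open>0 < s\<close> by (simp add: t_def)
    finally show ?thesis by (simp only: right_diff_distrib[symmetric] abs_mult)
  qed
  then show ?thesis using p(1) \<open>k \<ge> 1\<close> unfolding f_def by (intro exI[of _ "k * p"]) auto
qed

text \<open>Being a union of balls on which the property is known, this set is open by construction;
  the radius comes from the stability statement in \<open>periodic_near_sieves_thin\<close>.\<close>

definition thin_neighbourhood :: "nat \<Rightarrow> (int \<Rightarrow>\<^sub>C real) set" where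
  "thin_neighbourhood M = (\<Union>(V, r)\<in>{(V, r). \<forall>W. (\<forall>n. \<bar>W n - apply_bcontfun V n\<bar> \<le> r) \<longrightarrow> sieves_thin M W}. ball V r)"

lemma open_thin_neighbourhood: "open (thin_neighbourhood M)"
  unfolding thin_neighbourhood_def by (intro open_UN) auto

lemma thin_neighbourhood_sieves_thin:
  assumes "V \<in> thin_neighbourhood M"
  shows "sieves_thin M (apply_bcontfun V)"
proof -
  obtain V0 r where V0: "dist V0 V < r" "\<And>W. (\<And>n. \<bar>W n - apply_bcontfun V0 n\<bar> \<le> r) \<Longrightarrow> sieves_thin M W"
    using assms by (auto simp: thin_neighbourhood_def)
  show ?thesis
  proof (rule V0(2))
    show "\<bar>apply_bcontfun V n - apply_bcontfun V0 n\<bar> \<le> r" for n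
      using abs_apply_diff_le_dist[of V n V0] V0(1) by (simp add: dist_commute)
  qed
qed

lemma dense_thin_neighbourhood:
  assumes "0 < M"
  shows "limit_periodic \<subseteq> closure (limit_periodic \<inter> thin_neighbourhood M)"
proof
  fix V assume V: "V \<in> limit_periodic"
  show "V \<in> closure (limit_periodic \<inter> thin_neighbourhood M)"
    unfolding closure_approachable
  proof (intro allI impI)
    fix e :: real assume "0 < e"
    obtain V0 where V0: "periodic_fun (apply_bcontfun V0)" "dist V0 V < e / 2"
      by (rule limit_periodic_approx[OF V, of "e / 2"]) (use \<open>0 < e\<close> in auto)
    obtain p where p: "0 < p" "\<And>n. apply_bcontfun V0 (n + int p) = apply_bcontfun V0 n"
      by (rule periodic_funE[OF V0(1)]) blast
    obtain P V' r where V': "0 < P \<and> 0 < r \<and> (\<forall>n. V' (n + int P) = V' n) \<and>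
        (\<forall>n. \<bar>V' n - apply_bcontfun V0 n\<bar> \<le> e / 2) \<and> (\<forall>W. (\<forall>n. \<bar>W n - V' n\<bar> \<le> r) \<longrightarrow> sieves_thin M W)"
      using periodic_near_sieves_thin[where V = "apply_bcontfun V0" and p = p and e = "e / 2" and M = M,
          OF p _ \<open>0 < M\<close>] \<open>0 < e\<close> by auto
    define V1 where "V1 = Bcontfun V'"
    have "bounded (range V')" using V' by (intro bounded_range_periodic[of P]) auto
    then have V1: "apply_bcontfun V1 = V'"
      unfolding V1_def by (intro Bcontfun_inverse) (simp add: bcontfun_int_iff)
    have "periodic_fun (apply_bcontfun V1)"
      unfolding V1 periodic_fun_def using V' by (intro exI[of _ "int P"]) simp
    then have "V1 \<in> limit_periodic" unfolding limit_periodic_def by (intro subsetD[OF closure_subset]) simp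
    moreover have "V1 \<in> thin_neighbourhood M"
      unfolding thin_neighbourhood_def using V' by (intro UN_I[of "(V1, r)"]) (auto simp: V1)
    moreover have "dist V1 V0 \<le> e / 2"
      by (rule dist_bound) (use V' in \<open>simp add: V1 dist_real_def\<close>)
    then have "dist V1 V < e" using V0(2) dist_triangle[of V1 V V0] by linarith
    ultimately show "\<exists>y\<in>limit_periodic \<inter> thin_neighbourhood M. dist y V < e" by blast
  qed
qed

lemma rl2_nontrivial: "\<exists>u :: rl2. u \<noteq> 0"
proof -
  have "(\<lambda>n :: int. (indicat_real {0} n)\<^sup>2) summable_on UNIV"
    by (rule finite_nonzero_values_imp_summable_on) (simp add: indicator_def)
  then have "seq (Abs_rl2 (indicat_real {0})) 0 = 1" by (subst Abs_rl2_inverse) simp_all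
  then show ?thesis by (metis seq_zero zero_neq_one)
qed

lemma cantor_spectrum:
  assumes V: "V \<in> limit_periodic" and thin: "\<And>M. 0 < M \<Longrightarrow> sieves_thin M (apply_bcontfun V)"
    and "c \<noteq> 0" "k \<ge> 1"
  defines "W \<equiv> \<lambda>n. c * sieve k (apply_bcontfun V) n"
  shows "op_spectrum (schrodinger W) = complex_of_real ` approx_spectrum (schr W) \<and>
    cantor_set (approx_spectrum (schr W)) \<and> hausdorff_dim (approx_spectrum (schr W)) = 0"
proof -
  interpret T: symmetric_operator "schr W" by (rule symmetric_operator_jacobi)
  have "\<bar>apply_bcontfun V n\<bar> \<le> norm V" for n using norm_bounded[of V n] by simp
  then have bW: "bounded (range W)" unfolding W_def by (rule bounded_range_scaled_sieve)
  have thinK: "\<exists>M\<ge>m. thin M (approx_spectrum (schr W))" for m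
  proof -
    obtain a :: nat where a: "\<bar>c\<bar> < a" using reals_Archimedean2 by blast
    obtain b :: nat where b: "1 / \<bar>c\<bar> < b" using reals_Archimedean2 by blast
    define M where "M = m + k + a + b"
    have "\<bar>c\<bar> \<le> real M" using a by (simp add: M_def)
    moreover have "1 / \<bar>c\<bar> \<le> real M" using b by (simp add: M_def)
    then have "1 / real M \<le> \<bar>c\<bar>" using \<open>c \<noteq> 0\<close> \<open>k \<ge> 1\<close> by (simp add: M_def field_simps)
    ultimately have "c \<in> coupling_range M" by (simp add: coupling_range_def)
    moreover have "k \<in> {1..M}" "0 < M" using \<open>k \<ge> 1\<close> by (auto simp: M_def)
    ultimately have "thin M (approx_spectrum (schr W))"
      using thin unfolding sieves_thin_def W_def by blast
    then show ?thesis by (intro exI[of _ M]) (simp add: M_def)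
  qed
  have "\<not> E isolated_in approx_spectrum (schr W)" for E
    by (rule almost_periodic_no_isolated_spectrum[OF bW])
      (unfold W_def, rule sieve_limit_periodic_almost_periodic[OF V \<open>k \<ge> 1\<close>])
  then have "cantor_set (approx_spectrum (schr W))"
    unfolding cantor_set_def
    using T.approx_spectrum_nonempty[OF rl2_nontrivial] T.compact_approx_spectrum
      interior_empty_if_thin[OF thinK] by blast
  then show ?thesis using op_spectrum_schrodinger[OF bW] hausdorff_dim_0_if_thin[OF thinK] by blast
qed

text \<open>
  The library proves completeness of \<^typ>\<open>'a \<Rightarrow>\<^sub>C 'b\<close> only over a metric domain, which
  \<^typ>\<open>int\<close> is not.
\<close>

lemma complete_bcontfun: "complete (UNIV :: ('a::topological_space \<Rightarrow>\<^sub>C 'b::complete_space) set)"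
  unfolding complete_def
proof (intro allI impI)
  fix f :: "nat \<Rightarrow> 'a \<Rightarrow>\<^sub>C 'b"
  assume "(\<forall>n. f n \<in> UNIV) \<and> Cauchy f"
  then have "Cauchy f" by simp
  then obtain g where "uniform_limit UNIV f g sequentially"
    using uniformly_convergent_eq_cauchy[of "\<lambda>_. True" f]
    unfolding Cauchy_def uniform_limit_sequentially_iff
    by (metis dist_fun_lt_imp_dist_val_lt)
  from uniform_limit_bcontfunE[OF this sequentially_bot] obtain l where "f \<longlonglongrightarrow> l" by metis
  then show "\<exists>l\<in>UNIV. f \<longlonglongrightarrow> l" by blast
qed

theorem theorem1p1:
  shows "\<exists>G :: (int \<Rightarrow>\<^sub>C real) set.
    gdelta_in (top_of_set limit_periodic) G \<and>
    (top_of_set limit_periodic) closure_of G = limit_periodic \<and>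
    (\<forall>V\<in>G. \<forall>c::real. \<forall>k::nat. c \<noteq> 0 \<longrightarrow> k \<ge> 1 \<longrightarrow>
      (\<exists>K :: real set.
        op_spectrum (schrodinger (\<lambda>n. c * sieve k (apply_bcontfun V) n)) = complex_of_real ` K \<and>
        cantor_set K \<and> hausdorff_dim K = 0))"
proof -
  \<comment> \<open>Indices start at \<open>Suc 0\<close>, because density is established for
    \<open>0 < M\<close>.\<close>
  define \<G> where "\<G> = (\<lambda>m. limit_periodic \<inter> thin_neighbourhood (Suc m)) ` UNIV"
  have op: "openin (top_of_set limit_periodic) T" if "T \<in> \<G>" for T
    using that open_thin_neighbourhood by (auto simp: \<G>_def openin_open)
  have "completely_metrizable_space (euclidean :: (int \<Rightarrow>\<^sub>C real) topology)"
    using Met_TC.completely_metrizable_space_mtopology complete_bcontfun by auto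
  then have "completely_metrizable_space (top_of_set limit_periodic)"
    by (rule completely_metrizable_space_closedin) (simp add: limit_periodic_def)
  moreover have "countable \<G>" by (simp add: \<G>_def)
  moreover have "top_of_set limit_periodic closure_of T = limit_periodic" if T: "T \<in> \<G>" for T
  proof -
    obtain m where "T = limit_periodic \<inter> thin_neighbourhood (Suc m)" using T by (auto simp: \<G>_def)
    then show ?thesis
      using dense_thin_neighbourhood[of "Suc m"] by (auto simp: closure_of_subtopology Int_absorb1)
  qed
  ultimately have dense: "top_of_set limit_periodic closure_of \<Inter>\<G> = limit_periodic"
    using Baire_category[of "top_of_set limit_periodic" \<G>] op by simp
  have "gdelta_in (top_of_set limit_periodic) (\<Inter>\<G>)"
    by (rule gdelta_in_Inter) (use op \<open>countable \<G>\<close> in \<open>auto simp: \<G>_def intro: open_imp_gdelta_in\<close>)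
  moreover have "\<exists>K :: real set.
      op_spectrum (schrodinger (\<lambda>n. c * sieve k (apply_bcontfun V) n)) = complex_of_real ` K \<and>
      cantor_set K \<and> hausdorff_dim K = 0" if "V \<in> \<Inter>\<G>" "c \<noteq> 0" "k \<ge> 1" for V c k
  proof -
    have "V \<in> limit_periodic" using that(1) by (auto simp: \<G>_def)
    moreover have "sieves_thin M (apply_bcontfun V)" if "0 < M" for M
      using \<open>V \<in> \<Inter>\<G>\<close> that thin_neighbourhood_sieves_thin[of V M]
      by (auto simp: \<G>_def dest!: spec[of _ "M - 1"])
    ultimately show ?thesis using cantor_spectrum that(2,3) by blast
  qed
  ultimately show ?thesis using dense by blast
qed

end
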